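(* Let $A=\bigcup_n A_n$ be a family of combinatorial objects and let $\{G_w(x):w\in A\}$ be a family of symmetric polynomials in $x=(x_1,\ldots,x_n)$ such that $G_w=\sum_\alpha c_{w\alpha}F_\alpha$, where $\alpha$ ranges over compositions with at most $n$ positive parts and the function $(w,\alpha)\mapsto c_{w\alpha}$ is in $\mathsf{GapP}$. Define $d_{w\lambda}$ by $G_w=\sum_\lambda d_{w\lambda}s_\lambda$, the sum over partitions $\lambda$ with at most $n$ parts. Then $(w,\lambda)\mapsto d_{w\lambda}$ is in $\mathsf{GapP}$. The same conclusion holds if the fundamental quasisymmetric polynomials $F_\alpha$ in the hypothesis are replaced by the monomial quasisymmetric polynomials $M_\alpha$.
   Context: $M_\alpha=\sum_{1\le i_1<\cdots<i_\ell\le n}x_{i_1}^{\alpha_1}\cdots x_{i_\ell}^{\alpha_\ell}$; $F_\alpha=\sum_{\beta\preccurlyeq\alpha}M_\beta$, where $\beta\preccurlyeq\alpha$ means $\alpha$ is obtained from $\beta$ by adding consecutive parts. $s_\lambda$ are Schur polynomials. Objects in $A_n$ are binary words of size $n$; partitions and compositions are encoded in unary. $\#\mathsf{P}$ = functions counting polynomially bounded witnesses of a polynomial-time decidable relation; $\mathsf{GapP}=\#\mathsf{P}-\#\mathsf{P}$. *)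

theory Defs
  imports
    "HOL-Library.Poly_Mapping"
    "HOL-Combinatorics.Permutations"
    "HOL-Computational_Algebra.Polynomial"
begin

section \<open>Deterministic multi-tape Turing machines and polynomial time\<close>

text \<open>
  States and tape symbols are initial segments of the naturals. State 0 is initial, state 1 accepts,
  state 2 rejects; symbol 0 is the blank, symbols 1 and 2 stand for the two input bits. Tapes are
  infinite in both directions. The transition function sees the scanned symbols of all tapes and
  yields the next state together with, for each tape, the symbol to write and the head movement.
\<close>

datatype move = Move_Left | Stay | Move_Right

record tm =
  tapes :: nat
  symbols :: nat
  states :: nat
  trans :: "nat \<Rightarrow> nat list \<Rightarrow> nat \<times> (nat \<times> move) list"

definition wf_tm :: "tm \<Rightarrow> bool" where
  "wf_tm M \<longleftrightarrow> tapes M \<ge> 1 \<and> symbols M \<ge> 3 \<and> states M \<ge> 3 \<and>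
     (\<forall>q ss. q < states M \<and> length ss = tapes M \<and> set ss \<subseteq> {..<symbols M} \<longrightarrow>
        fst (trans M q ss) < states M \<and>
        length (snd (trans M q ss)) = tapes M \<and>
        fst ` set (snd (trans M q ss)) \<subseteq> {..<symbols M})"

type_synonym tape = "(int \<Rightarrow> nat) \<times> int"
type_synonym config = "nat \<times> tape list"

definition scan :: "tape \<Rightarrow> nat" where
  "scan t = fst t (snd t)"

fun move_head :: "move \<Rightarrow> int \<Rightarrow> int" where
  "move_head Move_Left h = h - 1"
| "move_head Stay h = h"
| "move_head Move_Right h = h + 1"

definition act :: "nat \<times> move \<Rightarrow> tape \<Rightarrow> tape" where
  "act a t = ((fst t)(snd t := fst a), move_head (snd a) (snd t))"

definition step :: "tm \<Rightarrow> config \<Rightarrow> config" where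
  "step M cfg =
     (if fst cfg = 1 \<or> fst cfg = 2 then cfg
      else (let r = trans M (fst cfg) (map scan (snd cfg))
            in (fst r, map2 act (snd r) (snd cfg))))"

definition input_tape :: "bool list \<Rightarrow> tape" where
  "input_tape x =
     (\<lambda>i. if 0 \<le> i \<and> i < int (length x) then (if x ! nat i then 2 else 1) else 0, 0)"

definition blank_tape :: tape where
  "blank_tape = (\<lambda>_. 0, 0)"

definition init_config :: "tm \<Rightarrow> bool list \<Rightarrow> config" where
  "init_config M x = (0, input_tape x # replicate (tapes M - 1) blank_tape)"

definition decides_in_time :: "tm \<Rightarrow> bool list set \<Rightarrow> (nat \<Rightarrow> nat) \<Rightarrow> bool" where
  "decides_in_time M L T \<longleftrightarrow>
     (\<forall>x. \<exists>t \<le> T (length x).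
        fst ((step M ^^ t) (init_config M x)) = (if x \<in> L then 1 else 2))"

definition PTIME :: "bool list set set" where
  "PTIME = {L. \<exists>M (p :: nat poly). wf_tm M \<and> decides_in_time M L (poly p)}"


section \<open>Counting classes\<close>

text \<open>Self-delimiting pairing: the bits of the first word are doubled, and 01 is the separator.\<close>

definition word_pair :: "bool list \<Rightarrow> bool list \<Rightarrow> bool list" where
  "word_pair x y = concat (map (\<lambda>b. [b, b]) x) @ [False, True] @ y"

definition ptime_relation :: "(bool list \<times> bool list) set \<Rightarrow> bool" where
  "ptime_relation R \<longleftrightarrow> {word_pair x y | x y. (x, y) \<in> R} \<in> PTIME"

definition SharpP :: "(bool list \<Rightarrow> nat) set" where
  "SharpP = {f. \<exists>R (p :: nat poly). ptime_relation R \<and>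
     (\<forall>x. f x = card {y. length y \<le> poly p (length x) \<and> (x, y) \<in> R})}"

definition GapP :: "(bool list \<Rightarrow> int) set" where
  "GapP = {h. \<exists>f \<in> SharpP. \<exists>g \<in> SharpP. \<forall>x. h x = int (f x) - int (g x)}"

text \<open>
  A function defined only on some set \<open>D\<close> of objects, given by their encodings, is in GapP if
  it agrees on \<open>D\<close> with a GapP function on words.
\<close>

definition gapP_on :: "'a set \<Rightarrow> ('a \<Rightarrow> bool list) \<Rightarrow> ('a \<Rightarrow> int) \<Rightarrow> bool" where
  "gapP_on D enc f \<longleftrightarrow> (\<exists>h \<in> GapP. \<forall>a \<in> D. f a = h (enc a))"

definition unary :: "nat list \<Rightarrow> bool list" where
  "unary \<alpha> = concat (map (\<lambda>a. replicate a True @ [False]) \<alpha>)"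

definition encode :: "bool list \<times> nat list \<Rightarrow> bool list" where
  "encode p = word_pair (fst p) (unary (snd p))"


section \<open>Symmetric and quasisymmetric polynomials\<close>

text \<open>
  Polynomials with integer coefficients in variables indexed by naturals: finitely supported maps
  from monomials (finitely supported exponent vectors) to coefficients. The variables
  \<open>x\<^sub>1, \<dots>, x\<^sub>n\<close> are those with index in \<open>{1..n}\<close>.
\<close>

type_synonym mpoly = "(nat \<Rightarrow>\<^sub>0 nat) \<Rightarrow>\<^sub>0 int"

definition var :: "nat \<Rightarrow> mpoly" where
  "var i = Poly_Mapping.single (Poly_Mapping.single i 1) 1"

definition symmetric_poly :: "nat \<Rightarrow> mpoly \<Rightarrow> bool" where
  "symmetric_poly n g \<longleftrightarrow>
     (\<forall>m \<in> Poly_Mapping.keys g. Poly_Mapping.keys m \<subseteq> {1..n}) \<and>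
     (\<forall>\<pi>. \<pi> permutes {1..n} \<longrightarrow>
        (\<forall>m. Poly_Mapping.lookup g (Poly_Mapping.map_key \<pi> m) = Poly_Mapping.lookup g m))"

definition compositions :: "nat list set" where
  "compositions = {\<alpha>. \<forall>a \<in> set \<alpha>. a > 0}"

definition partitions :: "nat list set" where
  "partitions = {\<mu> \<in> compositions. sorted_wrt (\<ge>) \<mu>}"

definition comp_refines :: "nat list \<Rightarrow> nat list \<Rightarrow> bool" where
  "comp_refines \<beta> \<alpha> \<longleftrightarrow> (\<exists>bs. [] \<notin> set bs \<and> concat bs = \<beta> \<and> map sum_list bs = \<alpha>)"

definition monomial_qsym :: "nat \<Rightarrow> nat list \<Rightarrow> mpoly" where
  "monomial_qsym n \<alpha> =
     (\<Sum>is | length is = length \<alpha> \<and> sorted_wrt (<) is \<and> set is \<subseteq> {1..n}.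
        \<Prod>j < length \<alpha>. var (is ! j) ^ (\<alpha> ! j))"

definition fundamental_qsym :: "nat \<Rightarrow> nat list \<Rightarrow> mpoly" where
  "fundamental_qsym n \<alpha> = (\<Sum>\<beta> | \<beta> \<in> compositions \<and> comp_refines \<beta> \<alpha>. monomial_qsym n \<beta>)"

text \<open>Semistandard Young tableaux of shape \<open>\<mu>\<close> with entries in \<open>{1..n}\<close>, as lists of rows.\<close>

definition SSYT :: "nat \<Rightarrow> nat list \<Rightarrow> nat list list set" where
  "SSYT n \<mu> = {T. map length T = \<mu> \<and> set (concat T) \<subseteq> {1..n} \<and>
     (\<forall>r \<in> set T. sorted r) \<and>
     (\<forall>i j. Suc i < length T \<and> j < length (T ! Suc i) \<longrightarrow> T ! i ! j < T ! Suc i ! j)}"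

definition schur :: "nat \<Rightarrow> nat list \<Rightarrow> mpoly" where
  "schur n \<mu> = (\<Sum>T \<in> SSYT n \<mu>. prod_list (map var (concat T)))"

text \<open>
  \<open>g\<close> is the linear combination of the polynomials \<open>b i\<close>, \<open>i \<in> I\<close>, with coefficients \<open>c i\<close>,
  only finitely many of which are nonzero.
\<close>

definition expands_in :: "('i \<Rightarrow> mpoly) \<Rightarrow> 'i set \<Rightarrow> mpoly \<Rightarrow> ('i \<Rightarrow> int) \<Rightarrow> bool" where
  "expands_in b I g c \<longleftrightarrow>
     finite {i \<in> I. c i \<noteq> 0} \<and> g = (\<Sum>i | i \<in> I \<and> c i \<noteq> 0. of_int (c i) * b i)"

definition compositions_upto :: "nat \<Rightarrow> nat list set" where
  "compositions_upto n = {\<alpha> \<in> compositions. length \<alpha> \<le> n}"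

definition partitions_upto :: "nat \<Rightarrow> nat list set" where
  "partitions_upto n = {\<mu> \<in> partitions. length \<mu> \<le> n}"

end

theory Submission
  imports Defs "Jordan_Normal_Form.Determinant" "HOL-Library.Monad_Syntax"
begin

text \<open>
  Multiplying \<open>G\<close> by the Vandermonde product and using the bialternant formula for Schur
  polynomials, the coefficient \<open>d\<close> at a partition \<open>\<mu>\<close> of length \<open>n\<close> is the coefficient of the
  monomial with exponent \<open>\<mu> + \<delta>\<close> in the product of \<open>G\<close> and all \<open>x\<^sub>i - x\<^sub>j\<close> with \<open>i < j \<le> n\<close>.
  Expanding the product instead of writing it as a determinant gives a signed sum over all sets
  \<open>T\<close> of pairs \<open>i < j\<close> of the coefficient of \<open>G\<close> at the exponent vector
  \<open>\<mu> + \<Sum>\<^bsub>(i, j) \<in> T\<^esub> (e\<^sub>i - e\<^sub>j)\<close>, so that every bit string of the right length encodes a summand and only nonnegativity of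
  the exponents has to be verified. Such a coefficient is the monomial quasisymmetric coefficient
  at the composition of nonzero exponents, or the sum of the fundamental coefficients at all of
  its coarsenings. A witness for \<open>d\<close> thus consists of the bits of \<open>T\<close>, the bits of a coarsening,
  and a witness for \<open>c\<close>; the total size of the unary composition does not grow. Membership in
  polynomial time is shown by writing the verifier as a structured program over stacks of bits and
  compiling such programs to multi-tape Turing machines.
\<close>

section \<open>Turing machines from finite automata\<close>

definition stay :: "nat list \<Rightarrow> (nat \<times> move) list" where
  "stay ss = map (\<lambda>x. (x, Stay)) ss"

lemma length_stay [simp]: "length (stay ss) = length ss"
  by (simp add: stay_def)

lemma fst_set_stay: "fst ` set (stay ss) = set ss"
  by (force simp: stay_def)

lemma map2_act_stay: "map2 act (stay (map scan ts)) ts = ts"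
  by (auto simp: stay_def act_def scan_def list_eq_iff_nth_eq)

locale tm_automaton =
  fixes Q :: "'q set" and \<delta> :: "'q \<Rightarrow> nat list \<Rightarrow> 'q \<times> (nat \<times> move) list"
    and q_init q_accept q_reject :: 'q and num_tapes num_symbols :: nat
  assumes finite_Q: "finite Q" and special_in_Q: "{q_init, q_accept, q_reject} \<subseteq> Q"
    and special_distinct: "distinct [q_init, q_accept, q_reject]"
    and num_tapes_pos: "1 \<le> num_tapes" and num_symbols_ge: "3 \<le> num_symbols"
begin

definition admissible :: "'q \<times> (nat \<times> move) list \<Rightarrow> bool" where
  "admissible d \<longleftrightarrow> fst d \<in> Q \<and> length (snd d) = num_tapes \<and> fst ` set (snd d) \<subseteq> {..<num_symbols}"

definition realizes :: "tm \<Rightarrow> ('q \<Rightarrow> nat) \<Rightarrow> bool" where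
  "realizes S e \<longleftrightarrow> wf_tm S \<and> tapes S = num_tapes \<and> symbols S = num_symbols \<and>
     e q_init = 0 \<and> e q_accept = 1 \<and> e q_reject = 2 \<and> inj_on e Q \<and>
     (\<forall>q \<in> Q. \<forall>ss. admissible (\<delta> q ss) \<longrightarrow> trans S (e q) ss = map_prod e id (\<delta> q ss))"

lemma ex_state_numbering:
  "\<exists>(e :: 'q \<Rightarrow> nat) N. inj_on e Q \<and> e ` Q \<subseteq> {..<N} \<and> 3 \<le> N \<and> e q_init = 0 \<and> e q_accept = 1 \<and>
    e q_reject = 2"
proof -
  let ?special = "{q_init, q_accept, q_reject}"
  obtain f :: "'q \<Rightarrow> nat" and N where f: "f ` (Q - ?special) = {j. j < N}" "inj_on f (Q - ?special)"
    using finite_imp_inj_to_nat_seg[of "Q - ?special"] finite_Q by auto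
  define e where "e q = (if q = q_init then 0 else if q = q_accept then 1
    else if q = q_reject then 2 else f q + 3)" for q
  have "inj_on e Q"
  proof (rule inj_onI)
    fix x y assume "x \<in> Q" "y \<in> Q" "e x = e y"
    then show "x = y" using inj_onD[OF f(2), of x y] by (simp add: e_def split: if_splits)
  qed
  moreover have "e ` Q \<subseteq> {..<N + 3}" using f(1) by (auto simp: e_def)
  moreover have "e q_init = 0" "e q_accept = 1" "e q_reject = 2"
    using special_distinct by (auto simp: e_def)
  ultimately show ?thesis by (intro exI[of _ e] exI[of _ "N + 3"]) simp
qed

theorem ex_realization: "\<exists>S e. realizes S e"
proof -
  obtain e :: "'q \<Rightarrow> nat" and N where e: "inj_on e Q" "e ` Q \<subseteq> {..<N}" "3 \<le> N"
    "e q_init = 0" "e q_accept = 1" "e q_reject = 2"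
    using ex_state_numbering by blast
  define t where "t n ss = (let d = \<delta> (inv_into Q e n) ss in
    if admissible d then map_prod e id d else (0, replicate num_tapes (0, Stay)))" for n ss
  define S where "S = \<lparr>tapes = num_tapes, symbols = num_symbols, states = N, trans = t\<rparr>"
  have "wf_tm S"
    using num_tapes_pos num_symbols_ge e(2,3)
    by (auto simp: wf_tm_def S_def t_def Let_def admissible_def)
  moreover have "trans S (e q) ss = map_prod e id (\<delta> q ss)"
    if "q \<in> Q" "admissible (\<delta> q ss)" for q ss
    using that e(1) by (simp add: S_def t_def Let_def)
  ultimately have "realizes S e" using e by (simp add: realizes_def S_def)
  then show ?thesis by blast
qed

lemma step_realization:
  assumes "realizes S e" "q \<in> Q" "q \<noteq> q_accept" "q \<noteq> q_reject"
    and "\<delta> q (map scan ts) = (q', as)" "admissible (q', as)"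
  shows "step S (e q, ts) = (e q', map2 act as ts)"
proof -
  have "inj_on e Q" using assms(1) by (simp add: realizes_def)
  then have "e q \<noteq> e q_accept" "e q \<noteq> e q_reject"
    using assms(2-4) special_in_Q by (auto dest: inj_onD)
  then show ?thesis using assms by (simp add: realizes_def step_def)
qed

end


section \<open>Stack programs\<close>

type_synonym regs = "nat \<Rightarrow> bool list"

datatype com =
    Skip
  | Fail
  | Push nat bool
  | Pop nat
  | Seq com com  (infixr \<open>;;\<close> 60)
  | Case nat com com com
  | While nat com

fun control :: "com list \<Rightarrow> regs \<Rightarrow> com list option" where
  "control (Skip # l) s = Some l"
| "control ((a ;; b) # l) s = Some (a # b # l)"
| "control (Case r a b c # l) s =
     Some ((case s r of [] \<Rightarrow> a | x # _ \<Rightarrow> if x then c else b) # l)"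
| "control (While r a # l) s = Some (if s r = [] then l else a # While r a # l)"
| "control l s = None"

text \<open>
  The number counts the steps of the compiled machine exactly, of which a push takes two; the
  outcome \<open>None\<close> is rejection.
\<close>

inductive exec :: "com list \<Rightarrow> regs \<Rightarrow> nat \<Rightarrow> regs option \<Rightarrow> bool" where
  Done: "exec [] s 0 (Some s)"
| Fail: "exec (Fail # l) s 1 None"
| Push: "exec l (s(r := b # s r)) t out \<Longrightarrow> exec (Push r b # l) s (Suc (Suc t)) out"
| Pop: "exec l (s(r := tl (s r))) t out \<Longrightarrow> exec (Pop r # l) s (Suc t) out"
| Control: "control l s = Some l' \<Longrightarrow> exec l' s t out \<Longrightarrow> exec l s (Suc t) out"

fun reg_set :: "com \<Rightarrow> nat set" where
  "reg_set Skip = {}"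
| "reg_set Fail = {}"
| "reg_set (Push r b) = {r}"
| "reg_set (Pop r) = {r}"
| "reg_set (a ;; b) = reg_set a \<union> reg_set b"
| "reg_set (Case r a b c) = insert r (reg_set a \<union> reg_set b \<union> reg_set c)"
| "reg_set (While r a) = insert r (reg_set a)"

lemma reg_set_control: "control l s = Some l' \<Longrightarrow> (\<Union>c \<in> set l'. reg_set c) \<subseteq> (\<Union>c \<in> set l. reg_set c)"
  by (cases "(l, s)" rule: control.cases) (auto split: list.splits if_splits)

lemma exec_unchanged:
  "exec l s t (Some s') \<Longrightarrow> r \<notin> (\<Union>c \<in> set l. reg_set c) \<Longrightarrow> s' r = s r"
  by (induction l s t "Some s'" rule: exec.induct) (auto dest: reg_set_control)

lemma exec_length: "exec l s t (Some s') \<Longrightarrow> length (s' r) \<le> length (s r) + t"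
  by (induction l s t "Some s'" rule: exec.induct) (auto split: if_splits)

definition init_regs :: "bool list \<Rightarrow> regs" where
  "init_regs u = (\<lambda>_. [])(0 := u)"

definition starts_True :: "bool list \<Rightarrow> bool" where
  "starts_True xs \<longleftrightarrow> xs \<noteq> [] \<and> hd xs"

lemma starts_True_simps [simp]: "\<not> starts_True []" "starts_True (x # xs) \<longleftrightarrow> x"
  by (simp_all add: starts_True_def)

fun conts :: "com \<Rightarrow> com list \<Rightarrow> com list set" where
  "conts (a ;; b) l = insert ((a ;; b) # l) (conts a (b # l) \<union> conts b l)"
| "conts (Case r a b c) l = insert (Case r a b c # l) (conts a l \<union> conts b l \<union> conts c l)"
| "conts (While r a) l = insert (While r a # l) (conts a (While r a # l))"
| "conts c l = {c # l}"

lemma finite_conts: "finite (conts c l)"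
  by (induction c arbitrary: l) auto

lemma Cons_in_conts: "c # l \<in> conts c l"
  by (cases c) auto

fun successors :: "com list \<Rightarrow> com list set" where
  "successors [] = {}"
| "successors (Fail # l) = {}"
| "successors ((a ;; b) # l) = {a # b # l}"
| "successors (Case r a b c # l) = {a # l, b # l, c # l}"
| "successors (While r a # l) = {l, a # While r a # l}"
| "successors (c # l) = {l}"

lemma control_in_successors: "control l s = Some l' \<Longrightarrow> l' \<in> successors l"
  by (cases "(l, s)" rule: control.cases) (auto split: list.splits if_splits)

lemma successors_conts: "l' \<in> conts c l \<Longrightarrow> successors l' \<subseteq> insert l (conts c l)"
proof (induction c arbitrary: l)
  case (Seq a b)
  then show ?case using Cons_in_conts[of a "b # l"] Cons_in_conts[of b l] by fastforce
next
  case (Case r a b c)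
  then show ?case
    using Cons_in_conts[of a l] Cons_in_conts[of b l] Cons_in_conts[of c l] by fastforce
next
  case (While r a)
  then show ?case using Cons_in_conts[of a "While r a # l"] by fastforce
qed auto

lemma reg_set_conts:
  "l' \<in> conts c l \<Longrightarrow> (\<Union>c' \<in> set l'. reg_set c') \<subseteq> reg_set c \<union> (\<Union>c' \<in> set l. reg_set c')"
  by (induction c arbitrary: l) fastforce+

section \<open>Simulation of stack programs by Turing machines\<close>

definition rel_tape :: "tape \<Rightarrow> int \<Rightarrow> nat" where
  "rel_tape t = (\<lambda>i. fst t (snd t + i))"

definition rel_act :: "nat \<times> move \<Rightarrow> (int \<Rightarrow> nat) \<Rightarrow> int \<Rightarrow> nat" where
  "rel_act a f = (\<lambda>i. (f(0 := fst a)) (i + move_head (snd a) 0))"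

lemma scan_rel_tape: "scan t = rel_tape t 0"
  by (simp add: scan_def rel_tape_def)

lemma rel_tape_act: "rel_tape (act a t) = rel_act a (rel_tape t)"
  by (cases a; cases "snd a") (auto simp: rel_tape_def act_def rel_act_def fun_eq_iff algebra_simps)

text \<open>A register is a stack of bits with its top under the head, so an input tape is itself a stack.\<close>

definition stack :: "bool list \<Rightarrow> int \<Rightarrow> nat" where
  "stack xs = fst (input_tape xs)"

lemma stack_altdef:
  "stack xs i = (if 0 \<le> i \<and> i < int (length xs) then (if xs ! nat i then 2 else 1) else 0)"
  by (simp add: stack_def input_tape_def)

lemma rel_tape_input [simp]: "rel_tape (input_tape xs) = stack xs"
  by (simp add: rel_tape_def stack_def input_tape_def)

lemma rel_tape_blank [simp]: "rel_tape blank_tape = stack []"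
  by (auto simp: rel_tape_def stack_altdef blank_tape_def)

lemma stack_0: "stack xs 0 = (case xs of [] \<Rightarrow> 0 | x # _ \<Rightarrow> if x then 2 else 1)"
  by (cases xs) (auto simp: stack_altdef)

lemma stack_lt_3: "stack xs i < 3"
  by (auto simp: stack_altdef)

lemma rel_act_pop: "rel_act (0, Move_Right) (stack xs) = stack (tl xs)"
proof
  fix i :: int
  have "nat (i + 1) = Suc (nat i)" if "0 \<le> i" using that by simp
  then show "rel_act (0, Move_Right) (stack xs) i = stack (tl xs) i"
    by (cases xs) (auto simp: rel_act_def stack_altdef)
qed

lemma rel_act_push:
  "rel_act (if b then 2 else 1, Stay) (rel_act (stack xs 0, Move_Left) (stack xs)) = stack (b # xs)"
proof
  fix i :: int
  have "nat i = Suc (nat (i - 1))" if "0 < i" using that by simp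
  then show "rel_act (if b then 2 else 1, Stay) (rel_act (stack xs 0, Move_Left) (stack xs)) i =
      stack (b # xs) i"
    by (auto simp: rel_act_def stack_altdef)
qed

definition legal_config :: "tm \<Rightarrow> config \<Rightarrow> bool" where
  "legal_config M cfg \<longleftrightarrow> fst cfg < states M \<and> length (snd cfg) = tapes M \<and>
     (\<forall>t \<in> set (snd cfg). \<forall>i. rel_tape t i < symbols M)"

lemma legal_trans:
  assumes "wf_tm M" "legal_config M (q, ts)"
  shows "fst (trans M q (map scan ts)) < states M"
    "length (snd (trans M q (map scan ts))) = tapes M"
    "fst ` set (snd (trans M q (map scan ts))) \<subseteq> {..<symbols M}"
proof -
  have "set (map scan ts) \<subseteq> {..<symbols M}" "length (map scan ts) = tapes M" "q < states M"
    using assms(2) by (auto simp: scan_rel_tape legal_config_def)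
  then show "fst (trans M q (map scan ts)) < states M"
    "length (snd (trans M q (map scan ts))) = tapes M"
    "fst ` set (snd (trans M q (map scan ts))) \<subseteq> {..<symbols M}"
    using assms(1) unfolding wf_tm_def by blast+
qed

lemma legal_step:
  assumes "wf_tm M" "legal_config M cfg"
  shows "legal_config M (step M cfg)"
proof (cases "fst cfg = 1 \<or> fst cfg = 2")
  case True
  then show ?thesis using assms by (simp add: step_def)
next
  case False
  obtain q ts where cfg: "cfg = (q, ts)" by (cases cfg)
  define d where "d = trans M q (map scan ts)"
  note d = legal_trans[OF assms[unfolded cfg], folded d_def]
  have "rel_tape (act a t) i < symbols M" if "(a, t) \<in> set (zip (snd d) ts)" for a t i
  proof -
    have "fst a < symbols M" "t \<in> set ts"
      using that d(3) by (auto dest: set_zip_leftD set_zip_rightD)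
    then show ?thesis using assms(2) cfg by (auto simp: rel_tape_act rel_act_def legal_config_def)
  qed
  moreover have "step M cfg = (fst d, map2 act (snd d) ts)"
    using False cfg by (simp add: step_def d_def Let_def)
  ultimately show ?thesis
    using d assms(2) cfg by (auto simp: legal_config_def)
qed

lemma legal_steps: "wf_tm M \<Longrightarrow> legal_config M cfg \<Longrightarrow> legal_config M ((step M ^^ t) cfg)"
  by (induction t) (auto intro: legal_step)

lemma legal_init: "wf_tm M \<Longrightarrow> legal_config M (init_config M x)"
  by (auto simp: wf_tm_def legal_config_def init_config_def less_le_trans[OF stack_lt_3])

datatype sim_state = Cont "com list" | Writing nat bool "com list" | Sub bool nat | Accept | Reject

text \<open>
  After \<open>P\<close> has terminated, the machine \<open>M b\<close> is started, where \<open>b\<close> tells whether the top of register \<open>V\<close>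
  is a set bit. Its first tape is the one holding register \<open>Z\<close>, the last register that \<open>P\<close> may use.
\<close>

locale simulator =
  fixes P :: com and Z V :: nat and M :: "bool \<Rightarrow> tm"
  assumes wf: "wf_tm (M b)" and regs: "reg_set P \<subseteq> {..Z}" and V: "V \<le> Z"
begin

definition tape_count :: nat where "tape_count = Z + tapes (M False) + tapes (M True)"

definition symbol_count :: nat where "symbol_count = symbols (M False) + symbols (M True)"

definition sub_state :: "bool \<Rightarrow> nat \<Rightarrow> sim_state" where
  "sub_state b q = (if q = 1 then Accept else if q = 2 then Reject else Sub b q)"

fun \<delta> :: "sim_state \<Rightarrow> nat list \<Rightarrow> sim_state \<times> (nat \<times> move) list" where
  "\<delta> (Cont (Skip # l)) ss = (Cont l, stay ss)"
| "\<delta> (Cont (Fail # l)) ss = (Reject, stay ss)"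
| "\<delta> (Cont (Push r b # l)) ss = (Writing r b l, (stay ss)[r := (ss ! r, Move_Left)])"
| "\<delta> (Writing r b l) ss = (Cont l, (stay ss)[r := (if b then 2 else 1, Stay)])"
| "\<delta> (Cont (Pop r # l)) ss = (Cont l, (stay ss)[r := (0, Move_Right)])"
| "\<delta> (Cont ((a ;; b) # l)) ss = (Cont (a # b # l), stay ss)"
| "\<delta> (Cont (Case r a b c # l)) ss =
    (Cont ((if ss ! r = 0 then a else if ss ! r = 1 then b else c) # l), stay ss)"
| "\<delta> (Cont (While r a # l)) ss = (Cont (if ss ! r = 0 then l else a # While r a # l), stay ss)"
| "\<delta> (Cont []) ss = (Sub (ss ! V = 2) 0, stay ss)"
| "\<delta> (Sub b q) ss =
    (let d = trans (M b) q (take (tapes (M b)) (drop Z ss)) in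
     (sub_state b (fst d), stay (take Z ss) @ snd d @ stay (drop (Z + tapes (M b)) ss)))"
| "\<delta> q ss = (q, stay ss)"

definition program_conts :: "com list set" where
  "program_conts = insert [] (conts P [])"

fun pending_write :: "com list \<Rightarrow> sim_state" where
  "pending_write (Push r b # l) = Writing r b l"
| "pending_write l = Reject"

definition Q :: "sim_state set" where
  "Q = Cont ` program_conts \<union> pending_write ` program_conts \<union>
     (\<Union>b. Sub b ` {..<states (M b)}) \<union> {Accept, Reject}"

lemma Cont_in_Q [simp]: "Cont l \<in> Q \<longleftrightarrow> l \<in> program_conts"
proof -
  have "pending_write l' \<noteq> Cont l" for l' by (cases l' rule: pending_write.cases) auto
  from this[symmetric] show ?thesis by (auto simp: Q_def)
qed

lemma Accept_in_Q [simp]: "Accept \<in> Q" and Reject_in_Q [simp]: "Reject \<in> Q"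
  by (simp_all add: Q_def)

lemma Sub_in_Q: "q < states (M b) \<Longrightarrow> Sub b q \<in> Q"
  by (auto simp: Q_def)

lemma Writing_in_Q: "Push r b # l \<in> program_conts \<Longrightarrow> Writing r b l \<in> Q"
  by (auto simp: Q_def image_iff intro: bexI[of _ "Push r b # l"])

lemma successors_program_conts: "l \<in> program_conts \<Longrightarrow> l' \<in> successors l \<Longrightarrow> l' \<in> program_conts"
  using successors_conts[of l P "[]"] by (auto simp: program_conts_def)

lemma reg_set_program_conts: "c # l \<in> program_conts \<Longrightarrow> reg_set c \<subseteq> {..Z}"
  using reg_set_conts[of "c # l" P "[]"] regs by (auto simp: program_conts_def)

lemma tape_count_ge: "Z + tapes (M b) \<le> tape_count" and Z_less_tape_count: "Z < tape_count"
  using wf[of True] wf[of False] by (cases b; simp add: tape_count_def wf_tm_def)+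

lemma symbol_count_ge: "symbols (M b) \<le> symbol_count" "3 \<le> symbol_count"
  using wf[of True] wf[of False] by (cases b; simp add: symbol_count_def wf_tm_def)+

sublocale tm_automaton Q \<delta> "Cont [P]" Accept Reject tape_count symbol_count
  using Z_less_tape_count symbol_count_ge Cons_in_conts[of P "[]"]
  by unfold_locales (auto simp: Q_def program_conts_def finite_conts)

end

locale simulator_machine = simulator +
  fixes S :: tm and e :: "sim_state \<Rightarrow> nat"
  assumes realizes: "realizes S e"
begin

definition readable :: "tape list \<Rightarrow> bool" where
  "readable ts \<longleftrightarrow> length ts = tape_count \<and> (\<forall>t \<in> set ts. scan t < symbol_count)"

lemma step_stay:
  assumes "readable ts" "\<delta> q (map scan ts) = (q', stay (map scan ts))"
    "q \<in> Q" "q' \<in> Q" "q \<noteq> Accept" "q \<noteq> Reject"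
  shows "step S (e q, ts) = (e q', ts)"
proof -
  have "admissible (q', stay (map scan ts))"
    using assms(1,4) by (auto simp: admissible_def readable_def fst_set_stay)
  then show ?thesis using step_realization[OF realizes assms(3,5,6,2)] by (simp add: map2_act_stay)
qed

lemma step_write:
  assumes "readable ts" "\<delta> q (map scan ts) = (q', (stay (map scan ts))[r := a])"
    "r < tape_count" "fst a < symbol_count" "q \<in> Q" "q' \<in> Q" "q \<noteq> Accept" "q \<noteq> Reject"
  shows "step S (e q, ts) = (e q', ts[r := act a (ts ! r)])"
proof -
  have "fst ` set ((stay (map scan ts))[r := a]) \<subseteq> insert (fst a) (fst ` set (stay (map scan ts)))"
    using image_mono[OF set_update_subset_insert] by (metis image_insert)
  then have "admissible (q', (stay (map scan ts))[r := a])"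
    using assms(1,4,6) by (auto simp: admissible_def readable_def fst_set_stay)
  moreover have "map2 act ((stay (map scan ts))[r := a]) ts = ts[r := act a (ts ! r)]"
    using zip_update[of "stay (map scan ts)" r a ts "ts ! r"]
    by (simp add: map_update map2_act_stay)
  ultimately show ?thesis using step_realization[OF realizes assms(5,7,8,2)] by simp
qed

definition rep :: "tape list \<Rightarrow> regs \<Rightarrow> bool" where
  "rep ts s \<longleftrightarrow> length ts = tape_count \<and> (\<forall>r < tape_count. rel_tape (ts ! r) = stack (s r))"

lemma rep_scan: "rep ts s \<Longrightarrow> r < tape_count \<Longrightarrow> map scan ts ! r = stack (s r) 0"
  by (simp add: rep_def scan_rel_tape)

lemma rep_readable: "rep ts s \<Longrightarrow> readable ts"
  unfolding readable_def rep_def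
  by (metis in_set_conv_nth less_le_trans scan_rel_tape stack_lt_3 symbol_count_ge(2))

lemma rep_update:
  "rep ts s \<Longrightarrow> rel_tape t = stack xs \<Longrightarrow> rep (ts[r := t]) (s(r := xs))"
  by (auto simp: rep_def nth_list_update)

lemma rep_init: "rep (snd (init_config S u)) (init_regs u)"
  using num_tapes_pos realizes
  by (auto simp: rep_def init_config_def init_regs_def realizes_def nth_Cons split: nat.splits)

lemma step_pop:
  assumes "rep ts s" "Pop r # l \<in> program_conts"
  shows "\<exists>ts'. step S (e (Cont (Pop r # l)), ts) = (e (Cont l), ts') \<and> rep ts' (s(r := tl (s r)))"
proof -
  have r: "r < tape_count" using reg_set_program_conts[OF assms(2)] Z_less_tape_count by simp
  have "step S (e (Cont (Pop r # l)), ts) = (e (Cont l), ts[r := act (0, Move_Right) (ts ! r)])"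
    by (rule step_write[OF rep_readable[OF assms(1)] _ r])
      (use assms(2) successors_program_conts[OF assms(2)] symbol_count_ge(2) in auto)
  moreover have "rep (ts[r := act (0, Move_Right) (ts ! r)]) (s(r := tl (s r)))"
    using assms(1) r by (intro rep_update) (auto simp: rep_def rel_tape_act rel_act_pop)
  ultimately show ?thesis by blast
qed

lemma steps_push:
  assumes "rep ts s" "Push r b # l \<in> program_conts"
  shows "\<exists>ts'. step S (step S (e (Cont (Push r b # l)), ts)) = (e (Cont l), ts') \<and>
    rep ts' (s(r := b # s r))"
proof -
  have r: "r < tape_count" using reg_set_program_conts[OF assms(2)] Z_less_tape_count by simp
  have len: "length ts = tape_count" and scan_r: "scan (ts ! r) = stack (s r) 0"
    using assms(1) r by (auto simp: rep_def scan_rel_tape)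
  define ts1 where "ts1 = ts[r := act (scan (ts ! r), Move_Left) (ts ! r)]"
  define ts2 where "ts2 = ts1[r := act (if b then 2 else 1, Stay) (ts1 ! r)]"
  have readable: "readable ts" using assms(1) by (rule rep_readable)
  have "step S (e (Cont (Push r b # l)), ts) = (e (Writing r b l), ts1)"
    unfolding ts1_def
    by (rule step_write[OF readable _ r])
      (use readable r len assms(2) Writing_in_Q in \<open>auto simp: readable_def\<close>)
  moreover have "step S (e (Writing r b l), ts1) = (e (Cont l), ts2)"
    unfolding ts2_def
  proof (rule step_write[OF _ _ r])
    have "scan (act (scan (ts ! r), Move_Left) (ts ! r)) = 0"
      using assms(1) r by (simp add: scan_rel_tape rel_tape_act rep_def rel_act_def stack_altdef)
    then show "readable ts1"
      using readable symbol_count_ge(2) set_update_subset_insert[of ts r]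
      unfolding ts1_def readable_def by fastforce
  qed (use assms(2) Writing_in_Q successors_program_conts[OF assms(2)] symbol_count_ge(2) in auto)
  moreover have "rep ts2 (s(r := b # s r))"
  proof -
    have "rel_tape (act (if b then 2 else 1, Stay) (ts1 ! r)) = stack (b # s r)"
      using assms(1) r len scan_r by (simp add: ts1_def rel_tape_act rel_act_push rep_def)
    then have "rep (ts[r := act (if b then 2 else 1, Stay) (ts1 ! r)]) (s(r := b # s r))"
      using assms(1) by (rule rep_update[rotated])
    then show ?thesis by (simp add: ts2_def ts1_def)
  qed
  ultimately show ?thesis by auto
qed

lemma step_control:
  assumes "rep ts s" "l \<in> program_conts" "control l s = Some l'"
  shows "step S (e (Cont l), ts) = (e (Cont l'), ts)"
proof (rule step_stay[OF rep_readable[OF assms(1)]])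
  have "r < tape_count" if "c # l1 \<in> program_conts" "r \<in> reg_set c" for c l1 r
    using reg_set_program_conts that Z_less_tape_count by fastforce
  then show "\<delta> (Cont l) (map scan ts) = (Cont l', stay (map scan ts))"
    using assms rep_scan[OF assms(1)]
    by (cases "(l, s)" rule: control.cases)
      (auto simp: stack_0 simp del: nth_map split: list.splits if_splits)
  show "Cont l' \<in> Q" using assms successors_program_conts control_in_successors by simp
qed (use assms(2) in auto)

definition ends_in :: "config \<Rightarrow> regs option \<Rightarrow> bool" where
  "ends_in cfg out \<longleftrightarrow>
    (case out of None \<Rightarrow> fst cfg = 2 | Some s \<Rightarrow> \<exists>ts. cfg = (e (Cont []), ts) \<and> rep ts s)"

lemma simulate_exec:
  assumes "exec l s t out" "rep ts s" "l \<in> program_conts"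
  shows "ends_in ((step S ^^ t) (e (Cont l), ts)) out"
  using assms
proof (induction arbitrary: ts rule: exec.induct)
  case (Done s)
  then show ?case by (auto simp: ends_in_def)
next
  case (Fail l s)
  have "step S (e (Cont (Fail # l)), ts) = (e Reject, ts)"
    by (rule step_stay) (use Fail rep_readable in auto)
  then show ?case using realizes by (simp add: ends_in_def realizes_def)
next
  case (Push l s r b t out)
  have l: "l \<in> program_conts" using successors_program_conts[OF Push.prems(2)] by simp
  obtain ts' where "step S (step S (e (Cont (Push r b # l)), ts)) = (e (Cont l), ts')"
    and rep: "rep ts' (s(r := b # s r))" using steps_push[OF Push.prems] by blast
  then show ?case using Push.IH[OF rep l] by (simp add: funpow_Suc_right del: funpow.simps)
next
  case (Pop l s r t out)
  have l: "l \<in> program_conts" using successors_program_conts[OF Pop.prems(2)] by simp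
  obtain ts' where "step S (e (Cont (Pop r # l)), ts) = (e (Cont l), ts')"
    and rep: "rep ts' (s(r := tl (s r)))" using step_pop[OF Pop.prems] by blast
  then show ?case using Pop.IH[OF rep l] by (simp add: funpow_Suc_right del: funpow.simps)
next
  case (Control l s l' t out)
  have "l' \<in> program_conts"
    using successors_program_conts[OF Control.prems(2)] control_in_successors[OF Control.hyps(1)]
    by blast
  from Control.IH[OF Control.prems(1) this] show ?case
    using step_control[OF Control.prems Control.hyps(1)]
    by (simp add: funpow_Suc_right del: funpow.simps)
qed

text \<open>
  From here on the tapes between the first \<open>Z\<close> and the last ones run the machine \<open>M b\<close>; its tapes
  agree with them up to a translation, as the head need not be at the origin when \<open>P\<close> terminates.
\<close>

definition embeds :: "tape list \<Rightarrow> tape list \<Rightarrow> bool" where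
  "embeds us ts \<longleftrightarrow> length ts = tape_count \<and> (\<exists>pre mid post. ts = pre @ mid @ post \<and> length pre = Z \<and>
     map rel_tape mid = map rel_tape us \<and> (\<forall>t \<in> set pre \<union> set post. scan t < symbol_count))"

lemma map_scan: "map scan ts = map (\<lambda>f. f 0) (map rel_tape ts)"
  by (simp add: scan_rel_tape)

lemma map_rel_tape_act: "map rel_tape (map2 act as ts) = map2 rel_act as (map rel_tape ts)"
  by (auto simp: list_eq_iff_nth_eq rel_tape_act)

lemma embedded_trans:
  assumes "embeds us ts" "legal_config (M b) (q, us)" "q \<noteq> 1" "q \<noteq> 2"
    and d: "trans (M b) q (map scan us) = (q', as)"
  shows "\<exists>ts'. step S (e (Sub b q), ts) = (e (sub_state b q'), ts') \<and> embeds (map2 act as us) ts'"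
proof -
  obtain pre mid post where ts: "ts = pre @ mid @ post" "length ts = tape_count" "length pre = Z"
    and mid: "map rel_tape mid = map rel_tape us"
    and outer: "\<forall>t \<in> set pre \<union> set post. scan t < symbol_count"
    using assms(1) unfolding embeds_def by blast
  have q: "q < states (M b)" and len_us: "length us = tapes (M b)"
    using assms(2) by (auto simp: legal_config_def)
  have scan_mid: "map scan mid = map scan us" unfolding map_scan mid ..
  have len_mid: "length mid = tapes (M b)" using arg_cong[OF mid, of length] len_us by simp
  note legal = legal_trans[OF wf assms(2), unfolded d fst_conv snd_conv]
  define bs where "bs = stay (map scan pre) @ as @ stay (map scan post)"
  have \<delta>: "\<delta> (Sub b q) (map scan ts) = (sub_state b q', bs)"
    using ts(1,3) len_mid len_us scan_mid d by (simp add: bs_def Let_def)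
  have admissible: "admissible (sub_state b q', bs)"
  proof -
    have "fst ` set bs = scan ` set pre \<union> fst ` set as \<union> scan ` set post"
      by (simp add: bs_def image_Un fst_set_stay Un_assoc)
    moreover have "fst ` set as \<subseteq> {..<symbol_count}"
      using legal(3) symbol_count_ge(1)[of b] by (meson lessThan_subset_iff subset_trans)
    ultimately have "fst ` set bs \<subseteq> {..<symbol_count}"
      using outer by auto
    moreover have "sub_state b q' \<in> Q" using legal(1) by (simp add: sub_state_def Sub_in_Q)
    moreover have "length bs = tape_count" using ts len_mid legal(2) by (simp add: bs_def)
    ultimately show ?thesis by (simp add: admissible_def)
  qed
  have "map2 act bs ts = pre @ map2 act as mid @ post"
    using len_mid legal(2) by (simp add: ts(1) bs_def map2_act_stay)
  moreover have "map rel_tape (map2 act as mid) = map rel_tape (map2 act as us)"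
    unfolding map_rel_tape_act mid ..
  ultimately have "embeds (map2 act as us) (map2 act bs ts)"
    unfolding embeds_def using ts outer legal(2) len_mid
    by (intro conjI exI[of _ pre] exI[of _ "map2 act as mid"] exI[of _ post]) auto
  moreover have "step S (e (Sub b q), ts) = (e (sub_state b q'), map2 act bs ts)"
    using q by (intro step_realization[OF realizes Sub_in_Q _ _ \<delta> admissible]) auto
  ultimately show ?thesis by blast
qed

lemma embedded_step:
  assumes "embeds us ts" "legal_config (M b) (q, us)"
  shows "\<exists>ts'. step S (e (sub_state b q), ts) = (e (sub_state b (fst (step (M b) (q, us)))), ts') \<and>
    embeds (snd (step (M b) (q, us))) ts'"
proof (cases "q = 1 \<or> q = 2")
  case True
  then have "e (sub_state b q) = 1 \<or> e (sub_state b q) = 2"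
    using realizes by (auto simp: sub_state_def realizes_def)
  then show ?thesis using True assms(1) by (auto simp: step_def)
next
  case False
  obtain q' as where d: "trans (M b) q (map scan us) = (q', as)"
    by (cases "trans (M b) q (map scan us)")
  then have "step (M b) (q, us) = (q', map2 act as us)"
    using False by (simp add: step_def)
  moreover have "sub_state b q = Sub b q" using False by (simp add: sub_state_def)
  ultimately show ?thesis using embedded_trans[OF assms _ _ d] False by simp
qed

lemma embedded_steps:
  assumes "embeds us ts" "legal_config (M b) (q, us)"
  shows "\<exists>ts'. (step S ^^ t) (e (sub_state b q), ts) =
      (e (sub_state b (fst ((step (M b) ^^ t) (q, us)))), ts') \<and>
    embeds (snd ((step (M b) ^^ t) (q, us))) ts'"
proof (induction t)
  case 0
  then show ?case using assms by auto
next
  case (Suc t)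
  obtain q' us' where cfg: "(step (M b) ^^ t) (q, us) = (q', us')"
    by (cases "(step (M b) ^^ t) (q, us)")
  have "legal_config (M b) (q', us')" using legal_steps[OF wf assms(2), of t] cfg by simp
  moreover obtain ts' where "(step S ^^ t) (e (sub_state b q), ts) = (e (sub_state b q'), ts')"
    and "embeds us' ts'" using Suc cfg by auto
  ultimately show ?case using embedded_step[of us' ts' b q'] cfg by auto
qed

lemma init_config_S: "init_config S u = (e (Cont [P]), snd (init_config S u))"
  using realizes by (simp add: realizes_def init_config_def)

lemma P_in_program_conts: "[P] \<in> program_conts"
  by (simp add: program_conts_def Cons_in_conts)

lemma run_program:
  "exec [P] (init_regs u) t out \<Longrightarrow> ends_in ((step S ^^ t) (init_config S u)) out"
  by (subst init_config_S) (rule simulate_exec[OF _ rep_init P_in_program_conts])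

lemma embeds_init:
  assumes "rep ts s" "\<And>r. Z < r \<Longrightarrow> s r = []"
  shows "embeds (snd (init_config (M b) (s Z))) ts"
  unfolding embeds_def
proof (intro conjI exI ballI)
  show len: "length ts = tape_count" using assms(1) by (simp add: rep_def)
  let ?n = "tapes (M b)"
  show "ts = take Z ts @ take ?n (drop Z ts) @ drop ?n (drop Z ts)"
    by (simp only: append_take_drop_id)
  show "length (take Z ts) = Z" using Z_less_tape_count len by simp
  have n: "1 \<le> ?n" using wf[of b] by (simp add: wf_tm_def)
  show "map rel_tape (take ?n (drop Z ts)) = map rel_tape (snd (init_config (M b) (s Z)))"
  proof (rule nth_equalityI)
    show "length (map rel_tape (take ?n (drop Z ts))) =
        length (map rel_tape (snd (init_config (M b) (s Z))))"
      using len n tape_count_ge[of b] by (simp add: init_config_def)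
    fix i assume "i < length (map rel_tape (take ?n (drop Z ts)))"
    then have i: "i < ?n" "Z + i < tape_count" using len by auto
    then have "map rel_tape (take ?n (drop Z ts)) ! i = stack (s (Z + i))"
      using assms(1) len by (simp add: rep_def)
    then show "map rel_tape (take ?n (drop Z ts)) ! i =
        map rel_tape (snd (init_config (M b) (s Z))) ! i"
      using i assms(2) by (cases i) (simp_all add: init_config_def)
  qed
  fix t assume "t \<in> set (take Z ts) \<union> set (drop ?n (drop Z ts))"
  then show "scan t < symbol_count"
    using rep_readable[OF assms(1)] by (auto simp: readable_def dest: in_set_takeD in_set_dropD)
qed

lemma run_reject:
  "exec [P] (init_regs u) t None \<Longrightarrow> fst ((step S ^^ t) (init_config S u)) = 2"
  using run_program by (fastforce simp: ends_in_def)

lemma run_submachine: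
  assumes exec: "exec [P] (init_regs u) t (Some s)"
    and b: "b \<longleftrightarrow> starts_True (s V)"
    and halt: "fst ((step (M b) ^^ t') (init_config (M b) (s Z))) = (if acc then 1 else 2)"
  shows "fst ((step S ^^ (t + Suc t')) (init_config S u)) = (if acc then 1 else 2)"
proof -
  obtain ts where ts: "(step S ^^ t) (init_config S u) = (e (Cont []), ts)" "rep ts s"
    using run_program[OF exec] by (auto simp: ends_in_def)
  define us where "us = snd (init_config (M b) (s Z))"
  have init: "init_config (M b) (s Z) = (0, us)" by (simp add: us_def init_config_def)
  have start: "step S (e (Cont []), ts) = (e (sub_state b 0), ts)"
  proof (rule step_stay[OF rep_readable[OF ts(2)]])
    have "map scan ts ! V = 2 \<longleftrightarrow> b"
      using rep_scan[OF ts(2), of V] V Z_less_tape_count b by (simp add: stack_0 split: list.split)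
    then show "\<delta> (Cont []) (map scan ts) = (sub_state b 0, stay (map scan ts))"
      by (simp add: sub_state_def)
    show "sub_state b 0 \<in> Q" using wf[of b] by (simp add: sub_state_def Sub_in_Q wf_tm_def)
  qed (simp_all add: program_conts_def)
  have "s r = []" if "Z < r" for r
    using exec_unchanged[OF exec, of r] that regs by (force simp: init_regs_def)
  then have "embeds us ts" unfolding us_def using ts(2) by (intro embeds_init)
  moreover have "legal_config (M b) (0, us)" using legal_init[OF wf, of b "s Z"] init by simp
  ultimately obtain ts' where
    "(step S ^^ t') (e (sub_state b 0), ts) = (e (sub_state b (if acc then 1 else 2)), ts')"
    using embedded_steps[of us ts b 0 t'] halt init by auto
  then have "fst ((step S ^^ Suc t') (e (Cont []), ts)) = (if acc then 1 else 2)"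
    using start realizes
    by (simp add: funpow_Suc_right sub_state_def realizes_def del: funpow.simps)
  then show ?thesis by (simp only: add.commute[of t] funpow_add comp_apply ts(1))
qed

lemma run_decides:
  assumes exec: "exec [P] (init_regs u) t out"
    and decides: "\<And>b. decides_in_time (M b) (L b) (time b)" and mono: "\<And>b. mono (time b)"
  defines "N \<equiv> length u + t"
  shows "\<exists>t' \<le> t + 1 + time True N + time False N. fst ((step S ^^ t') (init_config S u)) =
    (if \<exists>s. out = Some s \<and> s Z \<in> L (starts_True (s V)) then 1 else 2)"
proof (cases out)
  case None
  then show ?thesis using exec run_reject by (intro exI[of _ t]) auto
next
  case (Some s)
  define b where "b = starts_True (s V)"
  obtain t' where t': "t' \<le> time b (length (s Z))"
    "fst ((step (M b) ^^ t') (init_config (M b) (s Z))) = (if s Z \<in> L b then 1 else 2)"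
    using decides[of b] unfolding decides_in_time_def by blast
  have "length (s Z) \<le> N"
    using exec_length[OF exec[unfolded Some], of Z]
    by (simp add: N_def init_regs_def split: if_splits)
  then have "t' \<le> time b N" using t'(1) monoD[OF mono] le_trans by blast
  then have "t' \<le> time True N + time False N" by (cases b) auto
  moreover have "fst ((step S ^^ (t + Suc t')) (init_config S u)) = (if s Z \<in> L b then 1 else 2)"
    using run_submachine[OF exec[unfolded Some] b_def t'(2)] .
  ultimately show ?thesis unfolding Some b_def by (intro exI[of _ "t + Suc t'"]) auto
qed

end

definition ptime_transducer :: "(bool list \<Rightarrow> (bool \<times> bool list) option) \<Rightarrow> bool" where
  "ptime_transducer f \<longleftrightarrow> (\<exists>P V Z (p :: nat poly). reg_set P \<subseteq> {..Z} \<and> V \<le> Z \<and>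
     (\<forall>u. \<exists>t \<le> poly p (length u). \<exists>out. exec [P] (init_regs u) t out \<and>
        f u = map_option (\<lambda>s. (starts_True (s V), s Z)) out))"

lemma poly_nat_mono: "(x::nat) \<le> y \<Longrightarrow> poly p x \<le> poly p y"
  by (induction p) (auto intro!: add_mono mult_mono)

theorem PTIME_transducer_preimage:
  assumes "ptime_transducer f" and L: "\<And>b. L b \<in> PTIME"
  shows "{u. \<exists>b z. f u = Some (b, z) \<and> z \<in> L b} \<in> PTIME" (is "?L' \<in> _")
proof -
  obtain P V Z and p :: "nat poly" where regs: "reg_set P \<subseteq> {..Z}" "V \<le> Z"
    and run: "\<And>u. \<exists>t \<le> poly p (length u). \<exists>out. exec [P] (init_regs u) t out \<and>
      f u = map_option (\<lambda>s. (starts_True (s V), s Z)) out"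
    using assms(1) unfolding ptime_transducer_def by blast
  have "\<exists>M (q :: nat poly). wf_tm M \<and> decides_in_time M (L b) (poly q)" for b
    using L unfolding PTIME_def by blast
  then obtain M and q :: "bool \<Rightarrow> nat poly"
    where M: "\<And>b. wf_tm (M b)" "\<And>b. decides_in_time (M b) (L b) (poly (q b))"
    by metis
  interpret simulator P Z V M using M(1) regs by unfold_locales auto
  obtain S e where "realizes S e" using ex_realization by blast
  then interpret simulator_machine P Z V M S e by unfold_locales
  define T where "T = p + 1 + pcompose (q True) ([:0, 1:] + p) + pcompose (q False) ([:0, 1:] + p)"
  have "\<exists>t' \<le> poly T (length u). fst ((step S ^^ t') (init_config S u)) =
      (if u \<in> ?L' then 1 else 2)" for u
  proof -
    obtain t out where t: "t \<le> poly p (length u)" and exec: "exec [P] (init_regs u) t out"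
      and f: "f u = map_option (\<lambda>s. (starts_True (s V), s Z)) out"
      using run by blast
    obtain t' where t': "t' \<le> t + 1 + poly (q True) (length u + t) + poly (q False) (length u + t)"
      "fst ((step S ^^ t') (init_config S u)) =
        (if \<exists>s. out = Some s \<and> s Z \<in> L (starts_True (s V)) then 1 else 2)"
      using run_decides[OF exec M(2)] by (auto simp: mono_def poly_nat_mono)
    have "poly (q b) (length u + t) \<le> poly (q b) (length u + poly p (length u))" for b
      using t by (intro poly_nat_mono) simp
    from this[of True] this[of False] have "t' \<le> poly T (length u)"
      using t'(1) t by (simp add: T_def poly_pcompose)
    moreover have "(\<exists>s. out = Some s \<and> s Z \<in> L (starts_True (s V))) \<longleftrightarrow> u \<in> ?L'"
      using f by (cases out) auto
    ultimately show ?thesis using t'(2) by auto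
  qed
  then have "decides_in_time S ?L' (poly T)" unfolding decides_in_time_def by blast
  moreover have "wf_tm S" using realizes by (simp add: realizes_def)
  ultimately show ?thesis unfolding PTIME_def by blast
qed

section \<open>Building blocks of stack programs\<close>

definition resumes :: "com list \<Rightarrow> regs option \<Rightarrow> nat \<Rightarrow> regs option \<Rightarrow> bool" where
  "resumes l out u out' \<longleftrightarrow> (case out of None \<Rightarrow> out' = None | Some s \<Rightarrow> exec l s u out')"

text \<open>
  Quantifying over the commands \<open>l\<close> that follow makes statements about programs compose.
\<close>

definition runs_list :: "com list \<Rightarrow> regs \<Rightarrow> nat \<Rightarrow> regs option \<Rightarrow> bool" where
  "runs_list cs s T out \<longleftrightarrow>
     (\<forall>l u out'. resumes l out u out' \<longrightarrow> (\<exists>t \<le> T + u. exec (cs @ l) s t out'))"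

abbreviation runs :: "com \<Rightarrow> regs \<Rightarrow> nat \<Rightarrow> regs option \<Rightarrow> bool" where
  "runs c \<equiv> runs_list [c]"

lemma runs_listD: "runs_list cs s T out \<Longrightarrow> resumes l out u out' \<Longrightarrow> \<exists>t \<le> T + u. exec (cs @ l) s t out'"
  by (simp add: runs_list_def)

lemma runs_exec: "runs c s T out \<Longrightarrow> \<exists>t \<le> T. exec [c] s t out"
  using runs_listD[of "[c]" s T out "[]" 0 out]
  by (cases out) (auto simp: resumes_def intro: exec.Done)

lemma runs_weaken: "runs_list cs s T out \<Longrightarrow> T \<le> T' \<Longrightarrow> out = out' \<Longrightarrow> runs_list cs s T' out'"
  unfolding runs_list_def by (meson add_le_mono1 le_trans)

lemma runs_start_eq: "runs c s T out \<Longrightarrow> s = s' \<Longrightarrow> runs c s' T out"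
  by simp

lemma runs_list_Nil: "runs_list [] s 0 (Some s)"
  by (auto simp: runs_list_def resumes_def)

lemma runs_list_Cons:
  assumes "runs a s T (map_option F r)" "\<And>x. r = Some x \<Longrightarrow> runs_list cs (F x) U (G x)"
  shows "runs_list (a # cs) s (T + U) (Option.bind r G)"
  unfolding runs_list_def
proof (intro allI impI)
  fix l u out assume res: "resumes l (Option.bind r G) u out"
  obtain t where t: "t \<le> U + u" "resumes (cs @ l) (map_option F r) t out"
  proof (cases r)
    case None
    then show ?thesis using res that[of 0] by (simp add: resumes_def)
  next
    case (Some x)
    then show ?thesis using runs_listD[OF assms(2)[OF Some], of l u out] res that
      by (auto simp: resumes_def)
  qed
  then obtain t' where "t' \<le> T + t" "exec ([a] @ cs @ l) s t' out"
    using runs_listD[OF assms(1)] by blast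
  with t(1) show "\<exists>t \<le> T + U + u. exec ((a # cs) @ l) s t out"
    by (intro exI[of _ t']) auto
qed

lemma runs_control:
  assumes "\<And>l. control (c # l) s = Some (cs @ l)" "runs_list cs s T out"
  shows "runs c s (Suc T) out"
  unfolding runs_list_def
proof (intro allI impI)
  fix l u out' assume "resumes l out u out'"
  then obtain t where "t \<le> T + u" "exec (cs @ l) s t out'" using runs_listD[OF assms(2)] by blast
  then show "\<exists>t \<le> Suc T + u. exec ([c] @ l) s t out'"
    using assms(1) by (intro exI[of _ "Suc t"]) (auto intro: exec.Control)
qed

lemma runs_Skip: "runs Skip s 1 (Some s)"
  using runs_control[OF _ runs_list_Nil] by simp

lemma runs_Fail: "runs Fail s 1 None"
  unfolding runs_list_def resumes_def using exec.Fail le_add1 by fastforce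

lemma runs_Push: "runs (Push r b) s 2 (Some (s(r := b # s r)))"
  unfolding runs_list_def resumes_def using exec.Push by fastforce

lemma runs_Pop: "runs (Pop r) s 1 (Some (s(r := tl (s r))))"
  unfolding runs_list_def resumes_def using exec.Pop by fastforce

lemma runs_Seq:
  assumes "runs a s T (map_option F r)" "\<And>x. r = Some x \<Longrightarrow> runs b (F x) U (G x)"
  shows "runs (a ;; b) s (Suc (T + U)) (Option.bind r G)"
  by (rule runs_control[OF _ runs_list_Cons[OF assms]]) auto

lemma runs_Case:
  "runs (case s r of [] \<Rightarrow> a | x # _ \<Rightarrow> if x then c else b) s T out \<Longrightarrow>
    runs (Case r a b c) s (Suc T) out"
  by (rule runs_control) auto

lemma runs_While_End: "s r = [] \<Longrightarrow> runs (While r a) s 1 (Some s)"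
  using runs_control[of "While r a" s "[]", OF _ runs_list_Nil] by simp

lemma runs_While:
  assumes "s r \<noteq> []" "runs a s T (map_option F q)" "\<And>x. q = Some x \<Longrightarrow> runs (While r a) (F x) U (G x)"
  shows "runs (While r a) s (Suc (T + U)) (Option.bind q G)"
  by (rule runs_control[OF _ runs_list_Cons[OF assms(2,3)]]) (use assms(1) in auto)

lemma runs_Seq_None: "runs a s T None \<Longrightarrow> runs (a ;; b) s (Suc T) None"
  using runs_Seq[of a s T id None b 0] by simp

lemma runs_While_step_None: "s r \<noteq> [] \<Longrightarrow> runs a s T None \<Longrightarrow> runs (While r a) s (Suc T) None"
  using runs_While[of s r a T id None 0] by simp

lemma runs_While_step:
  "s r \<noteq> [] \<Longrightarrow> runs a s T (Some s') \<Longrightarrow> runs (While r a) s' U out \<Longrightarrow>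
    runs (While r a) s (Suc (T + U)) out"
  using runs_While[of s r a T id "Some s'" U "\<lambda>_. out"] by simp

lemma runs_Seq_Some: "runs a s T (Some s') \<Longrightarrow> runs b s' U out \<Longrightarrow> runs (a ;; b) s (Suc (T + U)) out"
  using runs_Seq[of a s T id "Some s'" b U "\<lambda>_. out"] by simp

lemma runs_Seq_map:
  "runs a s T (map_option F r) \<Longrightarrow> (\<And>x. r = Some x \<Longrightarrow> runs b (F x) U (Some (G x))) \<Longrightarrow>
    runs (a ;; b) s (Suc (T + U)) (map_option G r)"
  using runs_Seq[of a s T F r b U "\<lambda>x. Some (G x)"] by (simp add: map_conv_bind_option comp_def)

fun loop_free :: "com \<Rightarrow> bool" where
  "loop_free (a ;; b) = (loop_free a \<and> loop_free b)"
| "loop_free (Case r a b c) = (loop_free a \<and> loop_free b \<and> loop_free c)"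
| "loop_free (While r a) = False"
| "loop_free c = True"

fun max_cost :: "com \<Rightarrow> nat" where
  "max_cost (a ;; b) = Suc (max_cost a + max_cost b)"
| "max_cost (Case r a b c) = Suc (max_cost a + max_cost b + max_cost c)"
| "max_cost (Push r b) = 2"
| "max_cost c = 1"

fun denotation :: "com \<Rightarrow> regs \<Rightarrow> regs option" where
  "denotation Fail s = None"
| "denotation (Push r b) s = Some (s(r := b # s r))"
| "denotation (Pop r) s = Some (s(r := tl (s r)))"
| "denotation (a ;; b) s = Option.bind (denotation a s) (denotation b)"
| "denotation (Case r a b c) s =
     (case s r of [] \<Rightarrow> denotation a s | x # _ \<Rightarrow> if x then denotation c s else denotation b s)"
| "denotation c s = Some s"

lemma runs_loop_free: "loop_free c \<Longrightarrow> runs c s (max_cost c) (denotation c s)"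
proof (induction c arbitrary: s)
  case (Seq a b)
  then show ?case
    using runs_Seq[of a s "max_cost a" id "denotation a s" b "max_cost b" "denotation b"]
    by (simp add: option.map_id)
next
  case (Case r a b c)
  then have "runs (case s r of [] \<Rightarrow> a | x # _ \<Rightarrow> if x then c else b) s
      (max_cost a + max_cost b + max_cost c) (denotation (Case r a b c) s)"
    by (auto split: list.split intro: Case.IH[THEN runs_weaken])
  then show ?case by (simp only: max_cost.simps runs_Case)
qed (use runs_Skip runs_Fail runs_Push runs_Pop in auto)

lemma runs_denotation:
  "loop_free c \<Longrightarrow> max_cost c \<le> T \<Longrightarrow> denotation c s = out \<Longrightarrow> runs c s T out"
  using runs_weaken[OF runs_loop_free] by blast

lemma runs_While_Some:
  assumes "s r \<noteq> []" "loop_free c" "denotation c s = Some s'" "runs (While r c) s' U out'"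
    "Suc (max_cost c + U) \<le> T" "out' = out"
  shows "runs (While r c) s T out"
  using runs_weaken[OF runs_While_step] runs_denotation[OF assms(2) order_refl assms(3)] assms
  by blast

lemma runs_While_None:
  assumes "s r \<noteq> []" "loop_free c" "denotation c s = None" "Suc (max_cost c) \<le> T"
  shows "runs (While r c) s T None"
  using runs_weaken[OF runs_While_step_None] runs_denotation[OF assms(2) order_refl assms(3)] assms
  by blast

fun push_copies :: "nat \<Rightarrow> nat \<Rightarrow> bool \<Rightarrow> com" where
  "push_copies 0 r b = Skip"
| "push_copies (Suc k) r b = Push r b ;; push_copies k r b"

lemma push_copies [simp]:
  "loop_free (push_copies k r b)" "max_cost (push_copies k r b) = 3 * k + 1"
  "denotation (push_copies k r b) s = Some (s(r := replicate k b @ s r))"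
  "reg_set (push_copies k r b) = (if k = 0 then {} else {r})"
proof -
  show "denotation (push_copies k r b) s = Some (s(r := replicate k b @ s r))"
    by (induction k arbitrary: s) (auto simp: replicate_app_Cons_same)
qed (induction k; auto)+

lemma runs_push_copies:
  "runs (push_copies k r b) s (3 * k + 1) (Some (s(r := replicate k b @ s r)))"
  by (rule runs_denotation) simp_all

definition for_each_bit :: "nat \<Rightarrow> com \<Rightarrow> com \<Rightarrow> com" where
  "for_each_bit a c0 c1 = While a (Case a Skip (Pop a ;; c0) (Pop a ;; c1))"

lemma runs_for_each_bit:
  assumes "distinct [a, b, c]" "loop_free c0" "loop_free c1" "max_cost c0 + max_cost c1 + 8 \<le> K"
    "\<And>x s. denotation (if x then c1 else c0) s = Some (s(b := f x @ s b, c := g x @ s c))"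
  shows "runs (for_each_bit a c0 c1) s (K * Suc (length (s a)))
    (Some (s(a := [], b := concat (map f (rev (s a))) @ s b, c := concat (map g (rev (s a))) @ s c)))"
proof (induction "s a" arbitrary: s)
  case Nil
  then show ?case unfolding for_each_bit_def
    by (intro runs_weaken[OF runs_While_End]) (use assms(1,4) in \<open>auto simp: fun_eq_iff\<close>)
next
  case (Cons x xs)
  define s' where "s' = s(a := xs, b := f x @ s b, c := g x @ s c)"
  have s'_a: "s' a = xs" using assms(1) by (simp add: s'_def)
  then have IH: "runs (for_each_bit a c0 c1) s' (K * Suc (length xs)) (Some (s'(a := [],
      b := concat (map f (rev xs)) @ s' b, c := concat (map g (rev xs)) @ s' c)))"
    using Cons.hyps(1)[of s'] by simp
  have body: "denotation (Case a Skip (Pop a ;; c0) (Pop a ;; c1)) s = Some s'"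
    using Cons.hyps(2)[symmetric] assms(1) assms(5)[of x "s(a := xs)"] by (auto simp: s'_def)
  show ?case
    unfolding for_each_bit_def
    by (rule runs_While_Some[OF _ _ body IH[unfolded for_each_bit_def]])
      (use Cons.hyps(2)[symmetric] assms in \<open>auto simp: s'_def fun_eq_iff\<close>)
qed

definition spread :: "nat \<Rightarrow> nat \<Rightarrow> nat \<Rightarrow> com" where
  "spread k a b = for_each_bit a (push_copies k b False) (push_copies k b True)"

lemma runs_spread:
  assumes "a \<noteq> b"
  shows "runs (spread k a b) s ((6 * k + 10) * Suc (length (s a)))
    (Some (s(a := [], b := concat (map (replicate k) (rev (s a))) @ s b)))"
proof -
  obtain c where c: "c \<notin> {a, b}" using ex_new_if_finite[of "{a, b}"] infinite_UNIV_nat by auto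
  have "runs (spread k a b) s ((6 * k + 10) * Suc (length (s a)))
    (Some (s(a := [], b := concat (map (replicate k) (rev (s a))) @ s b,
      c := concat (map (\<lambda>_. []) (rev (s a))) @ s c)))"
    unfolding spread_def
    by (rule runs_for_each_bit) (use assms c in \<open>auto simp: fun_eq_iff\<close>)
  then show ?thesis by (rule runs_weaken) (use c in \<open>auto simp: fun_eq_iff\<close>)
qed

definition spread_count :: "nat \<Rightarrow> nat \<Rightarrow> nat \<Rightarrow> nat \<Rightarrow> com" where
  "spread_count k a b c =
     for_each_bit a (push_copies k b False ;; Push c True) (push_copies k b True ;; Push c True)"

lemma runs_spread_count:
  assumes "distinct [a, b, c]"
  shows "runs (spread_count k a b c) s ((6 * k + 16) * Suc (length (s a)))
    (Some (s(a := [], b := concat (map (replicate k) (rev (s a))) @ s b,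
      c := replicate (length (s a)) True @ s c)))"
proof -
  have "runs (spread_count k a b c) s ((6 * k + 16) * Suc (length (s a)))
    (Some (s(a := [], b := concat (map (replicate k) (rev (s a))) @ s b,
      c := concat (map (\<lambda>_. [True]) (rev (s a))) @ s c)))"
    unfolding spread_count_def
    by (rule runs_for_each_bit) (use assms in \<open>auto simp: fun_eq_iff\<close>)
  then show ?thesis by (simp add: map_replicate_const)
qed

lemma concat_map_replicate_1 [simp]: "concat (map (replicate (Suc 0)) xs) = xs"
  by (induction xs) auto

lemma length_concat_map_replicate [simp]: "length (concat (map (replicate k) xs)) = k * length xs"
  by (induction xs) auto

abbreviation move_rev :: "nat \<Rightarrow> nat \<Rightarrow> com" where
  "move_rev \<equiv> spread 1"

abbreviation (input) reg_guard :: nat where "reg_guard \<equiv> 9"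

definition move_ones :: "nat \<Rightarrow> nat \<Rightarrow> com" where
  "move_ones a b = Push reg_guard True ;;
     While reg_guard (Case a (Pop reg_guard) (Pop reg_guard) (Pop a ;; Push b True))"

lemma runs_move_ones:
  assumes "distinct [a, b, reg_guard]" "s reg_guard = []"
  shows "runs (move_ones a b) s (12 * length (takeWhile (\<lambda>b. b) (s a)) + 15)
    (Some (s(a := dropWhile (\<lambda>b. b) (s a), b := takeWhile (\<lambda>b. b) (s a) @ s b)))"
proof -
  let ?c = "Case a (Pop reg_guard) (Pop reg_guard) (Pop a ;; Push b True)"
  have loop: "runs (While reg_guard ?c) s (12 * length (takeWhile (\<lambda>b. b) xs) + 12)
      (Some (s(a := dropWhile (\<lambda>b. b) xs, b := takeWhile (\<lambda>b. b) xs @ s b, reg_guard := [])))"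
    if "s a = xs" "s reg_guard = [True]" for s xs
    using that
  proof (induction xs arbitrary: s)
    case Nil
    show ?case
      by (rule runs_While_Some[OF _ _ _ runs_While_End[of "s(reg_guard := [])"]])
        (use Nil assms(1) in \<open>auto simp: fun_eq_iff\<close>)
  next
    case (Cons x xs)
    show ?case
    proof (cases x)
      case False
      show ?thesis
        by (rule runs_While_Some[OF _ _ _ runs_While_End[of "s(reg_guard := [])"]])
          (use False Cons.prems assms(1) in \<open>auto simp: fun_eq_iff\<close>)
    next
      case True
      define s' where "s' = s(a := xs, b := True # s b)"
      have ones: "takeWhile (\<lambda>b. b) xs @ True # ys = True # takeWhile (\<lambda>b. b) xs @ ys" for ys
        by (induction xs) auto
      have IH: "runs (While reg_guard ?c) s' (12 * length (takeWhile (\<lambda>b. b) xs) + 12)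
          (Some (s'(a := dropWhile (\<lambda>b. b) xs, b := takeWhile (\<lambda>b. b) xs @ s' b, reg_guard := [])))"
        using Cons.prems assms(1) by (intro Cons.IH) (auto simp: s'_def)
      show ?thesis
        by (rule runs_While_Some[OF _ _ _ IH])
          (use True Cons.prems assms(1) in \<open>auto simp: s'_def fun_eq_iff ones\<close>)
    qed
  qed
  have "runs (Push reg_guard True) s 2 (Some (s(reg_guard := [True])))"
    using runs_Push[of reg_guard True s] assms(2) by simp
  from runs_Seq_Some[OF this loop] show ?thesis
    unfolding move_ones_def
    by (rule runs_weaken) (use assms in \<open>auto simp: fun_eq_iff\<close>)
qed

fun unpair :: "bool list \<Rightarrow> (bool list \<times> bool list) option" where
  "unpair (b # b' # u) =
     (if b = b' then map_option (apfst ((#) b)) (unpair u) else if b' then Some ([], u) else None)"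
| "unpair u = None"

lemma word_pair_Nil: "word_pair [] y = False # True # y"
  and word_pair_Cons: "word_pair (b # x) y = b # b # word_pair x y"
  by (simp_all add: word_pair_def)

lemma unpair_word_pair [simp]: "unpair (word_pair x y) = Some (x, y)"
  by (induction x) (simp_all add: word_pair_Nil word_pair_Cons)

lemma unpair_eq_Some_iff: "unpair u = Some (x, y) \<longleftrightarrow> u = word_pair x y"
proof
  show "unpair u = Some (x, y) \<Longrightarrow> u = word_pair x y"
    by (induction u arbitrary: x rule: unpair.induct)
      (auto simp: word_pair_Nil word_pair_Cons split: if_splits)
qed simp

lemma word_pair_inject: "word_pair x y = word_pair x' y' \<longleftrightarrow> x = x' \<and> y = y'"
  by (metis option.inject prod.inject unpair_word_pair)

lemma word_pair_altdef: "word_pair x y = concat (map (replicate 2) x) @ [False, True] @ y"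
  by (induction x) (simp_all add: word_pair_Nil word_pair_Cons numeral_2_eq_2)

lemma length_word_pair: "length (word_pair x y) = 2 * length x + 2 + length y"
  by (simp add: word_pair_altdef)

definition parse_step :: "nat \<Rightarrow> nat \<Rightarrow> com" where
  "parse_step a b = Case a Fail
     (Pop a ;; Case a Fail (Pop a ;; Push b False) (Pop a ;; Pop reg_guard))
     (Pop a ;; Case a Fail Fail (Pop a ;; Push b True))"

definition parse_pair :: "nat \<Rightarrow> nat \<Rightarrow> com" where
  "parse_pair a b = Push reg_guard True ;; While reg_guard (parse_step a b)"

lemma runs_parse_loop:
  assumes "distinct [a, b, reg_guard]" "s reg_guard = [True]"
  shows "runs (While reg_guard (parse_step a b)) s (40 * length (s a) + 35)
    (map_option (\<lambda>(x, y). s(a := y, b := rev x @ s b, reg_guard := [])) (unpair (s a)))"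
  using assms(2)
proof (induction "s a" arbitrary: s rule: unpair.induct)
  case (1 b1 b2 u)
  note s_a = 1(2)[symmetric]
  consider (data) "b1 = b2" | (separator) "\<not> b1" "b2" | (malformed) "b1" "\<not> b2" by blast
  then show ?case
  proof cases
    case data
    define s' where "s' = s(a := u, b := b1 # s b)"
    have IH: "runs (While reg_guard (parse_step a b)) s' (40 * length (s' a) + 35)
        (map_option (\<lambda>(x, y). s'(a := y, b := rev x @ s' b, reg_guard := [])) (unpair (s' a)))"
      by (rule "1.hyps"(1)) (use data "1.prems" assms(1) in \<open>auto simp: s'_def\<close>)
    show ?thesis
      by (rule runs_While_Some[OF _ _ _ IH])
        (use data "1.prems" assms(1) s_a in
          \<open>auto simp: parse_step_def s'_def fun_eq_iff option.map_comp intro!: option.map_cong0\<close>)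
  next
    case separator
    show ?thesis
      by (rule runs_While_Some[OF _ _ _ runs_While_End[of "s(a := u, reg_guard := [])"]])
        (use separator "1.prems" assms(1) s_a in \<open>auto simp: parse_step_def fun_eq_iff\<close>)
  next
    case malformed
    show ?thesis
      by (rule runs_weaken[OF runs_While_None])
        (use malformed "1.prems" assms(1) s_a in \<open>auto simp: parse_step_def\<close>)
  qed
next
  case "2_1"
  show ?case
    by (rule runs_weaken[OF runs_While_None])
      (use "2_1"(1)[symmetric] "2_1"(2) assms(1) in \<open>auto simp: parse_step_def\<close>)
next
  case ("2_2" v)
  show ?case
    by (rule runs_weaken[OF runs_While_None])
      (use "2_2"(1)[symmetric] "2_2"(2) assms(1) in \<open>auto simp: parse_step_def\<close>)
qed

lemma runs_parse_pair:
  assumes "distinct [a, b, reg_guard]" "s reg_guard = []"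
  shows "runs (parse_pair a b) s (40 * Suc (length (s a)))
    (map_option (\<lambda>(x, y). s(a := y, b := rev x @ s b)) (unpair (s a)))"
proof -
  have "runs (Push reg_guard True) s 2 (Some (s(reg_guard := [True])))"
    using runs_Push[of reg_guard True s] assms(2) by simp
  from runs_Seq_Some[OF this runs_parse_loop[OF assms(1)]] show ?thesis
    unfolding parse_pair_def
    by (rule runs_weaken) (use assms in \<open>auto simp: fun_eq_iff intro!: option.map_cong0\<close>)
qed

lemma ptime_transducerI:
  fixes p :: "nat poly"
  assumes "reg_set P \<subseteq> {..Z}" "V \<le> Z" "\<And>u. runs P (init_regs u) (poly p (length u)) (out u)"
    "\<And>u. f u = map_option (\<lambda>s. (starts_True (s V), s Z)) (out u)"
  shows "ptime_transducer f"
proof -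
  have "\<exists>t \<le> poly p (length u). \<exists>out. exec [P] (init_regs u) t out \<and>
      f u = map_option (\<lambda>s. (starts_True (s V), s Z)) out" for u
    using runs_exec[OF assms(3)] assms(4) by blast
  with assms(1,2) show ?thesis unfolding ptime_transducer_def by blast
qed

section \<open>Imposing the length bound on witnesses\<close>

abbreviation (input) reg_input :: nat where "reg_input \<equiv> 0"
abbreviation (input) reg_instance :: nat where "reg_instance \<equiv> 1"
abbreviation (input) reg_temp :: nat where "reg_temp \<equiv> 2"
abbreviation (input) reg_counter :: nat where "reg_counter \<equiv> 3"
abbreviation (input) reg_base :: nat where "reg_base \<equiv> 4"
abbreviation (input) reg_value :: nat where "reg_value \<equiv> 5"
abbreviation (input) reg_product :: nat where "reg_product \<equiv> 6"
abbreviation (input) reg_copy :: nat where "reg_copy \<equiv> 7"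
abbreviation (input) reg_output :: nat where "reg_output \<equiv> 11"

definition multiply_step :: com where
  "multiply_step =
    Pop reg_value ;; spread_count 1 reg_base reg_copy reg_product ;; move_rev reg_copy reg_base"

lemma runs_multiply:
  assumes "s reg_base = replicate N True" "s reg_value = replicate m True" "s reg_copy = []"
  shows "runs (While reg_value multiply_step) s (50 * Suc N * m + 1)
    (Some (s(reg_value := [], reg_product := replicate (m * N) True @ s reg_product)))"
  using assms
proof (induction m arbitrary: s)
  case 0
  then show ?case by (intro runs_weaken[OF runs_While_End]) (auto simp: fun_eq_iff)
next
  case (Suc m)
  define s' where
    "s' = s(reg_value := replicate m True, reg_product := replicate N True @ s reg_product)"
  have body: "runs multiply_step s (50 * Suc N - 1) (Some s')"
    unfolding multiply_step_def
    by (rule runs_weaken[OF runs_Seq_Some[OF runs_Pop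
          runs_Seq_Some[OF runs_spread_count runs_spread]]])
      (use Suc.prems in \<open>auto simp: s'_def fun_eq_iff\<close>)
  have IH: "runs (While reg_value multiply_step) s' (50 * Suc N * m + 1)
      (Some (s'(reg_value := [], reg_product := replicate (m * N) True @ s' reg_product)))"
    using Suc.prems by (intro Suc.IH) (auto simp: s'_def)
  have "s reg_value \<noteq> []" using Suc.prems by simp
  from runs_While_step[OF this body IH] show ?case
    by (rule runs_weaken)
      (auto simp: s'_def fun_eq_iff replicate_add[symmetric] algebra_simps simp flip: append_assoc)
qed

definition horner_step :: "nat \<Rightarrow> com" where
  "horner_step a = While reg_value multiply_step ;; move_rev reg_product reg_value ;;
    push_copies a reg_value True"

lemma runs_horner_step:
  assumes "s reg_base = replicate N True" "s reg_value = replicate m True" "s reg_product = []"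
    "s reg_copy = []"
  shows "runs (horner_step a) s (70 * Suc N * m + 3 * a + 30)
    (Some (s(reg_value := replicate (a + N * m) True)))"
  unfolding horner_step_def
  by (rule runs_weaken[OF runs_Seq_Some[OF runs_multiply
        runs_Seq_Some[OF runs_spread runs_push_copies]]])
    (use assms in \<open>auto simp: fun_eq_iff replicate_add algebra_simps\<close>)

definition polynomial_program :: "nat poly \<Rightarrow> com \<Rightarrow> nat poly \<Rightarrow> bool" where
  "polynomial_program p c T \<longleftrightarrow> reg_set c \<subseteq> {..reg_copy} \<and>
     (\<forall>s N. s reg_base = replicate N True \<longrightarrow> s reg_value = [] \<longrightarrow> s reg_product = [] \<longrightarrow> s reg_copy = [] \<longrightarrow>
        runs c s (poly T N) (Some (s(reg_value := replicate (poly p N) True))))"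

lemma ex_polynomial_program: "\<exists>c T. polynomial_program p c T"
proof (induction p)
  case 0
  have "runs Skip s (poly 1 N) (Some (s(reg_value := replicate (poly 0 N) True)))"
    if "s reg_value = []" for s N
    by (rule runs_weaken[OF runs_Skip]) (use that in \<open>auto simp: fun_eq_iff\<close>)
  then show ?case by (intro exI[of _ Skip] exI[of _ 1]) (simp add: polynomial_program_def)
next
  case (pCons a p)
  then obtain c T where c: "polynomial_program p c T" by blast
  define U where "U = T + [:70, 70:] * p + [:3 * a + 31:]"
  have "runs (c ;; horner_step a) s (poly U N)
      (Some (s(reg_value := replicate (poly (pCons a p) N) True)))"
    if s: "s reg_base = replicate N True" "s reg_value = []" "s reg_product = []"
      "s reg_copy = []" for s N
  proof -
    have "runs c s (poly T N) (Some (s(reg_value := replicate (poly p N) True)))"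
      using c s by (simp add: polynomial_program_def)
    then show ?thesis
      by (rule runs_weaken[OF runs_Seq_Some[OF _ runs_horner_step[of _ N "poly p N"]]])
        (use s in \<open>auto simp: U_def algebra_simps\<close>)
  qed
  moreover have "reg_set (c ;; horner_step a) \<subseteq> {..reg_copy}"
    using c
    by (auto simp: polynomial_program_def horner_step_def multiply_step_def spread_def
        spread_count_def for_each_bit_def)
  ultimately show ?case unfolding polynomial_program_def by blast
qed

definition compare_step :: com where
  "compare_step = Pop reg_counter ;; Case reg_value Fail (Pop reg_value) (Pop reg_value)"

lemma runs_compare:
  assumes "s reg_counter = replicate m True" "s reg_value = replicate k True"
  shows "runs (While reg_counter compare_step) s (10 * m + 7)
    (if m \<le> k then Some (s(reg_counter := [], reg_value := replicate (k - m) True)) else None)"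
  using assms
proof (induction m arbitrary: s k)
  case 0
  then show ?case by (intro runs_weaken[OF runs_While_End]) (auto simp: fun_eq_iff)
next
  case (Suc m)
  show ?case
  proof (cases k)
    case 0
    have "runs (While reg_counter compare_step) s (10 * Suc m + 7) None"
      by (rule runs_While_None) (use Suc.prems 0 in \<open>auto simp: compare_step_def\<close>)
    then show ?thesis using 0 by simp
  next
    case (Suc k')
    define s' where "s' = s(reg_counter := replicate m True, reg_value := replicate k' True)"
    have "denotation compare_step s = Some s'"
      using Suc.prems Suc by (auto simp: compare_step_def s'_def)
    from runs_While_Some[OF _ _ this Suc.IH[of s' k']] show ?thesis
      using Suc.prems Suc by (auto simp: s'_def compare_step_def fun_eq_iff)
  qed
qed

definition bound_program :: "com \<Rightarrow> com" where
  "bound_program c = parse_pair reg_input reg_instance ;; move_rev reg_input reg_temp ;;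
     spread_count 1 reg_temp reg_output reg_counter ;;
     (Push reg_output True ;; Push reg_output False) ;; spread_count 2 reg_instance reg_output reg_base ;; c ;; While reg_counter compare_step"

definition bounded_regs :: "bool list \<Rightarrow> bool list \<Rightarrow> regs" where
  "bounded_regs x y = (\<lambda>_. [])(reg_counter := replicate (length y) True,
     reg_base := replicate (length x) True, reg_output := word_pair x y)"

lemma runs_bound_test:
  assumes "polynomial_program p c T"
  shows "runs (c ;; While reg_counter compare_step) (bounded_regs x y)
    (poly T (length x) + 10 * length y + 8)
    (if length y \<le> poly p (length x) then Some ((bounded_regs x y)
       (reg_counter := [], reg_value := replicate (poly p (length x) - length y) True)) else None)"
proof -
  have "runs c (bounded_regs x y) (poly T (length x))
      (Some ((bounded_regs x y)(reg_value := replicate (poly p (length x)) True)))"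
    using assms by (simp add: polynomial_program_def bounded_regs_def)
  then show ?thesis
    by (rule runs_weaken[OF runs_Seq_Some[OF _ runs_compare[of _ "length y" "poly p (length x)"]]])
      (auto simp: bounded_regs_def fun_eq_iff)
qed

lemma runs_bound_program:
  assumes "polynomial_program p c T"
  shows "runs (bound_program c) (init_regs u) (poly (T + [:300, 300:]) (length u))
    (Option.bind (unpair u) (\<lambda>(x, y). if length y \<le> poly p (length x) then Some ((bounded_regs x y)
       (reg_counter := [], reg_value := replicate (poly p (length x) - length y) True)) else None))"
    (is "runs _ _ _ (Option.bind _ ?out)")
proof -
  let ?parsed = "\<lambda>(x, y). (init_regs u)(reg_input := y, reg_instance := rev x)"
  have "runs (parse_pair reg_input reg_instance) (init_regs u) (40 * Suc (length u))
      (map_option ?parsed (unpair u))"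
    by (rule runs_weaken[OF runs_parse_pair]) (auto simp: init_regs_def)
  then show ?thesis unfolding bound_program_def
  proof (rule runs_weaken[OF runs_Seq])
    fix xy assume "unpair u = Some xy"
    moreover obtain x y where xy: "xy = (x, y)" by (cases xy)
    ultimately have u: "u = word_pair x y" by (simp add: unpair_eq_Some_iff)
    then have len: "length u = 2 * length x + 2 + length y" by (simp add: length_word_pair)
    then have time_mono: "poly T (length x) \<le> poly T (length u)" by (intro poly_nat_mono) simp
    show "runs (move_rev reg_input reg_temp ;; spread_count 1 reg_temp reg_output reg_counter ;;
        (Push reg_output True ;; Push reg_output False) ;;
        spread_count 2 reg_instance reg_output reg_base ;; c ;; While reg_counter compare_step)
        (?parsed xy) (poly T (length u) + 200 * length u + 200) (?out xy)"
      unfolding xy prod.case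
      by (rule runs_weaken[OF runs_Seq_Some[OF runs_spread runs_Seq_Some[OF runs_spread_count
            runs_Seq_Some[OF runs_Seq_Some[OF runs_Push runs_Push]
            runs_Seq_Some[OF runs_spread_count runs_start_eq[OF runs_bound_test[OF assms, of x y]]]]]]])
        (use time_mono in \<open>auto
          simp: len bounded_regs_def init_regs_def word_pair_altdef fun_eq_iff\<close>)
  qed auto
qed

theorem ptime_relation_bounded:
  fixes p :: "nat poly"
  assumes "ptime_relation R"
  shows "ptime_relation {(x, y) \<in> R. length y \<le> poly p (length x)}"
proof -
  obtain c T where c: "polynomial_program p c T" using ex_polynomial_program by blast
  define L where "L = {word_pair x y | x y. (x, y) \<in> R}"
  let ?f = "\<lambda>u. Option.bind (unpair u)
      (\<lambda>(x, y). if length y \<le> poly p (length x) then Some (False, u) else None)"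
  have "ptime_transducer ?f"
  proof (rule ptime_transducerI[OF _ _ runs_bound_program[OF c]])
    have "reg_set c \<subseteq> {..reg_copy}" using c by (simp add: polynomial_program_def)
    also have "{..reg_copy} \<subseteq> {..reg_output}" by simp
    finally show "reg_set (bound_program c) \<subseteq> {..reg_output}"
      by (auto simp: bound_program_def parse_pair_def parse_step_def spread_def spread_count_def
          for_each_bit_def compare_step_def)
  qed (auto simp: bounded_regs_def unpair_eq_Some_iff split: bind_split)
  then have "{u. \<exists>b z. ?f u = Some (b, z) \<and> z \<in> L} \<in> PTIME"
    by (rule PTIME_transducer_preimage) (use assms in \<open>simp add: ptime_relation_def L_def\<close>)
  moreover have "{u. \<exists>b z. ?f u = Some (b, z) \<and> z \<in> L} =
      {word_pair x y | x y. (x, y) \<in> {(x, y) \<in> R. length y \<le> poly p (length x)}}"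
    by (auto simp: L_def unpair_eq_Some_iff word_pair_inject bind_eq_Some_conv split: if_splits)
  ultimately show ?thesis by (simp add: ptime_relation_def)
qed

section \<open>Sums over the leaves of choice trees\<close>

datatype 'a choice_tree = Dead | Leaf 'a | Fork "'a choice_tree" "'a choice_tree"

primrec bind_tree :: "'a choice_tree \<Rightarrow> ('a \<Rightarrow> 'b choice_tree) \<Rightarrow> 'b choice_tree" where
  "bind_tree Dead k = Dead"
| "bind_tree (Leaf a) k = k a"
| "bind_tree (Fork t u) k = Fork (bind_tree t k) (bind_tree u k)"

adhoc_overloading Monad_Syntax.bind \<rightleftharpoons> bind_tree

primrec follow :: "'a choice_tree \<Rightarrow> bool list \<Rightarrow> ('a \<times> bool list) option" where
  "follow Dead ys = None"
| "follow (Leaf a) ys = Some (a, ys)"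
| "follow (Fork t u) ys =
    (case ys of [] \<Rightarrow> None | b # ys' \<Rightarrow> if b then follow u ys' else follow t ys')"

primrec leaf_sum :: "'a choice_tree \<Rightarrow> ('a \<Rightarrow> 'b :: comm_monoid_add) \<Rightarrow> 'b" where
  "leaf_sum Dead f = 0"
| "leaf_sum (Leaf a) f = f a"
| "leaf_sum (Fork t u) f = leaf_sum t f + leaf_sum u f"

primrec depth :: "'a choice_tree \<Rightarrow> nat" where
  "depth Dead = 0"
| "depth (Leaf a) = 0"
| "depth (Fork t u) = Suc (max (depth t) (depth u))"

lemma bind_tree_assoc: "(t \<bind> k) \<bind> k' = t \<bind> (\<lambda>a. k a \<bind> k')" for t :: "'a choice_tree"
  by (induction t) auto

lemma set_bind_tree: "set_choice_tree (t \<bind> k) = (\<Union>a \<in> set_choice_tree t. set_choice_tree (k a))"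
  by (induction t) auto

lemma follow_bind: "follow (t \<bind> k) ys = Option.bind (follow t ys) (\<lambda>(a, ys'). follow (k a) ys')"
  by (induction t arbitrary: ys) (auto split: list.split)

lemma follow_map: "follow (map_choice_tree f t) ys = map_option (apfst f) (follow t ys)"
  by (induction t arbitrary: ys) (auto split: list.split)

lemma leaf_sum_bind: "leaf_sum (t \<bind> k) f = leaf_sum t (\<lambda>a. leaf_sum (k a) f)"
  by (induction t) auto

lemma leaf_sum_map: "leaf_sum (map_choice_tree g t) f = leaf_sum t (\<lambda>a. f (g a))"
  by (induction t) auto

lemma leaf_sum_cong: "(\<And>a. a \<in> set_choice_tree t \<Longrightarrow> f a = g a) \<Longrightarrow> leaf_sum t f = leaf_sum t g"
  by (induction t) auto

lemma leaf_sum_diff: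
  "leaf_sum t (\<lambda>a. f a - g a) = leaf_sum t f - leaf_sum t (g :: _ \<Rightarrow> 'b :: ab_group_add)"
  by (induction t) (simp_all add: add_diff_add)

lemma leaf_sum_mult_left: "leaf_sum t (\<lambda>a. c * f a) = c * (leaf_sum t f :: 'b :: semiring_0)"
  by (induction t) (auto simp: distrib_left)

lemma leaf_sum_of_nat: "leaf_sum t (\<lambda>a. of_nat (f a)) = (of_nat (leaf_sum t f) :: 'b :: semiring_1)"
  by (induction t) auto

lemma depth_bind_le: "(\<And>a. a \<in> set_choice_tree t \<Longrightarrow> depth (k a) \<le> N) \<Longrightarrow> depth (t \<bind> k) \<le> depth t + N"
  by (induction t) force+

lemma depth_map [simp]: "depth (map_choice_tree f t) = depth t"
  by (induction t) auto

lemma follow_in_set: "follow t ys = Some (a, ys') \<Longrightarrow> a \<in> set_choice_tree t"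
  by (induction t arbitrary: ys) (auto split: list.splits if_splits)

lemma follow_length:
  "follow t ys = Some (a, ys') \<Longrightarrow> length ys' \<le> length ys \<and> length ys \<le> length ys' + depth t"
proof (induction t arbitrary: ys)
  case (Fork t u)
  then obtain b l where ys: "ys = b # l" by (cases ys) auto
  then have "length ys' \<le> length l \<and> length l \<le> length ys' + depth (if b then u else t)"
    using Fork.IH(1)[of l] Fork.IH(2)[of l] Fork.prems by (cases b) auto
  then show ?case using ys by (auto split: if_splits)
qed auto

definition continuations :: "'a choice_tree \<Rightarrow> ('a \<Rightarrow> bool list set) \<Rightarrow> bool list set" where
  "continuations t K = {ys. \<exists>a ys'. follow t ys = Some (a, ys') \<and> ys' \<in> K a}"

lemma continuations_simps:
  "continuations Dead K = {}"
  "continuations (Leaf a) K = K a"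
  "continuations (Fork t u) K = (#) False ` continuations t K \<union> (#) True ` continuations u K"
proof -
  have "ys \<in> continuations (Fork t u) K \<longleftrightarrow>
      ys \<in> (#) False ` continuations t K \<union> (#) True ` continuations u K" for ys
    by (cases ys) (auto simp: continuations_def)
  then show "continuations (Fork t u) K =
      (#) False ` continuations t K \<union> (#) True ` continuations u K"
    by blast
qed (auto simp: continuations_def)

lemma card_continuations:
  assumes "\<And>a. finite (K a)"
  shows "finite (continuations t K) \<and> card (continuations t K) = leaf_sum t (\<lambda>a. card (K a))"
proof (induction t)
  case (Fork t u)
  have "(#) False ` continuations t K \<inter> (#) True ` continuations u K = {}" by auto
  then show ?case using Fork by (simp add: continuations_simps card_Un_disjoint card_image)
qed (simp_all add: continuations_simps assms)

text \<open>
  \<open>B\<close> is a reduction with binary choices, which are read from the front of the witness; the bit at a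
  leaf tells which of two relations the new instance and the remaining witness have to satisfy.
\<close>

definition branching_transducer ::
  "(bool list \<Rightarrow> (bool \<times> bool list) choice_tree) \<Rightarrow> bool list \<Rightarrow> (bool \<times> bool list) option" where
  "branching_transducer B u = do {
     (x, y) \<leftarrow> unpair u;
     ((b, x'), y') \<leftarrow> follow (B x) y;
     Some (b, word_pair x' y') }"

definition ptime_branching :: "(bool list \<Rightarrow> (bool \<times> bool list) choice_tree) \<Rightarrow> bool" where
  "ptime_branching B \<longleftrightarrow> ptime_transducer (branching_transducer B) \<and>
     (\<exists>q :: nat poly. \<forall>x. depth (B x) \<le> poly q (length x) \<and>
        (\<forall>(b, x') \<in> set_choice_tree (B x). length x' \<le> poly q (length x)))"

definition branching_relation ::
  "(bool list \<Rightarrow> (bool \<times> bool list) choice_tree) \<Rightarrow> (bool \<Rightarrow> (bool list \<times> bool list) set) \<Rightarrow>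
    (bool list \<times> bool list) set" where
  "branching_relation B R = {(x, y). y \<in> continuations (B x) (\<lambda>(b, x'). {y'. (x', y') \<in> R b})}"

lemma ptime_branching_relation:
  assumes "ptime_branching B" "\<And>b. ptime_relation (R b)"
  shows "ptime_relation (branching_relation B R)"
proof -
  define L where "L b = {word_pair x y | x y. (x, y) \<in> R b}" for b
  have "{u. \<exists>b z. branching_transducer B u = Some (b, z) \<and> z \<in> L b} \<in> PTIME"
    by (rule PTIME_transducer_preimage)
      (use assms in \<open>simp_all add: ptime_branching_def ptime_relation_def L_def\<close>)
  moreover have "{u. \<exists>b z. branching_transducer B u = Some (b, z) \<and> z \<in> L b} =
      {word_pair x y | x y. (x, y) \<in> branching_relation B R}"
    by (fastforce simp: branching_transducer_def branching_relation_def continuations_def L_def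
        bind_eq_Some_conv unpair_eq_Some_iff word_pair_inject)
  ultimately show ?thesis by (simp add: ptime_relation_def)
qed

definition poly_bounded_relation :: "(bool list \<times> bool list) set \<Rightarrow> bool" where
  "poly_bounded_relation R \<longleftrightarrow> (\<exists>p :: nat poly. \<forall>(x, y) \<in> R. length y \<le> poly p (length x))"

lemma finite_witnesses: "poly_bounded_relation R \<Longrightarrow> finite {y. (x, y) \<in> R}"
proof -
  assume "poly_bounded_relation R"
  then obtain p :: "nat poly" where "\<forall>(x, y) \<in> R. length y \<le> poly p (length x)"
    unfolding poly_bounded_relation_def by blast
  then have "{y. (x, y) \<in> R} \<subseteq> {y. set y \<subseteq> UNIV \<and> length y \<le> poly p (length x)}" by auto
  moreover have "finite {y :: bool list. set y \<subseteq> UNIV \<and> length y \<le> poly p (length x)}"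
    by (rule finite_lists_length_le) simp
  ultimately show ?thesis by (rule finite_subset)
qed

theorem SharpP_iff_bounded_relation:
  "f \<in> SharpP \<longleftrightarrow> (\<exists>R. ptime_relation R \<and> poly_bounded_relation R \<and> f = (\<lambda>x. card {y. (x, y) \<in> R}))"
proof
  assume "f \<in> SharpP"
  then obtain R and p :: "nat poly" where R: "ptime_relation R"
    and f: "\<And>x. f x = card {y. length y \<le> poly p (length x) \<and> (x, y) \<in> R}"
    unfolding SharpP_def by blast
  let ?R = "{(x, y) \<in> R. length y \<le> poly p (length x)}"
  have "f = (\<lambda>x. card {y. (x, y) \<in> ?R})" by (simp add: fun_eq_iff f conj_commute)
  moreover have "poly_bounded_relation ?R" unfolding poly_bounded_relation_def by blast
  ultimately show "\<exists>R. ptime_relation R \<and> poly_bounded_relation R \<and> f = (\<lambda>x. card {y. (x, y) \<in> R})"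
    using ptime_relation_bounded[OF R] by blast
next
  assume "\<exists>R. ptime_relation R \<and> poly_bounded_relation R \<and> f = (\<lambda>x. card {y. (x, y) \<in> R})"
  then obtain R and p :: "nat poly" where "ptime_relation R" "f = (\<lambda>x. card {y. (x, y) \<in> R})"
    and p: "\<forall>(x, y) \<in> R. length y \<le> poly p (length x)"
    unfolding poly_bounded_relation_def by blast
  moreover from p have
    "{y. (x, y) \<in> R} = {y. length y \<le> poly p (length x) \<and> (x, y) \<in> R}" for x by auto
  ultimately show "f \<in> SharpP" unfolding SharpP_def by auto
qed

lemma poly_bounded_branching_relation:
  assumes "ptime_branching B" "\<And>b. poly_bounded_relation (R b)"
  shows "poly_bounded_relation (branching_relation B R)"
proof -
  obtain q :: "nat poly" where q: "\<And>x. depth (B x) \<le> poly q (length x)"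
    "\<And>x b x'. (b, x') \<in> set_choice_tree (B x) \<Longrightarrow> length x' \<le> poly q (length x)"
    using assms(1) unfolding ptime_branching_def by blast
  obtain p :: "bool \<Rightarrow> nat poly" where p: "\<And>b x y. (x, y) \<in> R b \<Longrightarrow> length y \<le> poly (p b) (length x)"
    using assms(2) unfolding poly_bounded_relation_def by (metis case_prodD)
  have "length y \<le> poly (q + pcompose (p False) q + pcompose (p True) q) (length x)"
    if xy: "(x, y) \<in> branching_relation B R" for x y
  proof -
    obtain b x' y' where y: "follow (B x) y = Some ((b, x'), y')" and R: "(x', y') \<in> R b"
      using xy by (auto simp: branching_relation_def continuations_def split: prod.splits)
    have "length y' \<le> poly (p b) (poly q (length x))"
      using p[OF R] poly_nat_mono[OF q(2)[OF follow_in_set[OF y]]] by (rule le_trans)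
    then show ?thesis using follow_length[OF y] q(1)[of x] by (cases b) (auto simp: poly_pcompose)
  qed
  then show ?thesis unfolding poly_bounded_relation_def by blast
qed

theorem SharpP_leaf_sum:
  assumes B: "ptime_branching B" and f: "\<And>b. f b \<in> SharpP"
  shows "(\<lambda>x. leaf_sum (B x) (\<lambda>(b, x'). f b x')) \<in> SharpP"
proof -
  obtain R where R: "\<And>b. ptime_relation (R b)" "\<And>b. poly_bounded_relation (R b)"
    "\<And>b. f b = (\<lambda>x. card {y. (x, y) \<in> R b})"
    using f unfolding SharpP_iff_bounded_relation by metis
  have "leaf_sum (B x) (\<lambda>(b, x'). f b x') = card {y. (x, y) \<in> branching_relation B R}" for x
    using card_continuations[of "\<lambda>(b, x'). {y'. (x', y') \<in> R b}" "B x"] finite_witnesses[OF R(2)]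
    by (simp add: branching_relation_def R(3) case_prod_unfold)
  then show ?thesis
    unfolding SharpP_iff_bounded_relation
    by (intro exI[of _ "branching_relation B R"] conjI ptime_branching_relation[OF B R(1)]
        poly_bounded_branching_relation[OF B R(2)] ext)
qed

abbreviation parity_sign :: "bool \<Rightarrow> int" where
  "parity_sign p \<equiv> if p then -1 else 1"

theorem GapP_leaf_sum:
  assumes B: "ptime_branching B" and h: "h \<in> GapP"
  shows "(\<lambda>x. leaf_sum (B x) (\<lambda>(b, x'). parity_sign b * h x')) \<in> GapP"
proof -
  obtain f g where fg: "f \<in> SharpP" "g \<in> SharpP" "\<And>x. h x = int (f x) - int (g x)"
    using h unfolding GapP_def by blast
  let ?f = "\<lambda>x. leaf_sum (B x) (\<lambda>(b, x'). (if b then g else f) x')"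
  let ?g = "\<lambda>x. leaf_sum (B x) (\<lambda>(b, x'). (if b then f else g) x')"
  have "leaf_sum (B x) (\<lambda>(b, x'). parity_sign b * h x') = int (?f x) - int (?g x)" for x
    unfolding leaf_sum_of_nat[symmetric] leaf_sum_diff[symmetric]
    by (rule leaf_sum_cong) (auto simp: fg(3))
  moreover have "?f \<in> SharpP" "?g \<in> SharpP"
    using fg(1,2) by (auto intro!: SharpP_leaf_sum[OF B])
  ultimately show ?thesis
    unfolding GapP_def mem_Collect_eq by (intro bexI[of _ ?f] bexI[of _ ?g] allI)
qed

section \<open>Choice trees for raising operators and coarsenings\<close>

text \<open>
  One bit per part of \<open>vs\<close>; a set bit is a raising operator moving a unit from this part to \<open>l\<close>.
\<close>

fun raise_part :: "nat \<Rightarrow> nat list \<Rightarrow> bool \<Rightarrow> (nat \<times> nat list \<times> bool) choice_tree" where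
  "raise_part l [] p = Leaf (l, [], p)"
| "raise_part l (v # vs) p = Fork
     (map_choice_tree (\<lambda>(l', vs', p'). (l', v # vs', p')) (raise_part l vs p))
     (if v = 0 then Dead
      else map_choice_tree (\<lambda>(l', vs', p'). (l', (v - 1) # vs', p')) (raise_part (Suc l) vs (\<not> p)))"

text \<open>
  The parts are given from the last to the first. Every part then receives all its increments before
  its decrements, so that an underflow occurs exactly if the final exponent is negative.
\<close>

fun raise_parts :: "nat list \<Rightarrow> nat list \<Rightarrow> bool \<Rightarrow> (nat list \<times> bool) choice_tree" where
  "raise_parts [] vs p = Leaf (vs, p)"
| "raise_parts (l # ls) vs p = do {
     (l', vs', p') \<leftarrow> raise_part l vs p;
     raise_parts ls (l' # vs') p' }"

text \<open>
  The parts \<open>\<alpha>\<close> are complete and \<open>a\<close> is the part being formed. A set bit closes it, a clear bit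
  merges it with the next one, which \<open>strict\<close> forbids.
\<close>

fun merge_parts :: "bool \<Rightarrow> nat list \<Rightarrow> nat \<Rightarrow> nat list \<Rightarrow> (nat list \<times> nat) choice_tree" where
  "merge_parts strict \<alpha> a [] = Leaf (\<alpha>, a)"
| "merge_parts strict \<alpha> a (v # vs) = (if v = 0 then merge_parts strict \<alpha> a vs
     else Fork (if strict then Dead else merge_parts strict \<alpha> (a + v) vs)
       (merge_parts strict (\<alpha> @ [a + v]) 0 vs))"

definition coarsenings :: "bool \<Rightarrow> nat list \<Rightarrow> nat list choice_tree" where
  "coarsenings strict vs = do {
     (\<alpha>, a) \<leftarrow> merge_parts strict [] 0 vs;
     if a = 0 then Leaf \<alpha> else Dead }"

definition schur_coeff_tree :: "bool \<Rightarrow> nat list \<Rightarrow> (bool \<times> nat list) choice_tree" where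
  "schur_coeff_tree strict \<mu> = do {
     (vs, p) \<leftarrow> raise_parts (rev \<mu>) [] False;
     map_choice_tree (Pair p) (coarsenings strict vs) }"

lemma unary_Nil [simp]: "unary [] = []"
  by (simp add: unary_def)

lemma unary_Cons [simp]: "unary (v # vs) = replicate v True @ False # unary vs"
  by (simp add: unary_def)

lemma unary_append: "unary (vs @ ws) = unary vs @ unary ws"
  by (simp add: unary_def)

lemma length_unary: "length (unary vs) = sum_list vs + length vs"
  by (induction vs) auto

lemma takeWhile_unary [simp]: "takeWhile (\<lambda>b. b) (replicate v True @ False # ys) = replicate v True"
  and dropWhile_unary [simp]: "dropWhile (\<lambda>b. b) (replicate v True @ False # ys) = False # ys"
  by (induction v) auto

lemma raise_part_sizes:
  "(l', vs', p') \<in> set_choice_tree (raise_part l vs p) \<Longrightarrow>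
    l' + sum_list vs' = l + sum_list vs \<and> length vs' = length vs"
  by (induction l vs p arbitrary: l' vs' rule: raise_part.induct)
    (fastforce simp: choice_tree.set_map split: if_splits)+

lemma raise_parts_sizes:
  "(vs', p') \<in> set_choice_tree (raise_parts ls vs p) \<Longrightarrow>
    sum_list vs' = sum_list ls + sum_list vs \<and> length vs' = length ls + length vs"
  by (induction ls arbitrary: vs p) (fastforce simp: set_bind_tree dest: raise_part_sizes)+

lemma merge_parts_sizes:
  "(\<alpha>', a') \<in> set_choice_tree (merge_parts strict \<alpha> a vs) \<Longrightarrow>
    sum_list \<alpha>' + a' = sum_list \<alpha> + a + sum_list vs \<and> length \<alpha>' \<le> length \<alpha> + length vs"
  by (induction vs arbitrary: \<alpha> a) (fastforce split: if_splits)+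

lemma depth_raise_part: "depth (raise_part l vs p) \<le> length vs"
  by (induction l vs p rule: raise_part.induct) auto

lemma depth_raise_parts: "depth (raise_parts ls vs p) \<le> length ls * (length ls + length vs)"
proof (induction ls arbitrary: vs p)
  case (Cons l ls)
  have "depth (raise_parts (l # ls) vs p) \<le>
      depth (raise_part l vs p) + length ls * (length ls + Suc (length vs))"
    unfolding raise_parts.simps
  proof (rule depth_bind_le)
    fix leaf assume "leaf \<in> set_choice_tree (raise_part l vs p)"
    then obtain l' vs' p' where "leaf = (l', vs', p')" "length vs' = length vs"
      using raise_part_sizes by (metis prod_cases3)
    then show "depth (case leaf of (l', vs', p') \<Rightarrow> raise_parts ls (l' # vs') p') \<le>
        length ls * (length ls + Suc (length vs))"
      using Cons.IH[of "l' # vs'" p'] by simp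
  qed
  then show ?case using depth_raise_part[of l vs p] by simp
qed simp

lemma depth_merge_parts: "depth (merge_parts strict \<alpha> a vs) \<le> length vs"
  by (induction vs arbitrary: \<alpha> a) (auto simp: le_SucI)

lemma depth_coarsenings: "depth (coarsenings strict vs) \<le> length vs"
  unfolding coarsenings_def
  by (rule order_trans[OF depth_bind_le[where N = 0]]) (auto simp: depth_merge_parts)

lemma coarsenings_sizes:
  "\<alpha> \<in> set_choice_tree (coarsenings strict vs) \<Longrightarrow> sum_list \<alpha> = sum_list vs \<and> length \<alpha> \<le> length vs"
  by (auto simp: coarsenings_def set_bind_tree dest!: merge_parts_sizes split: if_splits)

lemma depth_schur_coeff_tree: "depth (schur_coeff_tree strict \<mu>) \<le> length \<mu> * length \<mu> + length \<mu>"
proof -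
  have "depth (schur_coeff_tree strict \<mu>) \<le> depth (raise_parts (rev \<mu>) [] False) + length \<mu>"
    unfolding schur_coeff_tree_def
  proof (rule depth_bind_le)
    fix leaf assume "leaf \<in> set_choice_tree (raise_parts (rev \<mu>) [] False)"
    then show "depth (case leaf of (vs, p) \<Rightarrow> map_choice_tree (Pair p) (coarsenings strict vs)) \<le>
        length \<mu>"
      using depth_coarsenings[of strict "fst leaf"] raise_parts_sizes[of "fst leaf" "snd leaf"]
      by (simp add: case_prod_unfold)
  qed
  then show ?thesis using depth_raise_parts[of "rev \<mu>" "[]" False] by simp
qed

lemma schur_coeff_tree_sizes:
  "(p, \<alpha>) \<in> set_choice_tree (schur_coeff_tree strict \<mu>) \<Longrightarrow>
    sum_list \<alpha> = sum_list \<mu> \<and> length \<alpha> \<le> length \<mu>"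
  by (auto simp: schur_coeff_tree_def set_bind_tree choice_tree.set_map
    dest!: coarsenings_sizes raise_parts_sizes)

text \<open>
  Decodes a reversed unary word, but is defined on all words, as the program must halt on all inputs.
\<close>

function blocks :: "bool list \<Rightarrow> nat list" where
  "blocks [] = []"
| "blocks (b # t) = length (takeWhile (\<lambda>b. b) t) # blocks (dropWhile (\<lambda>b. b) t)"
  by pat_completeness auto
termination
  by (relation "measure length") (auto simp: less_Suc_eq_le length_dropWhile_le)

lemma length_unary_blocks: "length (unary (blocks t)) = length t"
proof (induction t rule: blocks.induct)
  case (2 b t)
  have "length t = length (takeWhile (\<lambda>b. b) t) + length (dropWhile (\<lambda>b. b) t)"
    by (metis length_append takeWhile_dropWhile_id)
  with 2 show ?case by simp
qed simp

lemma blocks_rev_unary: "blocks (rev (unary vs)) = rev vs"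
proof (induction vs rule: rev_induct)
  case (snoc v vs)
  have "rev (unary vs) = [] \<or> (\<exists>ys. rev (unary vs) = False # ys)"
    by (cases vs rule: rev_cases) (simp_all add: unary_append)
  then have "takeWhile (\<lambda>b. b) (replicate v True @ rev (unary vs)) = replicate v True \<and>
      dropWhile (\<lambda>b. b) (replicate v True @ rev (unary vs)) = rev (unary vs)" by auto
  then show ?case using snoc by (simp add: unary_append)
qed simp


section \<open>The program following these choice trees\<close>

abbreviation (input) reg_witness :: nat where "reg_witness \<equiv> 0"
abbreviation (input) reg_shape :: nat where "reg_shape \<equiv> 10"
abbreviation (input) reg_word :: nat where "reg_word \<equiv> 3"
abbreviation (input) reg_part :: nat where "reg_part \<equiv> 4"
abbreviation (input) reg_parts :: nat where "reg_parts \<equiv> 5"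
abbreviation (input) reg_done :: nat where "reg_done \<equiv> 6"
abbreviation (input) reg_sign :: nat where "reg_sign \<equiv> 7"
abbreviation (input) reg_merged :: nat where "reg_merged \<equiv> 8"

definition read_raise_bit :: com where
  "read_raise_bit = Case reg_witness Fail (Pop reg_witness)
     (Pop reg_witness ;; Case reg_parts Skip Fail
       (Pop reg_parts ;; Push reg_part True ;;
        Case reg_sign Skip (Pop reg_sign ;; Push reg_sign True)
          (Pop reg_sign ;; Push reg_sign False)))"

definition copy_part :: com where
  "copy_part = move_ones reg_parts reg_done ;; Pop reg_parts ;; Push reg_done False"

definition raise_step :: com where
  "raise_step = read_raise_bit ;; copy_part"

lemma runs_copy_part:
  assumes "s reg_parts = unary (v # vs)" "s reg_guard = []"
  shows "runs copy_part s (12 * v + 20)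
    (Some (s(reg_parts := unary vs, reg_done := False # replicate v True @ s reg_done)))"
  unfolding copy_part_def
  by (rule runs_weaken[OF runs_Seq_Some[OF runs_move_ones runs_Seq_Some[OF runs_Pop runs_Push]]])
    (use assms in \<open>auto simp: fun_eq_iff\<close>)

lemma runs_raise_step_None:
  assumes "denotation read_raise_bit s = None"
  shows "runs raise_step s 50 None"
  unfolding raise_step_def
  by (rule runs_weaken[OF runs_Seq_None[OF runs_denotation[OF _ order_refl assms]]])
    (simp_all add: read_raise_bit_def)

lemma runs_raise_step_Some:
  assumes "denotation read_raise_bit s = Some s'" "s' reg_parts = unary (v # vs)"
    "s' reg_guard = []"
  shows "runs raise_step s (12 * v + 70)
    (Some (s'(reg_parts := unary vs, reg_done := False # replicate v True @ s' reg_done)))"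
  unfolding raise_step_def
  by (rule runs_weaken[OF runs_Seq_Some[OF runs_denotation[OF _ order_refl assms(1)]
        runs_copy_part[OF assms(2,3)]]])
    (simp_all add: read_raise_bit_def)

definition part_raised :: "regs \<Rightarrow> (nat \<times> nat list \<times> bool) \<times> bool list \<Rightarrow> regs" where
  "part_raised s = (\<lambda>((l, vs, p), ys). s(reg_witness := ys, reg_part := replicate l True,
     reg_parts := [], reg_done := rev (unary vs) @ s reg_done, reg_sign := [p]))"

lemma runs_raise_loop_Cons:
  assumes regs: "s reg_parts = unary (v # vs)" "s reg_guard = []"
    and read: "denotation read_raise_bit s =
        Some (s(reg_witness := ys, reg_part := replicate l' True,
      reg_parts := unary (v' # vs), reg_sign := [p']))"
    and tree: "follow (raise_part l (v # vs) p) (s reg_witness) =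
      map_option (apfst (\<lambda>(l'', vs', p''). (l'', v' # vs', p''))) (follow (raise_part l' vs p') ys)"
    and "v' \<le> v"
    and loop: "\<And>s. \<lbrakk>s reg_parts = unary vs; s reg_part = replicate l' True; s reg_sign = [p'];
        s reg_guard = []\<rbrakk> \<Longrightarrow>
      runs (While reg_parts raise_step) s (100 * length (unary vs) + 1)
        (map_option (part_raised s) (follow (raise_part l' vs p') (s reg_witness)))"
  shows "runs (While reg_parts raise_step) s (100 * length (unary (v # vs)) + 1)
    (map_option (part_raised s) (follow (raise_part l (v # vs) p) (s reg_witness)))"
proof -
  define s' where "s' = s(reg_witness := ys, reg_part := replicate l' True, reg_parts := unary vs,
    reg_done := False # replicate v' True @ s reg_done, reg_sign := [p'])"
  have ne: "s reg_parts \<noteq> []" using regs by simp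
  have body: "runs raise_step s (12 * v' + 70) (Some s')"
    by (rule runs_weaken[OF runs_raise_step_Some[OF read]])
      (use regs in \<open>auto simp: s'_def fun_eq_iff\<close>)
  have rest: "runs (While reg_parts raise_step) s' (100 * length (unary vs) + 1)
      (map_option (part_raised s') (follow (raise_part l' vs p') (s' reg_witness)))"
    using regs by (intro loop) (auto simp: s'_def)
  show ?thesis
    by (rule runs_weaken[OF runs_While_step[of s reg_parts, OF ne body rest]])
      (use tree regs \<open>v' \<le> v\<close> in
        \<open>auto simp: s'_def part_raised_def fun_eq_iff option.map_comp intro!: option.map_cong0\<close>)
qed

lemma runs_raise_loop:
  assumes "s reg_parts = unary vs" "s reg_part = replicate l True" "s reg_sign = [p]"
    "s reg_guard = []"
  shows "runs (While reg_parts raise_step) s (100 * length (unary vs) + 1)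
    (map_option (part_raised s) (follow (raise_part l vs p) (s reg_witness)))"
  using assms
proof (induction vs arbitrary: s l p)
  case Nil
  then show ?case by (intro runs_weaken[OF runs_While_End]) (auto simp: part_raised_def fun_eq_iff)
next
  case (Cons v vs)
  have ne: "s reg_parts \<noteq> []" using Cons.prems by simp
  have fail: ?case
    if "denotation read_raise_bit s = None"
      "follow (raise_part l (v # vs) p) (s reg_witness) = None"
    by (rule runs_weaken[OF runs_While_step_None[of s reg_parts, OF ne
          runs_raise_step_None[OF that(1)]]])
      (use that(2) in simp_all)
  note continue = runs_raise_loop_Cons[OF Cons.prems(1,4) _ _ _ Cons.IH]
  consider (no_bit) "s reg_witness = []" | (keep) ys where "s reg_witness = False # ys"
    | (underflow) ys where "s reg_witness = True # ys" "v = 0"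
    | (raise) ys v' where "s reg_witness = True # ys" "v = Suc v'"
    by (metis (full_types) list.exhaust not0_implies_Suc)
  then show ?case
  proof cases
    case no_bit
    then show ?thesis by (intro fail) (auto simp: read_raise_bit_def)
  next
    case (keep ys)
    then show ?thesis using Cons.prems
      by (intro continue[of ys l v p]) (auto simp: read_raise_bit_def follow_map fun_eq_iff)
  next
    case (underflow ys)
    then show ?thesis using Cons.prems by (intro fail) (auto simp: read_raise_bit_def)
  next
    case (raise ys v')
    then show ?thesis using Cons.prems
      by (intro continue[of ys "Suc l" v' "\<not> p"])
        (auto simp: read_raise_bit_def follow_map fun_eq_iff)
  qed
qed

lemma follow_raise_part_length_unary:
  assumes "follow (raise_part l vs p) ys = Some ((l', vs', p'), zs)"
  shows "length (unary (l' # vs')) = length (unary (l # vs))"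
  using assms by (auto simp: length_unary dest!: follow_in_set raise_part_sizes)

definition set_exponents :: "regs \<Rightarrow> bool list \<Rightarrow> (nat list \<times> bool) \<times> bool list \<Rightarrow> regs" where
  "set_exponents s t = (\<lambda>((vs, p), ys). s(reg_witness := ys, reg_shape := t, reg_parts := unary vs,
    reg_sign := [p]))"

definition raise_next :: com where
  "raise_next = Pop reg_shape ;; move_ones reg_shape reg_part ;; While reg_parts raise_step ;;
     move_rev reg_done reg_parts ;; Push reg_parts False ;; move_rev reg_part reg_parts"

lemma runs_raise_next:
  assumes "s reg_shape = b # t" "s reg_parts = unary vs" "s reg_sign = [p]"
    "s reg_guard = []" "s reg_part = []" "s reg_done = []"
  defines "l \<equiv> length (takeWhile (\<lambda>b. b) t)"
  shows "runs raise_next s (150 * (l + length (unary vs)) + 100)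
    (map_option (\<lambda>((l', vs', p'), ys). set_exponents s (dropWhile (\<lambda>b. b) t) ((l' # vs', p'), ys))
     (follow (raise_part l vs p) (s reg_witness)))"
proof -
  define s1 where "s1 = s(reg_shape := dropWhile (\<lambda>b. b) t, reg_part := replicate l True)"
  have ones: "takeWhile (\<lambda>b. b) t = replicate l True"
    unfolding l_def by (rule replicate_length_same[symmetric]) (auto dest: set_takeWhileD)
  have loop: "runs (While reg_parts raise_step) s1 (100 * length (unary vs) + 1)
    (map_option (part_raised s1) (follow (raise_part l vs p) (s reg_witness)))"
    using runs_raise_loop[of s1 vs l p] assms by (simp add: s1_def)
  have restore:
    "runs (move_rev reg_done reg_parts ;; Push reg_parts False ;; move_rev reg_part reg_parts)
      (part_raised s1 leaf) (20 * (l + length (unary vs)) + 40)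
      (Some ((\<lambda>((l', vs', p'), ys). set_exponents s (dropWhile (\<lambda>b. b) t)
        ((l' # vs', p'), ys)) leaf))"
    if "follow (raise_part l vs p) (s reg_witness) = Some leaf" for leaf
  proof -
    obtain l' vs' p' ys where leaf: "leaf = ((l', vs', p'), ys)" by (metis prod.collapse)
    have "l' + length (unary vs') = l + length (unary vs)"
      using follow_raise_part_length_unary[OF that[unfolded leaf]] by simp
    then show ?thesis unfolding leaf prod.case
      by (intro runs_weaken[OF runs_Seq_Some[OF runs_spread runs_Seq_Some[OF runs_Push runs_spread]]])
        (use assms(4-6) in \<open>auto simp: s1_def part_raised_def set_exponents_def fun_eq_iff\<close>)
  qed
  have "runs (Pop reg_shape) s 1 (Some (s(reg_shape := t)))"
    using runs_Pop[of reg_shape s] assms(1) by simp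
  moreover have "runs (move_ones reg_shape reg_part) (s(reg_shape := t)) (12 * l + 15) (Some s1)"
    by (rule runs_weaken[OF runs_move_ones]) (use assms ones in \<open>auto simp: s1_def\<close>)
  ultimately show ?thesis
    unfolding raise_next_def
    by (rule runs_weaken[OF runs_Seq_Some[OF _ runs_Seq_Some[OF _ runs_Seq_map[OF loop restore]]]])
      simp_all
qed

lemma runs_raise_parts:
  assumes "s reg_parts = unary vs" "s reg_sign = [p]" "s reg_guard = []" "s reg_part = []"
    "s reg_done = []"
    "length (s reg_shape) + length (unary vs) \<le> N"
  shows "runs (While reg_shape raise_next) s (150 * Suc N * length (s reg_shape) + 1)
    (map_option (set_exponents s [])
      (follow (raise_parts (blocks (s reg_shape)) vs p) (s reg_witness)))"
  using assms
proof (induction "s reg_shape" arbitrary: s vs p rule: blocks.induct)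
  case 1
  then show ?case
    by (intro runs_weaken[OF runs_While_End]) (auto simp: set_exponents_def fun_eq_iff)
next
  case (2 b t)
  define l where "l = length (takeWhile (\<lambda>b. b) t)"
  let ?t' = "dropWhile (\<lambda>b. b) t"
  let ?s' = "\<lambda>((l', vs', p'), ys). set_exponents s ?t' ((l' # vs', p'), ys)"
  note shape = "2.hyps"(2)[symmetric]
  have len_t: "length t = l + length ?t'"
    by (metis l_def length_append takeWhile_dropWhile_id)
  have rest: "runs (While reg_shape raise_next) (?s' leaf) (150 * Suc N * length ?t' + 1)
      ((\<lambda>((l', vs', p'), ys). map_option (set_exponents s [])
         (follow (raise_parts (blocks ?t') (l' # vs') p') ys)) leaf)"
    if "follow (raise_part l vs p) (s reg_witness) = Some leaf" for leaf
  proof -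
    obtain l' vs' p' ys where leaf: "leaf = ((l', vs', p'), ys)" by (metis prod.collapse)
    have "length (unary (l' # vs')) = Suc (l + length (unary vs))"
      using follow_raise_part_length_unary[OF that[unfolded leaf]] by simp
    then have "runs (While reg_shape raise_next) (?s' leaf)
        (150 * Suc N * length (?s' leaf reg_shape) + 1)
      (map_option (set_exponents (?s' leaf) [])
        (follow (raise_parts (blocks (?s' leaf reg_shape)) (l' # vs') p') (?s' leaf reg_witness)))"
      using "2.prems" shape len_t by (intro "2.hyps"(1)) (auto simp: leaf set_exponents_def)
    then show ?thesis
      by (rule runs_weaken) (auto simp: leaf set_exponents_def fun_eq_iff intro!: option.map_cong0)
  qed
  have ne: "s reg_shape \<noteq> []" using shape by simp
  have "l + length (unary vs) < N" using "2.prems"(6) len_t shape by simp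
  then have "150 * (l + length (unary vs)) + 102 \<le> 150 * Suc N" by simp
  then have "150 * (l + length (unary vs)) + 102 + 150 * Suc N * length ?t' \<le>
      150 * Suc N * length (s reg_shape)"
    using len_t shape by (simp add: algebra_simps)
  then show ?case
    by (rule_tac runs_weaken[OF runs_While[of s reg_shape, OF ne
          runs_raise_next[OF shape "2.prems"(1-5), folded l_def] rest]])
      (auto simp: shape l_def follow_bind map_option_bind case_prod_unfold intro!: Option.bind_cong)
qed

definition merge_step :: "bool \<Rightarrow> com" where
  "merge_step strict = Case reg_parts Skip (Pop reg_parts)
     (move_ones reg_parts reg_merged ;; Pop reg_parts ;;
      Case reg_witness Fail (if strict then Fail else Pop reg_witness)
        (Pop reg_witness ;; Push reg_merged False))"

lemma runs_merge_step:
  assumes "s reg_parts = unary (Suc v # vs)" "s reg_guard = []"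
  shows "runs (merge_step strict) s (12 * v + 60)
    (case s reg_witness of [] \<Rightarrow> None | b # ys \<Rightarrow> if strict \<and> \<not> b then None
      else Some (s(reg_witness := ys, reg_parts := unary vs,
        reg_merged := (if b then [False] else []) @ replicate (Suc v) True @ s reg_merged)))"
    (is "runs _ _ _ ?out")
proof -
  let ?tail = "Pop reg_parts ;; Case reg_witness Fail (if strict then Fail else Pop reg_witness)
    (Pop reg_witness ;; Push reg_merged False)"
  have "denotation ?tail (s(reg_parts := False # unary vs,
      reg_merged := replicate (Suc v) True @ s reg_merged)) = ?out"
    by (auto simp: fun_eq_iff split: list.split)
  then have tail: "runs ?tail (s(reg_parts := False # unary vs,
      reg_merged := replicate (Suc v) True @ s reg_merged)) 20 ?out"
    by (intro runs_denotation) auto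
  have "runs (move_ones reg_parts reg_merged) s (12 * v + 30)
      (Some (s(reg_parts := False # unary vs, reg_merged := replicate (Suc v) True @ s reg_merged)))"
    by (rule runs_weaken[OF runs_move_ones]) (use assms in auto)
  from runs_Seq_Some[OF this tail] have
    "runs (move_ones reg_parts reg_merged ;; ?tail) s (12 * v + 59) ?out"
    by (rule runs_weaken) simp_all
  then show ?thesis
    unfolding merge_step_def by (intro runs_weaken[OF runs_Case]) (use assms(1) in auto)
qed

lemma runs_merge_step_zero:
  assumes "s reg_parts = unary (0 # vs)"
  shows "runs (merge_step strict) s 60 (Some (s(reg_parts := unary vs)))"
proof -
  have "runs (Pop reg_parts) s 1 (Some (s(reg_parts := unary vs)))"
    using runs_Pop[of reg_parts s] assms by simp
  then show ?thesis
    unfolding merge_step_def by (intro runs_weaken[OF runs_Case]) (use assms in auto)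
qed

definition parts_merged :: "regs \<Rightarrow> (nat list \<times> nat) \<times> bool list \<Rightarrow> regs" where
  "parts_merged s = (\<lambda>((\<alpha>, a), ys). s(reg_witness := ys, reg_parts := [],
     reg_merged := replicate a True @ rev (unary \<alpha>)))"

lemma runs_merge_parts_Cons:
  assumes regs: "s reg_parts = unary (v # vs)" "s reg_guard = []"
    and body: "runs (merge_step strict) s (12 * v + 60)
        (Some (s(reg_witness := ys, reg_parts := unary vs,
      reg_merged := replicate a' True @ rev (unary \<alpha>'))))"
    and tree: "follow (merge_parts strict \<alpha> a (v # vs)) (s reg_witness) =
        follow (merge_parts strict \<alpha>' a' vs) ys"
    and loop: "\<And>s. \<lbrakk>s reg_parts = unary vs; s reg_merged = replicate a' True @ rev (unary \<alpha>');
        s reg_guard = []\<rbrakk> \<Longrightarrow>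
      runs (While reg_parts (merge_step strict)) s (100 * length (unary vs) + 1)
        (map_option (parts_merged s) (follow (merge_parts strict \<alpha>' a' vs) (s reg_witness)))"
  shows "runs (While reg_parts (merge_step strict)) s (100 * length (unary (v # vs)) + 1)
    (map_option (parts_merged s) (follow (merge_parts strict \<alpha> a (v # vs)) (s reg_witness)))"
proof -
  define s' where "s' = s(reg_witness := ys, reg_parts := unary vs,
    reg_merged := replicate a' True @ rev (unary \<alpha>'))"
  have ne: "s reg_parts \<noteq> []" using regs by simp
  have rest: "runs (While reg_parts (merge_step strict)) s' (100 * length (unary vs) + 1)
      (map_option (parts_merged s') (follow (merge_parts strict \<alpha>' a' vs) (s' reg_witness)))"
    using regs by (intro loop) (auto simp: s'_def)
  show ?thesis
    by (rule runs_weaken[OF runs_While_step[of s reg_parts, OF ne body[folded s'_def] rest]])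
      (use tree in \<open>auto simp: s'_def parts_merged_def fun_eq_iff intro!: option.map_cong0\<close>)
qed

lemma runs_merge_parts:
  assumes "s reg_parts = unary vs" "s reg_merged = replicate a True @ rev (unary \<alpha>)"
    "s reg_guard = []"
  shows "runs (While reg_parts (merge_step strict)) s (100 * length (unary vs) + 1)
    (map_option (parts_merged s) (follow (merge_parts strict \<alpha> a vs) (s reg_witness)))"
  using assms
proof (induction vs arbitrary: s \<alpha> a)
  case Nil
  then show ?case by (intro runs_weaken[OF runs_While_End]) (auto simp: parts_merged_def fun_eq_iff)
next
  case (Cons v vs)
  note continue = runs_merge_parts_Cons[OF Cons.prems(1,3) _ _ Cons.IH]
  show ?case
  proof (cases v)
    case 0
    have "runs (merge_step strict) s (12 * v + 60) (Some (s(reg_witness := s reg_witness,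
        reg_parts := unary vs, reg_merged := replicate a True @ rev (unary \<alpha>))))"
      by (rule runs_weaken[OF runs_merge_step_zero]) (use Cons.prems 0 in \<open>auto simp: fun_eq_iff\<close>)
    then show ?thesis by (rule continue) (simp_all add: 0)
  next
    case (Suc v')
    note step = runs_merge_step[OF Cons.prems(1)[unfolded Suc] Cons.prems(3), of strict]
    show ?thesis
    proof (cases "follow (Fork (if strict then Dead else Leaf False) (Leaf True)) (s reg_witness)")
      case None
      then have "runs (merge_step strict) s (12 * v' + 60) None"
        using step by (auto split: list.splits if_splits)
      moreover have "s reg_parts \<noteq> []" using Cons.prems by simp
      ultimately show ?thesis
        by (rule_tac runs_weaken[OF runs_While_step_None[of s reg_parts]])
          (use None Suc in \<open>auto split: list.splits if_splits\<close>)
    next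
      case (Some r)
      then obtain b ys where wit: "s reg_witness = b # ys" "\<not> (strict \<and> \<not> b)"
        by (auto split: list.splits if_splits)
      let ?\<alpha> = "if b then \<alpha> @ [a + v] else \<alpha>" and ?a = "if b then 0 else a + v"
      have "runs (merge_step strict) s (12 * v + 60)
          (Some (s(reg_witness := ys, reg_parts := unary vs,
          reg_merged := replicate ?a True @ rev (unary ?\<alpha>))))"
        by (rule runs_weaken[OF step]) (use wit Suc Cons.prems in
          \<open>auto simp: fun_eq_iff unary_append replicate_add[symmetric]
            simp flip: replicate_Suc append_assoc\<close>)
      then show ?thesis using wit Suc by (rule_tac continue) auto
    qed
  qed
qed

definition decode_unary :: "bool list \<Rightarrow> nat list" where
  "decode_unary m = rev (blocks (rev m))"

lemma decode_unary_unary [simp]: "decode_unary (unary \<mu>) = \<mu>"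
  by (simp add: decode_unary_def blocks_rev_unary)

lemma length_unary_rev: "length (unary (rev vs)) = length (unary vs)"
  by (simp add: length_unary)

lemma length_unary_decode_unary: "length (unary (decode_unary m)) = length m"
  by (simp add: decode_unary_def length_unary_rev length_unary_blocks)

definition schur_branching :: "bool \<Rightarrow> bool list \<Rightarrow> (bool \<times> bool list) choice_tree" where
  "schur_branching strict x = (case unpair x of None \<Rightarrow> Dead
     | Some (w, m) \<Rightarrow> map_choice_tree (apsnd (\<lambda>\<alpha>. encode (w, \<alpha>)))
       (schur_coeff_tree strict (decode_unary m)))"

definition unpair_nested :: "bool list \<Rightarrow> (bool list \<times> bool list \<times> bool list) option" where
  "unpair_nested u = do {
     (x, y) \<leftarrow> unpair u;
     (w, m) \<leftarrow> unpair x;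
     Some (w, m, y) }"

lemma unpair_nested_length:
  "unpair_nested u = Some (w, m, y) \<Longrightarrow> length w + length m + length y \<le> length u"
  by (auto simp: unpair_nested_def unpair_eq_Some_iff length_word_pair bind_eq_Some_conv)

definition read_input :: com where
  "read_input = parse_pair reg_witness reg_instance ;; move_rev reg_instance reg_temp ;;
     parse_pair reg_temp reg_word ;; move_rev reg_temp reg_shape ;; Push reg_sign False"

definition input_regs :: "bool list \<Rightarrow> bool list \<Rightarrow> bool list \<Rightarrow> regs" where
  "input_regs w m y =
    (\<lambda>_. [])(reg_witness := y, reg_shape := rev m, reg_word := rev w, reg_sign := [False])"

lemma runs_read_instance:
  "runs (move_rev reg_instance reg_temp ;; parse_pair reg_temp reg_word ;;
    move_rev reg_temp reg_shape ;;
      Push reg_sign False) ((\<lambda>_. [])(reg_witness := y, reg_instance := rev x)) (80 * Suc (length x))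
    (map_option (\<lambda>(w, m). input_regs w m y) (unpair x))"
proof -
  let ?s = "(\<lambda>_. [])(reg_witness := y, reg_temp := x)"
  have "runs (move_rev reg_instance reg_temp) ((\<lambda>_. [])(reg_witness := y, reg_instance := rev x))
      (20 * Suc (length x)) (Some ?s)"
    by (rule runs_weaken[OF runs_spread]) (auto simp: fun_eq_iff)
  moreover have "runs (parse_pair reg_temp reg_word) ?s (40 * Suc (length x))
      (map_option (\<lambda>(w, m). ?s(reg_temp := m, reg_word := rev w)) (unpair x))"
    by (rule runs_weaken[OF runs_parse_pair]) auto
  moreover have "runs (move_rev reg_temp reg_shape ;; Push reg_sign False)
      ((\<lambda>(w, m). ?s(reg_temp := m, reg_word := rev w)) wm) (16 * Suc (length x))
      (Some ((\<lambda>(w, m). input_regs w m y) wm))" if "unpair x = Some wm" for wm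
  proof -
    obtain w m where wm: "wm = (w, m)" by (cases wm)
    then have "length m + 2 \<le> length x"
      using that by (auto simp: unpair_eq_Some_iff length_word_pair)
    then show ?thesis unfolding wm prod.case
      by (intro runs_weaken[OF runs_Seq_Some[OF runs_spread runs_Push]])
        (auto simp: input_regs_def fun_eq_iff)
  qed
  ultimately show ?thesis
    by (rule runs_weaken[OF runs_Seq_Some[OF _ runs_Seq_map]]) simp_all
qed

lemma runs_read_input:
  "runs read_input (init_regs u) (200 * Suc (length u))
    (map_option (\<lambda>(w, m, y). input_regs w m y) (unpair_nested u))"
proof -
  let ?parsed = "\<lambda>(x, y). (\<lambda>_. [])(reg_witness := y, reg_instance := rev x)"
  have parse: "runs (parse_pair reg_witness reg_instance) (init_regs u) (40 * Suc (length u))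
      (map_option ?parsed (unpair u))"
    by (rule runs_weaken[OF runs_parse_pair])
      (auto simp: init_regs_def fun_eq_iff intro!: option.map_cong0)
  have rest: "runs (move_rev reg_instance reg_temp ;; parse_pair reg_temp reg_word ;;
      move_rev reg_temp reg_shape ;; Push reg_sign False) (?parsed xy) (80 * Suc (length u))
      ((\<lambda>(x, y). map_option (\<lambda>(w, m). input_regs w m y) (unpair x)) xy)"
    if "unpair u = Some xy" for xy
  proof -
    obtain x y where xy: "xy = (x, y)" by (cases xy)
    then have "length x \<le> length u" using that by (simp add: unpair_eq_Some_iff length_word_pair)
    then show ?thesis unfolding xy prod.case by (intro runs_weaken[OF runs_read_instance]) auto
  qed
  show ?thesis unfolding read_input_def
    by (rule runs_weaken[OF runs_Seq[OF parse rest]])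
      (auto simp: unpair_nested_def map_option_bind map_conv_bind_option comp_def
        intro!: Option.bind_cong)
qed

definition write_output :: com where
  "write_output = Case reg_merged Skip Skip Fail ;; move_rev reg_witness reg_temp ;;
    move_rev reg_temp reg_output ;;
     (Push reg_output True ;; Push reg_output False) ;; spread 2 reg_merged reg_output ;;
     (push_copies 2 reg_output True ;; push_copies 2 reg_output False) ;; spread 4 reg_word reg_output"

lemma word_pair_encode:
  "word_pair (encode (w, \<alpha>)) y =
    concat (map (replicate 4) w) @ replicate 2 False @ replicate 2 True @
     concat (map (replicate 2) (unary \<alpha>)) @ [False, True] @ y"
proof -
  have "concat (map (replicate 2) (concat (map (replicate 2) w))) = concat (map (replicate 4) w)"
    by (induction w) (auto simp: numeral_eq_Suc)
  then show ?thesis by (simp add: word_pair_altdef encode_def)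
qed

definition output_regs :: "bool list \<Rightarrow> bool \<Rightarrow> nat list \<Rightarrow> bool list \<Rightarrow> regs" where
  "output_regs w p \<alpha> y = (\<lambda>_. [])(reg_sign := [p], reg_output := word_pair (encode (w, \<alpha>)) y)"

definition merged_regs :: "bool list \<Rightarrow> bool \<Rightarrow> nat list \<Rightarrow> nat \<Rightarrow> bool list \<Rightarrow> regs" where
  "merged_regs w p \<alpha> a y = (\<lambda>_. [])(reg_witness := y, reg_word := rev w, reg_sign := [p],
     reg_merged := replicate a True @ rev (unary \<alpha>))"

lemma runs_write_output:
  assumes "length w + length (unary \<alpha>) + length y \<le> n"
  shows "runs write_output (merged_regs w p \<alpha> a y) (150 * Suc n)
    (if a = 0 then Some (output_regs w p \<alpha> y) else None)"
proof (cases "a = 0")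
  case True
  have "\<not> starts_True (rev (unary \<alpha>))"
    by (cases \<alpha> rule: rev_cases) (simp_all add: unary_append)
  then have "runs (Case reg_merged Skip Skip Fail) (merged_regs w p \<alpha> a y) 4
      (Some (merged_regs w p \<alpha> a y))"
    using True by (intro runs_denotation) (auto simp: merged_regs_def split: list.split)
  moreover have "runs (move_rev reg_witness reg_temp) (merged_regs w p \<alpha> a y) (16 * Suc n)
      (Some ((merged_regs w p \<alpha> a y)(reg_witness := [], reg_temp := rev y)))"
    by (rule runs_weaken[OF runs_spread]) (use assms in \<open>auto simp: merged_regs_def\<close>)
  moreover have "runs (move_rev reg_temp reg_output)
      ((merged_regs w p \<alpha> a y)(reg_witness := [], reg_temp := rev y)) (16 * Suc n)
      (Some ((merged_regs w p \<alpha> a y)(reg_witness := [], reg_output := y)))"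
    by (rule runs_weaken[OF runs_spread]) (use assms in \<open>auto simp: merged_regs_def fun_eq_iff\<close>)
  moreover have
    "runs ((Push reg_output True ;; Push reg_output False) ;; spread 2 reg_merged reg_output ;;
      (push_copies 2 reg_output True ;; push_copies 2 reg_output False) ;; spread 4 reg_word reg_output)
      ((merged_regs w p \<alpha> a y)(reg_witness := [], reg_output := y)) (60 * Suc n + 50)
        (Some (output_regs w p \<alpha> y))"
    by (rule runs_weaken[OF runs_Seq_Some[OF runs_Seq_Some[OF runs_Push runs_Push]
        runs_Seq_Some[OF runs_spread
        runs_Seq_Some[OF runs_Seq_Some[OF runs_push_copies runs_push_copies] runs_spread]]]])
      (use assms True in \<open>auto simp: merged_regs_def output_regs_def word_pair_encode fun_eq_iff\<close>)
  ultimately show ?thesis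
    unfolding write_output_def using True
    by (rule_tac runs_weaken[OF runs_Seq_Some[OF _ runs_Seq_Some[OF _ runs_Seq_Some]]]) auto
next
  case False
  then have "denotation (Case reg_merged Skip Skip Fail) (merged_regs w p \<alpha> a y) = None"
    by (cases a) (simp_all add: merged_regs_def)
  then show ?thesis
    unfolding write_output_def using False
    by (intro runs_weaken[OF runs_Seq_None[OF runs_denotation[OF _ order_refl]]]) auto
qed

definition raised_regs :: "bool list \<Rightarrow> nat list \<Rightarrow> bool \<Rightarrow> bool list \<Rightarrow> regs" where
  "raised_regs w vs p y =
    (\<lambda>_. [])(reg_witness := y, reg_word := rev w, reg_parts := unary vs, reg_sign := [p])"

lemma runs_merge_and_write:
  assumes "length w + length (unary vs) + length y \<le> n"
  shows "runs (While reg_parts (merge_step strict) ;; write_output) (raised_regs w vs p y)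
      (300 * Suc n)
    (map_option (\<lambda>(\<alpha>, y'). output_regs w p \<alpha> y') (follow (coarsenings strict vs) y))"
proof -
  have merge_part: "runs (While reg_parts (merge_step strict)) (raised_regs w vs p y) (100 * Suc n)
      (map_option (\<lambda>((\<alpha>, a), y'). merged_regs w p \<alpha> a y') (follow (merge_parts strict [] 0 vs) y))"
    by (rule runs_weaken[OF runs_merge_parts[where vs = vs and a = 0 and \<alpha> = "[]"]])
      (use assms in \<open>auto simp: raised_regs_def merged_regs_def parts_merged_def fun_eq_iff
        intro!: option.map_cong0\<close>)
  have output_part: "runs write_output ((\<lambda>((\<alpha>, a), y'). merged_regs w p \<alpha> a y') leaf) (150 * Suc n)
      ((\<lambda>((\<alpha>, a), y'). if a = 0 then Some (output_regs w p \<alpha> y') else None) leaf)"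
    if "follow (merge_parts strict [] 0 vs) y = Some leaf" for leaf
  proof -
    obtain \<alpha> a y' where leaf: "leaf = ((\<alpha>, a), y')" by (metis prod.collapse)
    then have follow: "follow (merge_parts strict [] 0 vs) y = Some ((\<alpha>, a), y')" using that by simp
    have "length (unary \<alpha>) \<le> length (unary vs)"
      using merge_parts_sizes[OF follow_in_set[OF follow]] by (simp add: length_unary)
    then have "length w + length (unary \<alpha>) + length y' \<le> n"
      using assms follow_length[OF follow] by simp
    then show ?thesis by (simp only: leaf prod.case runs_write_output)
  qed
  show ?thesis
    by (rule runs_weaken[OF runs_Seq[OF merge_part output_part]])
      (auto simp: coarsenings_def follow_bind map_option_bind intro!: Option.bind_cong)
qed

lemma runs_raise_all:
  assumes "length w + length m + length y \<le> n"
  shows "runs (While reg_shape raise_next ;; While reg_parts (merge_step strict) ;; write_output)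
    (input_regs w m y) (600 * Suc n * Suc n)
    (map_option (\<lambda>((p, \<alpha>), y'). output_regs w p \<alpha> y')
      (follow (schur_coeff_tree strict (decode_unary m)) y))"
proof -
  let ?tree = "raise_parts (blocks (rev m)) [] False"
  have raise_part: "runs (While reg_shape raise_next) (input_regs w m y) (150 * Suc n * n + 1)
      (map_option (\<lambda>((vs, p), y'). raised_regs w vs p y') (follow ?tree y))"
  proof (rule runs_weaken[OF runs_raise_parts[where vs = "[]" and p = False and N = n]])
    show "150 * Suc n * length (input_regs w m y reg_shape) + 1 \<le> 150 * Suc n * n + 1"
      using assms by (simp add: input_regs_def)
  qed (use assms in \<open>auto simp: input_regs_def raised_regs_def set_exponents_def fun_eq_iff
    intro!: option.map_cong0\<close>)
  have merge_part: "runs (While reg_parts (merge_step strict) ;; write_output)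
      ((\<lambda>((vs, p), y'). raised_regs w vs p y') leaf) (300 * Suc n)
      ((\<lambda>((vs, p), y'). map_option (\<lambda>(\<alpha>, y''). output_regs w p \<alpha> y'')
        (follow (coarsenings strict vs) y')) leaf)"
    if "follow ?tree y = Some leaf" for leaf
  proof -
    obtain vs p y' where leaf: "leaf = ((vs, p), y')" by (metis prod.collapse)
    then have follow: "follow ?tree y = Some ((vs, p), y')" using that by simp
    have "length (unary vs) = length m"
      using raise_parts_sizes[OF follow_in_set[OF follow]] length_unary_blocks[of "rev m"]
      by (simp add: length_unary)
    then have "length w + length (unary vs) + length y' \<le> n"
      using assms follow_length[OF follow] by simp
    then show ?thesis by (simp only: leaf prod.case runs_merge_and_write)
  qed
  show ?thesis
    by (rule runs_weaken[OF runs_Seq[OF raise_part merge_part]])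
      (auto simp: schur_coeff_tree_def decode_unary_def follow_bind follow_map map_option_bind
        option.map_comp comp_def case_prod_unfold algebra_simps intro!: Option.bind_cong)
qed

definition schur_program :: "bool \<Rightarrow> com" where
  "schur_program strict = read_input ;; While reg_shape raise_next ;;
    While reg_parts (merge_step strict) ;; write_output"

lemma runs_schur_program:
  "runs (schur_program strict) (init_regs u) (900 * Suc (length u) * Suc (length u))
    (Option.bind (unpair_nested u) (\<lambda>(w, m, y).
       map_option (\<lambda>((p, \<alpha>), y'). output_regs w p \<alpha> y')
         (follow (schur_coeff_tree strict (decode_unary m)) y)))"
  unfolding schur_program_def
proof (rule runs_weaken[OF runs_Seq[OF runs_read_input]])
  fix wmy assume "unpair_nested u = Some wmy"
  moreover obtain w m y where wmy: "wmy = (w, m, y)" by (metis prod.collapse)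
  ultimately have "length w + length m + length y \<le> length u" by (auto dest: unpair_nested_length)
  then show "runs
      (While reg_shape raise_next ;; While reg_parts (merge_step strict) ;; write_output)
      ((\<lambda>(w, m, y). input_regs w m y) wmy) (600 * Suc (length u) * Suc (length u))
      ((\<lambda>(w, m, y). map_option (\<lambda>((p, \<alpha>), y'). output_regs w p \<alpha> y')
         (follow (schur_coeff_tree strict (decode_unary m)) y)) wmy)"
    by (simp only: wmy prod.case runs_raise_all)
qed (auto simp: algebra_simps)

lemma reg_set_schur_program: "reg_set (schur_program strict) \<subseteq> {..reg_output}"
  by (auto simp: schur_program_def read_input_def write_output_def raise_next_def raise_step_def
      read_raise_bit_def copy_part_def merge_step_def parse_pair_def parse_step_def move_ones_def
      spread_def for_each_bit_def)

lemma branching_transducer_schur_branching: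
  "branching_transducer (schur_branching strict) u =
    map_option (\<lambda>s. (starts_True (s reg_sign), s reg_output))
    (Option.bind (unpair_nested u) (\<lambda>(w, m, y).
       map_option (\<lambda>((p, \<alpha>), y'). output_regs w p \<alpha> y')
         (follow (schur_coeff_tree strict (decode_unary m)) y)))"
proof (cases "unpair u")
  case (Some xy)
  obtain x y where xy: "xy = (x, y)" by (cases xy)
  show ?thesis
  proof (cases "unpair x")
    case (Some wm)
    obtain w m where wm: "wm = (w, m)" by (cases wm)
    show ?thesis
      using \<open>unpair u = Some xy\<close> Some xy wm
      by (auto simp: branching_transducer_def schur_branching_def unpair_nested_def follow_map
          output_regs_def
          map_conv_bind_option intro!: Option.bind_cong)
  qed (use Some xy in \<open>simp add: branching_transducer_def schur_branching_def unpair_nested_def\<close>)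
qed (simp add: branching_transducer_def unpair_nested_def)

lemma ptime_schur_branching: "ptime_branching (schur_branching strict)"
proof -
  have "ptime_transducer (branching_transducer (schur_branching strict))"
    by (rule ptime_transducerI[where p = "[:900, 1800, 900:]" and V = reg_sign,
          OF reg_set_schur_program _ runs_weaken[OF runs_schur_program _ refl]
          branching_transducer_schur_branching]) (simp_all add: algebra_simps)
  moreover have "depth (schur_branching strict x) \<le> poly [:0, 1, 1:] (length x) \<and>
      (\<forall>(b, x') \<in> set_choice_tree (schur_branching strict x).
        length x' \<le> poly [:0, 1, 1:] (length x))" for x
  proof (cases "unpair x")
    case None
    then show ?thesis by (simp add: schur_branching_def)
  next
    case (Some wm)
    obtain w m where wm: "wm = (w, m)" by (cases wm)
    then have x: "x = word_pair w m" using Some by (simp add: unpair_eq_Some_iff)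
    let ?\<mu> = "decode_unary m" and ?n = "length x"
    have n: "?n = 2 * length w + 2 + length m" by (simp add: x length_word_pair)
    have unary_\<mu>: "sum_list ?\<mu> + length ?\<mu> = length m"
      using length_unary_decode_unary by (simp only: length_unary)
    then have "length ?\<mu> * length ?\<mu> + length ?\<mu> \<le> ?n * ?n + ?n"
      using n by (intro add_mono mult_le_mono) auto
    then have "depth (schur_branching strict x) \<le> ?n * ?n + ?n"
      using depth_schur_coeff_tree[of strict ?\<mu>] by (simp add: schur_branching_def x)
    moreover have "length (encode (w, \<alpha>)) \<le> ?n"
      if "(p, \<alpha>) \<in> set_choice_tree (schur_coeff_tree strict ?\<mu>)" for p \<alpha>
      using schur_coeff_tree_sizes[OF that] unary_\<mu> n
      by (simp add: encode_def length_word_pair length_unary)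
    ultimately show ?thesis
      by (fastforce simp: schur_branching_def x choice_tree.set_map algebra_simps)
  qed
  ultimately show ?thesis unfolding ptime_branching_def by blast
qed

theorem GapP_schur_coeff_tree:
  assumes "h \<in> GapP"
  shows "\<exists>h' \<in> GapP. \<forall>w \<mu>. h' (encode (w, \<mu>)) =
    leaf_sum (schur_coeff_tree strict \<mu>) (\<lambda>(p, \<alpha>). parity_sign p * h (encode (w, \<alpha>)))"
  using GapP_leaf_sum[OF ptime_schur_branching[of strict] assms]
  by (rule bexI[rotated])
    (auto simp: schur_branching_def encode_def leaf_sum_map case_prod_unfold)

section \<open>Raising operators and the Vandermonde product\<close>

abbreviation lookup where "lookup \<equiv> Poly_Mapping.lookup"
abbreviation single where "single \<equiv> Poly_Mapping.single"

lemma lookup_single_mult: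
  fixes g :: mpoly
  shows "lookup (single t c * g) k = c * (\<Sum>q. lookup g q when k = t + q)"
  unfolding lookup_mult lookup_single by (simp add: when_mult)

lemma lookup_var_mult_add:
  fixes g :: mpoly
  shows "lookup (var a * g) (single a 1 + m) = lookup g m"
  by (simp add: var_def lookup_single_mult)

lemma lookup_var_mult_eq_0:
  fixes g :: mpoly
  assumes "lookup m a = 0"
  shows "lookup (var a * g) m = 0"
proof -
  have "lookup m a \<noteq> lookup (single a 1 + q) a" for q using assms by (simp add: lookup_add)
  then have "m \<noteq> single a 1 + q" for q by metis
  then show ?thesis by (simp add: var_def lookup_single_mult)
qed

lemma lookup_var_diff_mult:
  fixes g :: mpoly
  assumes "a \<noteq> k" "lookup m k = 0"
  shows "lookup ((var a - var k) * g) (m + single a (Suc l) + single k v) =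
    lookup g (m + single a l + single k v) -
      (if v = 0 then 0 else lookup g (m + single a (Suc l) + single k (v - 1)))"
proof -
  have single_Suc: "single i (Suc n) = single i 1 + single i n" for i n :: nat
    by (simp add: single_add[symmetric])
  have "m + single a (Suc l) + single k v = single a 1 + (m + single a l + single k v)"
    unfolding single_Suc[of a] by (simp only: ac_simps)
  then have "lookup (var a * g) (m + single a (Suc l) + single k v) =
      lookup g (m + single a l + single k v)"
    by (simp only: lookup_var_mult_add)
  moreover have "lookup (var k * g) (m + single a (Suc l) + single k v) =
      (if v = 0 then 0 else lookup g (m + single a (Suc l) + single k (v - 1)))"
  proof (cases v)
    case 0
    then show ?thesis using assms by (simp add: lookup_var_mult_eq_0 lookup_add lookup_single)
  next
    case (Suc v')
    then have "m + single a (Suc l) + single k v =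
        single k 1 + (m + single a (Suc l) + single k v')"
      unfolding Suc single_Suc[of k] by (simp only: ac_simps)
    then show ?thesis using Suc by (simp only: lookup_var_mult_add) simp
  qed
  ultimately show ?thesis by (simp add: left_diff_distrib lookup_minus)
qed

fun monom_at :: "nat \<Rightarrow> nat list \<Rightarrow> nat \<Rightarrow>\<^sub>0 nat" where
  "monom_at k [] = 0"
| "monom_at k (v # vs) = single k v + monom_at (Suc k) vs"

lemma lookup_monom_at:
  "lookup (monom_at k vs) i = (if k \<le> i \<and> i < k + length vs then vs ! (i - k) else 0)"
proof (induction vs arbitrary: k)
  case (Cons v vs)
  show ?case
  proof (cases "i = k")
    case True
    then show ?thesis using Cons[of "Suc k"] by (simp add: lookup_add)
  next
    case False
    then have "i - k = Suc (i - Suc k)" if "k \<le> i" using that by simp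
    then show ?thesis using False Cons by (auto simp: lookup_add lookup_single when_def)
  qed
qed simp

lemma leaf_sum_raise_part:
  fixes g :: mpoly
  assumes "\<And>i. k \<le> i \<Longrightarrow> i < k + length vs \<Longrightarrow> lookup e i = 0" "a < k"
  shows "leaf_sum (raise_part l vs p)
      (\<lambda>(l', vs', p'). parity_sign p' * lookup g (e + single a l' + monom_at k vs')) =
    parity_sign p * lookup ((\<Prod>j<length vs. var a - var (k + j)) * g)
      (e + single a (l + length vs) + monom_at k vs)"
  using assms
proof (induction vs arbitrary: l e k p)
  case Nil
  then show ?case by simp
next
  case (Cons v vs)
  define h where "h = (\<Prod>j<length vs. var a - var (Suc k + j)) * g"
  have IH: "leaf_sum (raise_part l vs p)
      (\<lambda>(l', vs', p'). parity_sign p' * lookup g (e + single a l' + monom_at k (u # vs'))) =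
      parity_sign p * lookup h (e + monom_at (Suc k) vs + single a (l + length vs) + single k u)"
    for l u p
    using Cons.IH[of "Suc k" "e + single k u" l p] Cons.prems
    by (simp add: h_def ac_simps lookup_add lookup_single)
  have "(\<Prod>j<length (v # vs). var a - var (k + j)) * g = (var a - var k) * h"
    unfolding h_def length_Cons prod.lessThan_Suc_shift by (simp add: mult.assoc)
  then have "lookup ((\<Prod>j<length (v # vs). var a - var (k + j)) * g)
      (e + single a (l + length (v # vs)) + monom_at k (v # vs)) =
      lookup ((var a - var k) * h)
        ((e + monom_at (Suc k) vs) + single a (Suc (l + length vs)) + single k v)"
    by (simp add: ac_simps)
  also have "\<dots> = lookup h (e + monom_at (Suc k) vs + single a (l + length vs) + single k v) -
      (if v = 0 then 0 else
        lookup h (e + monom_at (Suc k) vs + single a (Suc (l + length vs)) + single k (v - 1)))"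
    by (rule lookup_var_diff_mult) (use Cons.prems in \<open>auto simp: lookup_add lookup_monom_at\<close>)
  finally have product_lookup: "lookup ((\<Prod>j<length (v # vs). var a - var (k + j)) * g)
      (e + single a (l + length (v # vs)) + monom_at k (v # vs)) = \<dots>" .
  show ?case
    unfolding product_lookup using IH[of l p v] IH[of "Suc l" "\<not> p" "v - 1"]
    by (cases p; cases v) (simp_all add: leaf_sum_map case_prod_unfold)
qed

fun add_staircase :: "nat list \<Rightarrow> nat list" where
  "add_staircase [] = []"
| "add_staircase (l # ls) = (l + length ls) # add_staircase ls"

lemma length_add_staircase [simp]: "length (add_staircase \<mu>) = length \<mu>"
  by (induction \<mu>) auto

lemma nth_add_staircase: "i < length \<mu> \<Longrightarrow> add_staircase \<mu> ! i = \<mu> ! i + (length \<mu> - 1 - i)"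
  by (induction \<mu> arbitrary: i) (auto simp: nth_Cons split: nat.splits)

fun vandermonde :: "nat \<Rightarrow> nat \<Rightarrow> mpoly" where
  "vandermonde k 0 = 1"
| "vandermonde k (Suc n) = (\<Prod>j<n. var k - var (Suc k + j)) * vandermonde (Suc k) n"

lemma raise_parts_append:
  "raise_parts (ls @ ms) vs p = raise_parts ls vs p \<bind> (\<lambda>(vs', p'). raise_parts ms vs' p')"
  by (induction ls arbitrary: vs p) (simp_all add: bind_tree_assoc case_prod_unfold)

theorem leaf_sum_raise_parts:
  fixes g :: mpoly
  assumes "\<And>i. k \<le> i \<Longrightarrow> lookup e i = 0"
  shows "leaf_sum (raise_parts (rev \<mu>) [] p)
      (\<lambda>(v, p'). parity_sign p' * lookup g (e + monom_at k v)) =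
    parity_sign p * lookup (vandermonde k (length \<mu>) * g) (e + monom_at k (add_staircase \<mu>))"
  using assms
proof (induction \<mu> arbitrary: e k g)
  case (Cons l \<mu>)
  let ?h = "(\<Prod>j<length \<mu>. var k - var (Suc k + j)) * g"
  have "leaf_sum (raise_parts (rev (l # \<mu>)) [] p)
      (\<lambda>(v, p'). parity_sign p' * lookup g (e + monom_at k v)) =
      leaf_sum (raise_parts (rev \<mu>) [] p) (\<lambda>(vs, p'). leaf_sum (raise_part l vs p')
        (\<lambda>(l', vs', p''). parity_sign p'' * lookup g (e + single k l' + monom_at (Suc k) vs')))"
    by (simp add: raise_parts_append leaf_sum_bind case_prod_unfold add.assoc)
  also have "\<dots> = leaf_sum (raise_parts (rev \<mu>) [] p)
      (\<lambda>(vs, p'). parity_sign p' * lookup ?h ((e + single k (l + length \<mu>)) + monom_at (Suc k) vs))"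
  proof (rule leaf_sum_cong, clarify)
    fix vs p' assume "(vs, p') \<in> set_choice_tree (raise_parts (rev \<mu>) [] p)"
    then have "length vs = length \<mu>" by (auto dest: raise_parts_sizes)
    then show "leaf_sum (raise_part l vs p')
        (\<lambda>(l', vs', p''). parity_sign p'' * lookup g (e + single k l' + monom_at (Suc k) vs')) =
        parity_sign p' * lookup ?h ((e + single k (l + length \<mu>)) + monom_at (Suc k) vs)"
      using leaf_sum_raise_part[of "Suc k" vs e k l p' g] Cons.prems by simp
  qed
  also have "\<dots> = parity_sign p * lookup (vandermonde (Suc k) (length \<mu>) * ?h)
      ((e + single k (l + length \<mu>)) + monom_at (Suc k) (add_staircase \<mu>))"
    by (rule Cons.IH) (use Cons.prems in \<open>auto simp: lookup_add lookup_single\<close>)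
  finally show ?case by (simp add: ac_simps)
qed simp

lemma vandermonde_Suc_right:
  "vandermonde k (Suc n) = vandermonde k n * (\<Prod>i<n. var (k + i) - var (k + n))"
proof (induction n arbitrary: k)
  case (Suc n)
  have "vandermonde k (Suc (Suc n)) = (\<Prod>j<Suc n. var k - var (Suc k + j)) *
      (vandermonde (Suc k) n * (\<Prod>i<n. var (Suc k + i) - var (Suc k + n)))"
    by (subst vandermonde.simps(2)) (simp only: Suc.IH)
  also have "\<dots> = (\<Prod>j<n. var k - var (Suc k + j)) * vandermonde (Suc k) n *
      ((var k - var (Suc k + n)) * (\<Prod>i<n. var (Suc k + i) - var (Suc k + n)))"
    by (simp add: ac_simps)
  also have "(var k - var (Suc k + n)) * (\<Prod>i<n. var (Suc k + i) - var (Suc k + n)) =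
      (\<Prod>i<Suc n. var (k + i) - var (k + Suc n))"
    unfolding prod.lessThan_Suc_shift by simp
  also have "(\<Prod>j<n. var k - var (Suc k + j)) * vandermonde (Suc k) n = vandermonde k (Suc n)"
    by simp
  finally show ?case .
qed simp


section \<open>Alternants\<close>

lemma prod_permutes_lessThan: "p permutes {0..<n} \<Longrightarrow> (\<Prod>j<n. f (p j)) = (\<Prod>i<(n :: nat). f i)"
  using permutes_imp_bij[of p "{0..<n}"]
  by (intro prod.reindex_bij_betw) (simp add: lessThan_atLeast0)

lemma det_mat_Leibniz:
  "det (mat n n (\<lambda>(i, j). f i j)) = (\<Sum>p | p permutes {0..<n}. signof p * (\<Prod>j<n. f (p j) j))"
  by (subst det_col[of _ n]) (auto intro!: sum.cong prod.cong)

lemma det_mat_scale: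
  fixes f :: "nat \<Rightarrow> nat \<Rightarrow> 'a :: comm_ring_1"
  shows "det (mat n n (\<lambda>(i, j). r i * f i j * c j)) =
    (\<Prod>i<n. r i) * (\<Prod>j<n. c j) * det (mat n n (\<lambda>(i, j). f i j))"
  unfolding det_mat_Leibniz sum_distrib_left
  by (rule sum.cong) (simp_all add: prod.distrib prod_permutes_lessThan[of _ n r] ac_simps)

lemma det_mat_sum:
  fixes f :: "nat \<Rightarrow> nat \<Rightarrow> 'b \<Rightarrow> 'a :: comm_ring_1"
  assumes "\<And>j. j < n \<Longrightarrow> finite (I j)"
  shows "det (mat n n (\<lambda>(i, j). \<Sum>k \<in> I j. f i j k)) =
    (\<Sum>\<nu> \<in> PiE {..<n} I. det (mat n n (\<lambda>(i, j). f i j (\<nu> j))))"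
proof -
  have "det (mat n n (\<lambda>(i, j). \<Sum>k \<in> I j. f i j k)) =
      (\<Sum>p | p permutes {0..<n}. \<Sum>\<nu> \<in> PiE {..<n} I. signof p * (\<Prod>j<n. f (p j) j (\<nu> j)))"
    unfolding det_mat_Leibniz sum_distrib_left[symmetric]
    using assms by (intro sum.cong refl arg_cong2[of _ _ _ _ "(*)"] prod_sum_PiE) auto
  then show ?thesis unfolding det_mat_Leibniz by (subst sum.swap) simp
qed

lemma det_mat_clear_last_row:
  fixes f :: "nat \<Rightarrow> nat \<Rightarrow> 'a :: comm_ring_1"
  assumes last: "\<And>j. j < n \<Longrightarrow> f n j = f n (Suc j) * c j"
  shows "det (mat (Suc n) (Suc n) (\<lambda>(i, j). f i j)) =
    f n n * det (mat n n (\<lambda>(i, j). f i j - f i (Suc j) * c j))"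
proof -
  define A where "A = mat (Suc n) (Suc n) (\<lambda>(i, j). f i j)"
  \<comment> \<open>Multiplication by \<open>U\<close> subtracts from each column a multiple of the next.\<close>
  define U where
    "U = mat (Suc n) (Suc n) (\<lambda>(i, j). if i = j then 1 else if i = Suc j then - c j else 0)"
  have carrier_A: "A \<in> carrier_mat (Suc n) (Suc n)" and carrier_U: "U \<in> carrier_mat (Suc n) (Suc n)"
    by (auto simp: A_def U_def)
  have "det U = prod_list (diag_mat U)"
    by (rule det_lower_triangular[OF _ carrier_U]) (auto simp: U_def)
  also have "\<dots> = 1"
    using carrier_U by (auto simp: prod_list_diag_prod U_def intro!: prod.neutral)
  finally have det_U: "det U = 1" .
  have entries: "(A * U) $$ (i, j) = f i j - (if j < n then f i (Suc j) * c j else 0)"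
    if "i < Suc n" "j < Suc n" for i j
  proof -
    have "(A * U) $$ (i, j) = (\<Sum>k = 0..<Suc n. A $$ (i, k) * U $$ (k, j))"
      using that carrier_A carrier_U by (simp add: scalar_prod_def)
    also have "\<dots> = (\<Sum>k = 0..<Suc n.
        (if k = j then f i j else 0) - (if k = Suc j then f i (Suc j) * c j else 0))"
      using that by (intro sum.cong) (auto simp: A_def U_def)
    also have "\<dots> = (\<Sum>k = 0..<Suc n. if k = j then f i j else 0) -
        (\<Sum>k = 0..<Suc n. if k = Suc j then f i (Suc j) * c j else 0)"
      by (rule sum_subtractf)
    also have "\<dots> = f i j - (if j < n then f i (Suc j) * c j else 0)"
      using that by (simp only: sum.delta finite_atLeastLessThan) simp
    finally show ?thesis .
  qed
  have "det A = det (A * U)" using det_mult[OF carrier_A carrier_U] det_U by simp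
  also have "\<dots> = (\<Sum>j<Suc n. (A * U) $$ (n, j) * cofactor (A * U) n j)"
    by (rule laplace_expansion_row) (use carrier_A carrier_U in auto)
  also have "\<dots> = f n n * cofactor (A * U) n n"
    using entries[of n] last by simp
  also have "cofactor (A * U) n n = det (mat_delete (A * U) n n)"
    by (simp add: cofactor_def)
  also have "mat_delete (A * U) n n = mat n n (\<lambda>(i, j). f i j - f i (Suc j) * c j)"
    using carrier_A carrier_U entries
    by (intro eq_matI) (auto simp: mat_delete_def simp del: index_mult_mat(1))
  finally show ?thesis unfolding A_def .
qed

definition alternant :: "(nat \<Rightarrow> 'a) \<Rightarrow> nat \<Rightarrow> (nat \<Rightarrow> nat) \<Rightarrow> 'a :: comm_ring_1" where
  "alternant y n e = det (mat n n (\<lambda>(i, j). y i ^ e j))"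

lemma alternant_cong: "(\<And>j. j < n \<Longrightarrow> e j = e' j) \<Longrightarrow> alternant y n e = alternant y n e'"
  unfolding alternant_def by (rule arg_cong[of _ _ det]) (auto intro!: eq_matI)

lemma telescoping_power_sum:
  fixes a b :: "'a :: comm_ring_1"
  assumes "l \<le> u"
  shows "(a - b) * (\<Sum>k = l..u. a ^ (k + m) * b ^ (u - k)) =
      a ^ (u + m + 1) - a ^ (l + m) * b ^ (u - l + 1)"
  using assms
proof (induction u rule: dec_induct)
  case base
  then show ?case by (simp add: algebra_simps)
next
  case (step u)
  have "(\<Sum>k = l..u. a ^ (k + m) * b ^ (Suc u - k)) = b * (\<Sum>k = l..u. a ^ (k + m) * b ^ (u - k))"
    unfolding sum_distrib_left by (rule sum.cong) (auto simp: Suc_diff_le)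
  then have "(a - b) * (\<Sum>k = l..Suc u. a ^ (k + m) * b ^ (Suc u - k)) =
      b * ((a - b) * (\<Sum>k = l..u. a ^ (k + m) * b ^ (u - k))) + (a - b) * a ^ (Suc u + m)"
    using step(1) by (simp add: algebra_simps)
  also have "\<dots> = a ^ (Suc u + m + 1) - a ^ (l + m) * b ^ (Suc u - l + 1)"
    unfolding step.IH using step(1) by (simp add: algebra_simps Suc_diff_le)
  finally show ?case .
qed

theorem alternant_branching:
  fixes y :: "nat \<Rightarrow> 'a :: comm_ring_1" and f :: "nat \<Rightarrow> nat"
  assumes dec: "\<And>j. j < n \<Longrightarrow> f (Suc j) \<le> f j"
  shows "alternant y (Suc n) (\<lambda>j. f j + (n - j)) = y n ^ f n * ((\<Prod>i<n. y i - y n) *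
    (\<Sum>\<nu> \<in> PiE {..<n} (\<lambda>j. {f (Suc j)..f j}). (\<Prod>j<n. y n ^ (f j - \<nu> j)) *
      alternant y n (\<lambda>j. \<nu> j + (n - 1 - j))))"
proof -
  let ?c = "\<lambda>j. y n ^ (f j - f (Suc j) + 1)" and ?I = "\<lambda>j. {f (Suc j)..f j}"
  have last: "y n ^ (f j + (n - j)) = y n ^ (f (Suc j) + (n - Suc j)) * ?c j" if "j < n" for j
  proof -
    have "f j + (n - j) = f (Suc j) + (n - Suc j) + (f j - f (Suc j) + 1)"
      using dec[OF that] that by simp
    then show ?thesis by (simp only: power_add)
  qed
  have entry: "y i ^ (f j + (n - j)) - y i ^ (f (Suc j) + (n - Suc j)) * ?c j =
      (y i - y n) * (\<Sum>k \<in> ?I j. y i ^ (k + (n - 1 - j)) * y n ^ (f j - k)) * 1" if "j < n" for i j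
  proof -
    have "f j + (n - j) = f j + (n - 1 - j) + 1" "n - Suc j = n - 1 - j" using that by auto
    then show ?thesis by (simp only: telescoping_power_sum[OF dec[OF that]] mult_1_right)
  qed
  have "alternant y (Suc n) (\<lambda>j. f j + (n - j)) =
      y n ^ f n * det (mat n n (\<lambda>(i, j).
        y i ^ (f j + (n - j)) - y i ^ (f (Suc j) + (n - Suc j)) * ?c j))"
    unfolding alternant_def
    using det_mat_clear_last_row[of n "\<lambda>i j. y i ^ (f j + (n - j))" ?c, OF last] by simp
  also have "mat n n (\<lambda>(i, j). y i ^ (f j + (n - j)) - y i ^ (f (Suc j) + (n - Suc j)) * ?c j) =
      mat n n (\<lambda>(i, j). (y i - y n) * (\<Sum>k \<in> ?I j. y i ^ (k + (n - 1 - j)) * y n ^ (f j - k)) * 1)"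
    by (intro eq_matI) (simp_all only: dim_row_mat dim_col_mat index_mat prod.case entry)
  also have "det \<dots> = (\<Prod>i<n. y i - y n) *
      (\<Sum>\<nu> \<in> PiE {..<n} ?I. det (mat n n (\<lambda>(i, j). y i ^ (\<nu> j + (n - 1 - j)) * y n ^ (f j - \<nu> j))))"
    unfolding det_mat_scale by (subst det_mat_sum) simp_all
  also have "(\<Sum>\<nu> \<in> PiE {..<n} ?I.
      det (mat n n (\<lambda>(i, j). y i ^ (\<nu> j + (n - 1 - j)) * y n ^ (f j - \<nu> j)))) =
      (\<Sum>\<nu> \<in> PiE {..<n} ?I. (\<Prod>j<n. y n ^ (f j - \<nu> j)) * alternant y n (\<lambda>j. \<nu> j + (n - 1 - j)))"
  proof (rule sum.cong[OF refl])
    fix \<nu>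
    show "det (mat n n (\<lambda>(i, j). y i ^ (\<nu> j + (n - 1 - j)) * y n ^ (f j - \<nu> j))) =
        (\<Prod>j<n. y n ^ (f j - \<nu> j)) * alternant y n (\<lambda>j. \<nu> j + (n - 1 - j))"
      using det_mat_scale[of n "\<lambda>_. 1" "\<lambda>i j. y i ^ (\<nu> j + (n - 1 - j))" "\<lambda>j. y n ^ (f j - \<nu> j)"]
      by (simp add: alternant_def)
  qed
  finally show ?thesis .
qed

section \<open>Branching of Schur polynomials\<close>

lemma SSYT_iff_nth:
  "T \<in> SSYT n \<mu> \<longleftrightarrow> length T = length \<mu> \<and>
     (\<forall>i < length \<mu>. length (T ! i) = \<mu> ! i \<and> sorted (T ! i) \<and> set (T ! i) \<subseteq> {1..n}) \<and>
     (\<forall>i j. Suc i < length \<mu> \<longrightarrow> j < \<mu> ! Suc i \<longrightarrow> T ! i ! j < T ! Suc i ! j)"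
proof (cases "map length T = \<mu>")
  case True
  have "set (concat T) \<subseteq> {1..n} \<longleftrightarrow> (\<forall>i < length T. set (T ! i) \<subseteq> {1..n})"
    by (simp add: UN_subset_iff all_set_conv_all_nth)
  moreover have "(\<forall>r \<in> set T. sorted r) \<longleftrightarrow> (\<forall>i < length T. sorted (T ! i))"
    by (simp add: all_set_conv_all_nth)
  ultimately show ?thesis
    unfolding SSYT_def mem_Collect_eq
    by (simp add: True[symmetric] imp_conjL imp_conjR all_conj_distrib conj_ac)
next
  case False
  then have "\<not> (length T = length \<mu> \<and> (\<forall>i < length \<mu>. length (T ! i) = \<mu> ! i))"
    by (simp add: list_eq_iff_nth_eq)
  with False show ?thesis unfolding SSYT_def by blast
qed

lemma SSYT_length: "T \<in> SSYT n \<mu> \<Longrightarrow> length T = length \<mu>"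
  and SSYT_row: "T \<in> SSYT n \<mu> \<Longrightarrow> i < length \<mu> \<Longrightarrow>
    length (T ! i) = \<mu> ! i \<and> sorted (T ! i) \<and> set (T ! i) \<subseteq> {1..n}"
  and SSYT_column: "T \<in> SSYT n \<mu> \<Longrightarrow> Suc i < length \<mu> \<Longrightarrow> j < \<mu> ! Suc i \<Longrightarrow> T ! i ! j < T ! Suc i ! j"
  by (simp_all add: SSYT_iff_nth)

lemma finite_SSYT: "finite (SSYT n \<mu>)"
proof (rule finite_subset)
  let ?R = "{r. set r \<subseteq> {1..n} \<and> length r \<le> sum_list \<mu>}"
  show "SSYT n \<mu> \<subseteq> {T. set T \<subseteq> ?R \<and> length T = length \<mu>}"
  proof
    fix T assume T: "T \<in> SSYT n \<mu>"
    then have \<mu>: "\<mu> = map length T" by (auto simp: SSYT_def)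
    have "length r \<le> sum_list \<mu>" if "r \<in> set T" for r
      unfolding \<mu> using that by (intro member_le_sum_list) auto
    then show "T \<in> {T. set T \<subseteq> ?R \<and> length T = length \<mu>}"
      using T \<mu> by (auto simp: SSYT_def)
  qed
  show "finite {T. set T \<subseteq> ?R \<and> length T = length \<mu>}"
    by (intro finite_lists_length_eq finite_lists_length_le) simp
qed

lemma sorted_wrt_ge_nth_mono:
  "sorted_wrt (\<ge>) \<mu> \<Longrightarrow> i \<le> j \<Longrightarrow> j < length \<mu> \<Longrightarrow> \<mu> ! j \<le> (\<mu> ! i :: 'a :: preorder)"
  by (cases "i = j") (auto simp: sorted_wrt_iff_nth_less)

lemma SSYT_entry_gt_row_index:
  assumes T: "T \<in> SSYT n \<mu>" and \<mu>: "sorted_wrt (\<ge>) \<mu>" and "i < length \<mu>" "c < \<mu> ! i"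
  shows "i < T ! i ! c"
  using assms(3,4)
proof (induction i)
  case 0
  then have row: "length (T ! 0) = \<mu> ! 0" "set (T ! 0) \<subseteq> {1..n}" using SSYT_row[OF T, of 0] by auto
  then have "T ! 0 ! c \<in> set (T ! 0)" using 0 by simp
  then show ?case using row(2) by auto
next
  case (Suc i)
  have "c < \<mu> ! i" using Suc.prems sorted_wrt_ge_nth_mono[OF \<mu>, of i "Suc i"] by simp
  then have "i < T ! i ! c" using Suc by simp
  moreover have "T ! i ! c < T ! Suc i ! c" by (rule SSYT_column[OF T]) (use Suc.prems in auto)
  ultimately show ?case by simp
qed

lemma less_length_takeWhile_le_iff:
  fixes r :: "'a :: linorder list"
  assumes "sorted r" "c < length r"
  shows "c < length (takeWhile (\<lambda>x. x \<le> n) r) \<longleftrightarrow> r ! c \<le> n"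
proof
  let ?t = "takeWhile (\<lambda>x. x \<le> n) r"
  assume "c < length ?t"
  then have "r ! c \<in> set ?t" using nth_mem[of c ?t] by (simp add: takeWhile_nth)
  then show "r ! c \<le> n" by (auto dest: set_takeWhileD)
next
  let ?t = "takeWhile (\<lambda>x. x \<le> n) r"
  assume "r ! c \<le> n"
  show "c < length ?t"
  proof (rule ccontr)
    assume "\<not> c < length ?t"
    then have "length ?t < length r" "r ! length ?t \<le> r ! c"
      using assms by (auto intro: sorted_nth_mono)
    then show False using nth_length_takeWhile[of "\<lambda>x. x \<le> n" r] \<open>r ! c \<le> n\<close> by auto
  qed
qed

lemma sorted_eq_takeWhile_append_replicate:
  assumes "sorted r" "\<And>x. x \<in> set r \<Longrightarrow> x \<le> Suc n"
  shows "takeWhile (\<lambda>x. x \<le> n) r @ replicate (length r - length (takeWhile (\<lambda>x. x \<le> n) r)) (Suc n) =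
      r"
proof (rule nth_equalityI)
  let ?t = "takeWhile (\<lambda>x. x \<le> n) r"
  show len: "length (?t @ replicate (length r - length ?t) (Suc n)) = length r"
    by (simp add: length_takeWhile_le)
  fix c assume "c < length (?t @ replicate (length r - length ?t) (Suc n))"
  then have c: "c < length r" unfolding len .
  then have "r ! c \<le> Suc n" using assms(2) by simp
  then show "(?t @ replicate (length r - length ?t) (Suc n)) ! c = r ! c"
    using less_length_takeWhile_le_iff[OF assms(1) c, of n] c
    by (auto simp: nth_append takeWhile_nth)
qed

locale branching_shape =
  fixes n :: nat and \<mu> :: "nat list"
  assumes len: "length \<mu> = Suc n" and dec: "sorted_wrt (\<ge>) \<mu>"
begin

lemma dec_Suc: "j < n \<Longrightarrow> \<mu> ! Suc j \<le> \<mu> ! j"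
  using sorted_wrt_ge_nth_mono[OF dec, of j "Suc j"] len by simp

abbreviation small :: "nat list \<Rightarrow> nat list" where
  "small \<equiv> takeWhile (\<lambda>x. x \<le> n)"

definition restrict_tab :: "nat list list \<Rightarrow> (nat \<Rightarrow> nat) \<times> nat list list" where
  "restrict_tab T = (restrict (\<lambda>j. length (small (T ! j))) {..<n}, map (\<lambda>j. small (T ! j)) [0..<n])"

definition extend_tab :: "(nat \<Rightarrow> nat) \<times> nat list list \<Rightarrow> nat list list" where
  "extend_tab p = map (\<lambda>j. snd p ! j @ replicate (\<mu> ! j - fst p j) (Suc n)) [0..<n] @
     [replicate (\<mu> ! n) (Suc n)]"

abbreviation shapes :: "(nat \<Rightarrow> nat) set" where
  "shapes \<equiv> PiE {..<n} (\<lambda>j. {\<mu> ! Suc j..\<mu> ! j})"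

abbreviation pairs :: "((nat \<Rightarrow> nat) \<times> nat list list) set" where
  "pairs \<equiv> (SIGMA \<nu> : shapes. SSYT n (map \<nu> [0..<n]))"

lemma length_small:
  assumes T: "T \<in> SSYT (Suc n) \<mu>" and j: "j < n"
  shows "length (small (T ! j)) \<in> {\<mu> ! Suc j..\<mu> ! j}"
proof -
  have row: "length (T ! i) = \<mu> ! i" "sorted (T ! i)" "set (T ! i) \<subseteq> {1..Suc n}" if "i \<le> n" for i
    using SSYT_row[OF T] that len by auto
  have "c < length (small (T ! j))" if c: "c < \<mu> ! Suc j" for c
  proof -
    have "T ! j ! c < T ! Suc j ! c" by (rule SSYT_column[OF T]) (use c j len in auto)
    moreover have "T ! Suc j ! c \<in> set (T ! Suc j)" using c j row(1)[of "Suc j"] by simp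
    then have "T ! Suc j ! c \<le> Suc n" using row(3)[of "Suc j"] j by auto
    ultimately have "T ! j ! c \<le> n" by simp
    then show ?thesis
      using c j dec_Suc row(1,2)[of j]
      by (simp add: less_length_takeWhile_le_iff order_less_le_trans)
  qed
  then have "\<mu> ! Suc j \<le> length (small (T ! j))" by (meson not_le_imp_less order_less_irrefl)
  then show ?thesis using length_takeWhile_le[of _ "T ! j"] row(1)[of j] j by simp
qed

lemma restrict_in_pairs:
  assumes T: "T \<in> SSYT (Suc n) \<mu>"
  shows "restrict_tab T \<in> pairs"
proof -
  let ?T = "map (\<lambda>j. small (T ! j)) [0..<n]" and ?\<nu> = "restrict (\<lambda>j. length (small (T ! j))) {..<n}"
  have "set (small (T ! i)) \<subseteq> {1..n}" if "i < n" for i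
    using SSYT_row[OF T, of i] that len by (fastforce dest: set_takeWhileD)
  moreover have "sorted (small (T ! i))" if "i < n" for i
    using SSYT_row[OF T, of i] that len by (auto intro: sorted_takeWhile)
  moreover have "small (T ! i) ! j < small (T ! Suc i) ! j"
    if i: "Suc i < n" and j: "j < length (small (T ! Suc i))" for i j
  proof -
    have "j < \<mu> ! Suc i" using j length_small[OF T i] by simp
    then have "j < length (small (T ! i))" using length_small[OF T, of i] i by simp
    moreover have "T ! i ! j < T ! Suc i ! j"
      using SSYT_column[OF T] i \<open>j < \<mu> ! Suc i\<close> len by simp
    ultimately show ?thesis using j by (simp add: takeWhile_nth)
  qed
  ultimately have "?T \<in> SSYT n (map ?\<nu> [0..<n])" by (simp add: SSYT_iff_nth)
  moreover have "?\<nu> \<in> shapes" using length_small[OF T] by auto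
  ultimately show ?thesis by (simp add: restrict_tab_def)
qed

lemma nth_extend_tab:
  "i < Suc n \<Longrightarrow> extend_tab (\<nu>, T) ! i =
    (if i < n then T ! i @ replicate (\<mu> ! i - \<nu> i) (Suc n) else replicate (\<mu> ! n) (Suc n))"
  by (auto simp: extend_tab_def nth_append less_Suc_eq)

lemma length_extend_tab [simp]: "length (extend_tab p) = Suc n"
  by (simp add: extend_tab_def)

lemma extend_restrict:
  assumes T: "T \<in> SSYT (Suc n) \<mu>"
  shows "extend_tab (restrict_tab T) = T"
proof (rule nth_equalityI)
  show "length (extend_tab (restrict_tab T)) = length T"
    using SSYT_length[OF T] len by simp
  fix i assume "i < length (extend_tab (restrict_tab T))"
  then have i: "i < Suc n" by simp
  have row: "length (T ! i) = \<mu> ! i" "sorted (T ! i)" "set (T ! i) \<subseteq> {1..Suc n}"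
    using SSYT_row[OF T, of i] i len by auto
  then have "x \<le> Suc n" if "x \<in> set (T ! i)" for x using that by auto
  from sorted_eq_takeWhile_append_replicate[OF row(2) this]
  have row_eq: "small (T ! i) @ replicate (\<mu> ! i - length (small (T ! i))) (Suc n) = T ! i"
    by (simp add: row(1))
  show "extend_tab (restrict_tab T) ! i = T ! i"
  proof (cases "i < n")
    case True
    then show ?thesis using row_eq by (simp add: restrict_tab_def nth_extend_tab)
  next
    case False
    then have n: "i = n" using i by simp
    have "small (T ! n) = []"
    proof (cases "T ! n")
      case (Cons x r)
      then have "n < x"
        using SSYT_entry_gt_row_index[OF T dec, of n 0] row(1) len n by (cases "\<mu> ! n") auto
      then show ?thesis using Cons by simp
    qed simp
    then show ?thesis using row_eq n by (simp add: restrict_tab_def nth_extend_tab)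
  qed
qed

lemma extend_in_SSYT:
  assumes \<nu>: "\<nu> \<in> shapes" and T: "T \<in> SSYT n (map \<nu> [0..<n])"
  shows "extend_tab (\<nu>, T) \<in> SSYT (Suc n) \<mu>"
proof -
  have nu: "\<mu> ! Suc j \<le> \<nu> j" "\<nu> j \<le> \<mu> ! j" if "j < n" for j
    using \<nu> that by (auto simp: PiE_iff)
  have row: "length (T ! j) = \<nu> j" "sorted (T ! j)" "set (T ! j) \<subseteq> {1..n}" if "j < n" for j
    using SSYT_row[OF T, of j] that by auto
  have "length (extend_tab (\<nu>, T) ! i) = \<mu> ! i" "set (extend_tab (\<nu>, T) ! i) \<subseteq> {1..Suc n}"
    if "i < Suc n" for i
    using that nu(2)[of i] row(1,3)[of i] by (cases "i = n"; auto simp: nth_extend_tab)+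
  moreover have "sorted (extend_tab (\<nu>, T) ! i)" if "i < Suc n" for i
  proof (cases "i < n")
    case True
    have "\<forall>x \<in> set (T ! i). x \<le> Suc n" using row(3)[OF True] by auto
    then show ?thesis using that True row(2) by (simp add: nth_extend_tab sorted_append)
  qed (simp add: nth_extend_tab that)
  moreover have "extend_tab (\<nu>, T) ! i ! j < extend_tab (\<nu>, T) ! Suc i ! j"
    if i: "i < n" and j: "j < \<mu> ! Suc i" for i j
  proof -
    have j_row: "j < length (T ! i)" using j nu(1)[OF i] row(1)[OF i] by simp
    then have upper: "extend_tab (\<nu>, T) ! i ! j = T ! i ! j"
      using i by (simp add: nth_extend_tab nth_append)
    have le: "T ! i ! j \<le> n" using nth_mem[OF j_row] row(3)[OF i] by auto
    show ?thesis
    proof (cases "Suc i < n \<and> j < \<nu> (Suc i)")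
      case True
      then have "T ! i ! j < T ! Suc i ! j" using SSYT_column[OF T, of i j] by simp
      then show ?thesis using True upper row(1)[of "Suc i"] by (simp add: nth_extend_tab nth_append)
    next
      case False
      then have "extend_tab (\<nu>, T) ! Suc i ! j = Suc n"
        using i j row(1)[of "Suc i"] nu(2)[of "Suc i"]
        by (cases "Suc i = n") (auto simp: nth_extend_tab nth_append)
      then show ?thesis using upper le by simp
    qed
  qed
  ultimately show ?thesis by (simp add: SSYT_iff_nth len)
qed

lemma restrict_extend:
  assumes \<nu>: "\<nu> \<in> shapes" and T: "T \<in> SSYT n (map \<nu> [0..<n])"
  shows "restrict_tab (extend_tab (\<nu>, T)) = (\<nu>, T)"
proof -
  have small: "small (extend_tab (\<nu>, T) ! j) = T ! j" if "j < n" for j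
  proof -
    have "takeWhile (\<lambda>x. x \<le> n) (T ! j @ replicate (\<mu> ! j - \<nu> j) (Suc n)) = T ! j"
      using SSYT_row[OF T, of j] that by (subst takeWhile_append2) auto
    then show ?thesis using that by (simp add: nth_extend_tab)
  qed
  have "map (\<lambda>j. small (extend_tab (\<nu>, T) ! j)) [0..<n] = T"
    using SSYT_length[OF T] small by (simp add: list_eq_iff_nth_eq)
  moreover have "restrict (\<lambda>j. length (small (extend_tab (\<nu>, T) ! j))) {..<n} = \<nu>"
    using small SSYT_row[OF T] \<nu> by (auto simp: fun_eq_iff PiE_iff extensional_def)
  ultimately show ?thesis by (simp add: restrict_tab_def)
qed

lemma weight_extend:
  assumes T: "T \<in> SSYT n (map \<nu> [0..<n])"
  shows "prod_list (map var (concat (extend_tab (\<nu>, T)))) = prod_list (map var (concat T)) *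
    ((\<Prod>j<n. var (Suc n) ^ (\<mu> ! j - \<nu> j)) * var (Suc n) ^ (\<mu> ! n))"
proof -
  have weight_concat:
    "prod_list (map var (concat T)) = (\<Prod>j<length T. prod_list (map var (T ! j)))" for T
  proof -
    have "prod_list (map var (concat T)) = prod_list (map (\<lambda>r. prod_list (map var r)) T)"
      by (induction T) auto
    then show ?thesis by (simp add: prod.list_conv_set_nth atLeast0LessThan)
  qed
  have lenT: "length T = n" using SSYT_length[OF T] by simp
  have "prod_list (map var (concat (extend_tab (\<nu>, T)))) =
      (\<Prod>j<n. prod_list (map var (T ! j)) * var (Suc n) ^ (\<mu> ! j - \<nu> j)) * var (Suc n) ^ (\<mu> ! n)"
    unfolding weight_concat by (simp add: nth_extend_tab prod_list_replicate)
  also have "\<dots> = prod_list (map var (concat T)) *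
    ((\<Prod>j<n. var (Suc n) ^ (\<mu> ! j - \<nu> j)) * var (Suc n) ^ (\<mu> ! n))"
    unfolding weight_concat lenT by (simp add: prod.distrib mult.assoc)
  finally show ?thesis .
qed

theorem schur_branching:
  "schur (Suc n) \<mu> = (\<Sum>\<nu> \<in> shapes. schur n (map \<nu> [0..<n]) *
    ((\<Prod>j<n. var (Suc n) ^ (\<mu> ! j - \<nu> j)) * var (Suc n) ^ (\<mu> ! n)))"
proof -
  let ?weight = "\<lambda>(\<nu>, T). prod_list (map var (concat T)) *
    ((\<Prod>j<n. var (Suc n) ^ (\<mu> ! j - \<nu> j)) * var (Suc n) ^ (\<mu> ! n))"
  have "schur (Suc n) \<mu> = sum ?weight pairs"
    unfolding schur_def
  proof (rule sum.reindex_bij_witness[where i = extend_tab and j = restrict_tab])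
    fix T assume T: "T \<in> SSYT (Suc n) \<mu>"
    show "extend_tab (restrict_tab T) = T" "restrict_tab T \<in> pairs"
      using T by (rule extend_restrict restrict_in_pairs)+
    moreover obtain \<nu> T' where "restrict_tab T = (\<nu>, T')" by (cases "restrict_tab T")
    ultimately show "?weight (restrict_tab T) = prod_list (map var (concat T))"
      using weight_extend[of T' \<nu>] by simp
  next
    fix p assume "p \<in> pairs"
    then obtain \<nu> T where "p = (\<nu>, T)" "\<nu> \<in> shapes" "T \<in> SSYT n (map \<nu> [0..<n])" by blast
    then show "restrict_tab (extend_tab p) = p" "extend_tab p \<in> SSYT (Suc n) \<mu>"
      using restrict_extend extend_in_SSYT by simp_all
  qed
  also have "\<dots> = (\<Sum>\<nu> \<in> shapes. \<Sum>T \<in> SSYT n (map \<nu> [0..<n]). ?weight (\<nu>, T))"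
    by (subst sum.Sigma) (auto simp: finite_SSYT intro!: finite_PiE)
  finally show ?thesis by (simp add: schur_def sum_distrib_right)
qed

end

theorem vandermonde_mult_schur:
  assumes "sorted_wrt (\<ge>) \<mu>"
  shows "vandermonde 1 (length \<mu>) * schur (length \<mu>) \<mu> =
    alternant (\<lambda>i. var (Suc i)) (length \<mu>) ((!) (add_staircase \<mu>))"
  using assms
proof (induction "length \<mu>" arbitrary: \<mu>)
  case 0
  moreover have "SSYT 0 [] = {[]}" by (auto simp: SSYT_def)
  ultimately show ?case by (simp add: schur_def alternant_def)
next
  case (Suc n)
  interpret branching_shape n \<mu> using Suc.hyps(2) Suc.prems by unfold_locales auto
  let ?x = "var (Suc n)" and ?y = "\<lambda>i. var (Suc i)"
  let ?D = "\<Prod>i<n. ?y i - ?x" and ?alt = "\<lambda>\<nu>. alternant ?y n (\<lambda>j. \<nu> j + (n - 1 - j))"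
  have IH: "vandermonde 1 n * schur n (map \<nu> [0..<n]) = ?alt \<nu>" if "\<nu> \<in> shapes" for \<nu>
  proof -
    have "\<nu> j \<le> \<nu> i" if "i < j" "j < n" for i j
    proof -
      have "\<nu> j \<le> \<mu> ! j" using \<open>\<nu> \<in> shapes\<close> that by (auto simp: PiE_iff)
      also have "\<dots> \<le> \<mu> ! Suc i" using that len by (intro sorted_wrt_ge_nth_mono[OF dec]) auto
      also have "\<dots> \<le> \<nu> i" using \<open>\<nu> \<in> shapes\<close> that by (auto simp: PiE_iff)
      finally show ?thesis .
    qed
    then have "sorted_wrt (\<ge>) (map \<nu> [0..<n])" by (simp add: sorted_wrt_iff_nth_less)
    moreover have "alternant ?y n ((!) (add_staircase (map \<nu> [0..<n]))) = ?alt \<nu>"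
      by (rule alternant_cong) (simp add: nth_add_staircase)
    ultimately show ?thesis using Suc.hyps(1)[of "map \<nu> [0..<n]"] by simp
  qed
  have "vandermonde 1 (Suc n) * schur (Suc n) \<mu> = ?D * (\<Sum>\<nu> \<in> shapes.
      (vandermonde 1 n * schur n (map \<nu> [0..<n])) * ((\<Prod>j<n. ?x ^ (\<mu> ! j - \<nu> j)) * ?x ^ (\<mu> ! n)))"
    unfolding vandermonde_Suc_right schur_branching sum_distrib_left
    by (rule sum.cong[OF refl]) (simp add: ac_simps)
  also have "\<dots> = ?D * (\<Sum>\<nu> \<in> shapes. ?alt \<nu> * ((\<Prod>j<n. ?x ^ (\<mu> ! j - \<nu> j)) * ?x ^ (\<mu> ! n)))"
    by (intro arg_cong[of _ _ "(*) ?D"] sum.cong[OF refl]) (simp only: IH)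
  also have "\<dots> = ?x ^ (\<mu> ! n) * (?D * (\<Sum>\<nu> \<in> shapes. (\<Prod>j<n. ?x ^ (\<mu> ! j - \<nu> j)) * ?alt \<nu>))"
    unfolding sum_distrib_left by (rule sum.cong[OF refl]) (simp add: ac_simps)
  also have "\<dots> = alternant ?y (Suc n) (\<lambda>j. \<mu> ! j + (n - j))"
    using alternant_branching[of n "\<lambda>j. \<mu> ! j" ?y] dec_Suc by simp
  also have "\<dots> = alternant ?y (Suc n) ((!) (add_staircase \<mu>))"
    by (rule alternant_cong) (simp add: len nth_add_staircase)
  finally show ?case unfolding len .
qed


section \<open>Coefficients of Schur polynomials\<close>

lemma lookup_of_int_mult: "lookup (of_int c * (f :: mpoly)) k = c * lookup f k"
proof -
  have "(of_int c :: mpoly) = single 0 c" by (metis of_int_eq_id id_apply single_of_int)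
  then show ?thesis by (simp add: lookup_single_mult)
qed

lemma var_power: "var a ^ m = single (single a m) 1"
  by (induction m) (auto simp: var_def mult_single single_add[symmetric])

fun indexed_monom :: "nat list \<Rightarrow> nat list \<Rightarrow> nat \<Rightarrow>\<^sub>0 nat" where
  "indexed_monom (i # is) (a # as) = single i a + indexed_monom is as"
| "indexed_monom _ _ = 0"

lemma prod_var_power: "length is = length as \<Longrightarrow>
    (\<Prod>j<length as. var (is ! j) ^ (as ! j)) = single (indexed_monom is as) 1"
proof (induction "is" as rule: list_induct2)
  case (Cons i "is" a as)
  then show ?case unfolding length_Cons prod.lessThan_Suc_shift
    by (simp add: var_power mult_single)
qed simp

lemma monom_at_eq_indexed_monom: "monom_at k vs = indexed_monom [k..<k + length vs] vs"
  by (induction vs arbitrary: k) (simp_all add: upt_conv_Cons del: upt_Suc)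

lemma prod_var_power_consecutive:
  "(\<Prod>i<length vs. var (k + i) ^ (vs ! i)) = single (monom_at k vs) 1"
  using prod_var_power[of "[k..<k + length vs]" vs]
  by (simp add: monom_at_eq_indexed_monom del: upt_Suc)

lemma monom_at_inject: "length vs = length ws \<Longrightarrow> monom_at k vs = monom_at k ws \<longleftrightarrow> vs = ws"
proof
  assume len: "length vs = length ws" and eq: "monom_at k vs = monom_at k ws"
  show "vs = ws"
  proof (rule nth_equalityI[OF len])
    fix i assume "i < length vs"
    then show "vs ! i = ws ! i"
      using arg_cong[OF eq, of "\<lambda>m. lookup m (k + i)"] len by (simp add: lookup_monom_at)
  qed
qed simp

lemma add_staircase_strict:
  assumes "sorted_wrt (\<ge>) \<mu>"
  shows "sorted_wrt (>) (add_staircase \<mu>)"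
  unfolding sorted_wrt_iff_nth_less
proof (intro allI impI)
  fix i j assume "i < j" "j < length (add_staircase \<mu>)"
  then show "add_staircase \<mu> ! i > add_staircase \<mu> ! j"
    using sorted_wrt_ge_nth_mono[OF assms, of i j] by (simp add: nth_add_staircase)
qed

lemma add_staircase_inject:
  "length \<mu> = length \<nu> \<Longrightarrow> add_staircase \<mu> = add_staircase \<nu> \<longleftrightarrow> \<mu> = \<nu>"
  by (induction \<mu> \<nu> rule: list_induct2) auto

lemma strictly_decreasing_permute_list:
  assumes p: "p permutes {..<length xs}" and xs: "sorted_wrt (>) xs"
    and ys: "sorted_wrt (>) (permute_list p (xs :: 'a :: linorder list))"
  shows "p = id"
proof -
  have unique: "rev zs = sort xs" if "sorted_wrt (>) zs" "mset zs = mset xs" for zs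
    using that by (intro properties_for_sort[symmetric])
      (auto simp: sorted_wrt_rev elim: sorted_wrt_mono_rel[rotated])
  have eq: "permute_list p xs = xs"
    using unique[OF xs] unique[OF ys] p by (simp add: rev_swap)
  have "distinct xs" using xs by (induction xs) auto
  have "p i = i" if "i < length xs" for i
  proof -
    have "p i < length xs" using permutes_in_image[OF p, of i] that by simp
    moreover have "xs ! p i = xs ! i" using permute_list_nth[OF p that] eq by simp
    ultimately show ?thesis using \<open>distinct xs\<close> that by (simp add: nth_eq_iff_index_eq)
  qed
  then have "p i = i" for i using permutes_not_in[OF p, of i] by (cases "i < length xs") auto
  then show ?thesis by auto
qed

lemma alternant_var:
  "alternant (\<lambda>i. var (Suc i)) (length es) ((!) es) =
    (\<Sum>p | p permutes {..<length es}. of_int (sign p) * single (monom_at 1 (permute_list p es)) 1)"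
proof -
  have "(\<Prod>i = 0..<length es. var (Suc i) ^ (es ! p i)) = single (monom_at 1 (permute_list p es)) 1"
    if "p permutes {..<length es}" for p
    using prod_var_power_consecutive[where k = 1 and vs = "permute_list p es"]
      permute_list_nth[OF that]
    by (simp add: atLeast0LessThan)
  then show ?thesis
    unfolding alternant_def
    by (subst det_def'[of _ "length es"])
      (auto intro!: sum.cong simp: lessThan_atLeast0)
qed

lemma lookup_alternant_var:
  assumes es: "sorted_wrt (>) es" and es': "sorted_wrt (>) es'" and len: "length es' = length es"
  shows "lookup (alternant (\<lambda>i. var (Suc i)) (length es) ((!) es)) (monom_at 1 es') =
      (if es = es' then 1 else 0)"
proof -
  let ?P = "{p. p permutes {..<length es}}"
  have coeff: "lookup (single (monom_at 1 (permute_list p es)) 1) (monom_at 1 es') =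
      (if permute_list p es = es' then 1 else 0 :: int)" for p
    by (simp add: lookup_single when_def monom_at_inject len)
  have "permute_list p es = es' \<longleftrightarrow> p = id \<and> es = es'" if "p permutes {..<length es}" for p
    using strictly_decreasing_permute_list[OF that es] es' by auto
  then have "sign p * lookup (single (monom_at 1 (permute_list p es)) 1) (monom_at 1 es') =
      (if p = id then (if es = es' then 1 else 0) else 0)" if "p \<in> ?P" for p
    using that unfolding coeff by (simp add: sign_id)
  then have "lookup (alternant (\<lambda>i. var (Suc i)) (length es) ((!) es)) (monom_at 1 es') =
      (\<Sum>p \<in> ?P. if p = id then (if es = es' then 1 else 0) else 0)"
    unfolding alternant_var lookup_sum lookup_of_int_mult by (intro sum.cong refl)
  also have "\<dots> = (if es = es' then 1 else 0)"
    by (simp add: finite_permutations permutes_id)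
  finally show ?thesis .
qed

definition tab_content :: "nat list \<Rightarrow> nat \<Rightarrow>\<^sub>0 nat" where
  "tab_content xs = sum_list (map (\<lambda>x. single x 1) xs)"

lemma prod_list_var: "prod_list (map var xs) = single (tab_content xs) 1"
  by (induction xs) (auto simp: tab_content_def var_def mult_single)

lemma lookup_tab_content_pos: "x \<in> set xs \<Longrightarrow> lookup (tab_content xs) x > 0"
  by (induction xs) (auto simp: tab_content_def lookup_add lookup_single when_def)

lemma lookup_schur:
  "lookup (schur n \<mu>) m = (\<Sum>T \<in> SSYT n \<mu>. if tab_content (concat T) = m then 1 else 0)"
  by (auto simp: schur_def prod_list_var lookup_sum lookup_single when_def intro!: sum.cong)

lemma SSYT_mono: "n \<le> N \<Longrightarrow> SSYT n \<mu> \<subseteq> SSYT N \<mu>"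
  by (fastforce simp: SSYT_def)

lemma lookup_schur_fewer_variables:
  assumes "length v \<le> n" "n \<le> N"
  shows "lookup (schur N \<mu>) (monom_at 1 v) = lookup (schur n \<mu>) (monom_at 1 v)"
  unfolding lookup_schur
proof (rule sum.mono_neutral_right[OF finite_SSYT SSYT_mono[OF assms(2)]], rule ballI)
  fix T assume T: "T \<in> SSYT N \<mu> - SSYT n \<mu>"
  have "tab_content (concat T) \<noteq> monom_at 1 v"
  proof
    assume content: "tab_content (concat T) = monom_at 1 v"
    have "x \<in> {1..n}" if "x \<in> set (concat T)" for x
      using lookup_tab_content_pos[OF that] assms(1) unfolding content
      by (auto simp: lookup_monom_at split: if_splits)
    then have "T \<in> SSYT n \<mu>" using T unfolding SSYT_def by blast
    then show False using T by simp
  qed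
  then show "(if tab_content (concat T) = monom_at 1 v then 1 else 0) = 0" by simp
qed

lemma SSYT_append_zero: "SSYT n (\<mu> @ [0]) = (\<lambda>T. T @ [[]]) ` SSYT n \<mu>"
proof -
  have "T @ [[]] \<in> SSYT n (\<mu> @ [0]) \<longleftrightarrow> T \<in> SSYT n \<mu>" if len: "length T = length \<mu>" for T
    by (auto simp: SSYT_iff_nth len nth_append less_Suc_eq)
  moreover have "T \<in> (\<lambda>T. T @ [[]]) ` {T. length T = length \<mu>}" if "T \<in> SSYT n (\<mu> @ [0])" for T
    using that by (auto simp: SSYT_def map_eq_append_conv)
  ultimately show ?thesis using SSYT_length by blast
qed

lemma schur_append_zeros: "schur n (\<mu> @ replicate k 0) = schur n \<mu>"
proof (induction k arbitrary: \<mu>)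
  case (Suc k)
  have "schur n (\<mu> @ [0]) = schur n \<mu>"
    unfolding schur_def SSYT_append_zero by (subst sum.reindex) (auto intro: inj_onI)
  then show ?case using Suc[of "\<mu> @ [0]"] by simp
qed simp

lemma partitions_sorted: "\<mu> \<in> partitions \<Longrightarrow> sorted_wrt (\<ge>) \<mu>"
  and partitions_pos: "\<mu> \<in> partitions \<Longrightarrow> 0 \<notin> set \<mu>"
  by (auto simp: partitions_def compositions_def)

lemma schur_eq_0:
  assumes "\<mu> \<in> partitions" "n < length \<mu>"
  shows "schur n \<mu> = 0"
proof -
  have "0 < \<mu> ! n" using partitions_pos[OF assms(1)] nth_mem[OF assms(2)] by (metis gr0I)
  have False if T: "T \<in> SSYT n \<mu>" for T
  proof -
    have "T ! n ! 0 \<in> set (T ! n)" using SSYT_row[OF T assms(2)] \<open>0 < \<mu> ! n\<close> by simp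
    then have "T ! n ! 0 \<le> n" using SSYT_row[OF T assms(2)] by auto
    then show False
      using SSYT_entry_gt_row_index[OF T partitions_sorted[OF assms(1)] assms(2) \<open>0 < \<mu> ! n\<close>] by simp
  qed
  then show ?thesis by (auto simp: schur_def intro: sum.neutral)
qed

lemma lookup_vandermonde_mult_schur:
  assumes "sorted_wrt (\<ge>) \<kappa>" "sorted_wrt (\<ge>) \<mu>" "length \<kappa> = length \<mu>"
  shows "lookup (vandermonde 1 (length \<mu>) * schur (length \<mu>) \<kappa>) (monom_at 1 (add_staircase \<mu>)) =
    (if \<kappa> = \<mu> then 1 else 0)"
proof -
  have "vandermonde 1 (length \<mu>) * schur (length \<mu>) \<kappa> =
      alternant (\<lambda>i. var (Suc i)) (length (add_staircase \<kappa>)) ((!) (add_staircase \<kappa>))"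
    using vandermonde_mult_schur[OF assms(1)] assms(3) by simp
  then show ?thesis
    using lookup_alternant_var[OF add_staircase_strict[OF assms(1)] add_staircase_strict[OF assms(2)]]
      add_staircase_inject[OF assms(3)] assms(3) by simp
qed

theorem lookup_vandermonde_mult_schur_partition:
  assumes \<kappa>: "\<kappa> \<in> partitions" and \<mu>: "\<mu> \<in> partitions"
  shows "lookup (vandermonde 1 (length \<mu>) * schur (length \<mu>) \<kappa>) (monom_at 1 (add_staircase \<mu>)) =
    (if \<kappa> = \<mu> then 1 else 0)"
proof (cases "length \<kappa> \<le> length \<mu>")
  case False
  then show ?thesis using schur_eq_0[OF \<kappa>, of "length \<mu>"] by auto
next
  case True
  let ?\<kappa> = "\<kappa> @ replicate (length \<mu> - length \<kappa>) 0"
  have "?\<kappa> = \<mu> \<longleftrightarrow> \<kappa> = \<mu>"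
  proof
    assume padded: "?\<kappa> = \<mu>"
    then have "0 \<notin> set ?\<kappa>" using partitions_pos[OF \<mu>] by simp
    then show "\<kappa> = \<mu>" using padded by (cases "length \<mu> - length \<kappa>") auto
  qed simp
  moreover have "sorted_wrt (\<ge>) ?\<kappa>"
    using partitions_sorted[OF \<kappa>]
    by (simp add: sorted_wrt_append) (simp add: sorted_wrt_iff_nth_less)
  ultimately show ?thesis
    using lookup_vandermonde_mult_schur[of ?\<kappa> \<mu>] partitions_sorted[OF \<mu>] True
    by (simp add: schur_append_zeros)
qed

theorem leaf_sum_raise_parts_schur_expansion:
  assumes expansion: "expands_in (schur N) (partitions_upto N) g d" and \<mu>: "\<mu> \<in> partitions_upto N"
  shows "leaf_sum (raise_parts (rev \<mu>) [] False)
      (\<lambda>(v, p). parity_sign p * lookup g (monom_at 1 v)) = d \<mu>"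
proof -
  let ?I = "{\<kappa> \<in> partitions_upto N. d \<kappa> \<noteq> 0}" and ?n = "length \<mu>"
  have fin: "finite ?I" and g: "g = (\<Sum>\<kappa> \<in> ?I. of_int (d \<kappa>) * schur N \<kappa>)"
    using expansion by (auto simp: expands_in_def)
  define g' where "g' = (\<Sum>\<kappa> \<in> ?I. of_int (d \<kappa>) * schur ?n \<kappa>)"
  have "lookup g (monom_at 1 v) = lookup g' (0 + monom_at 1 v)"
    if "(v, p) \<in> set_choice_tree (raise_parts (rev \<mu>) [] False)" for v p
  proof -
    have "lookup (schur N \<kappa>) (monom_at 1 v) = lookup (schur ?n \<kappa>) (monom_at 1 v)" for \<kappa>
      using raise_parts_sizes[OF that] \<mu>
      by (intro lookup_schur_fewer_variables) (auto simp: partitions_upto_def)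
    then show ?thesis by (simp only: g g'_def lookup_sum lookup_of_int_mult add_0)
  qed
  then have "leaf_sum (raise_parts (rev \<mu>) [] False)
      (\<lambda>(v, p). parity_sign p * lookup g (monom_at 1 v)) =
      leaf_sum (raise_parts (rev \<mu>) [] False)
        (\<lambda>(v, p). parity_sign p * lookup g' (0 + monom_at 1 v))"
    by (intro leaf_sum_cong) auto
  also have "\<dots> = lookup (vandermonde 1 ?n * g') (monom_at 1 (add_staircase \<mu>))"
    using leaf_sum_raise_parts[of 1 0 \<mu> False g'] by simp
  also have "\<dots> =
      (\<Sum>\<kappa> \<in> ?I. d \<kappa> * lookup (vandermonde 1 ?n * schur ?n \<kappa>) (monom_at 1 (add_staircase \<mu>)))"
    by (simp add: g'_def sum_distrib_left mult.left_commute[of _ "of_int _"] lookup_sum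
        lookup_of_int_mult)
  also have "\<dots> = (\<Sum>\<kappa> \<in> ?I. if \<kappa> = \<mu> then d \<mu> else 0)"
  proof (rule sum.cong[OF refl])
    fix \<kappa> assume "\<kappa> \<in> ?I"
    then have "\<kappa> \<in> partitions" "\<mu> \<in> partitions" using \<mu> by (auto simp: partitions_upto_def)
    from lookup_vandermonde_mult_schur_partition[OF this]
    show "d \<kappa> * lookup (vandermonde 1 ?n * schur ?n \<kappa>) (monom_at 1 (add_staircase \<mu>)) =
        (if \<kappa> = \<mu> then d \<mu> else 0)" by simp
  qed
  also have "\<dots> = d \<mu>" using fin \<mu> by simp
  finally show ?thesis .
qed

section \<open>Coefficients of quasisymmetric polynomials\<close>

definition nonzero_exponents :: "(nat \<Rightarrow>\<^sub>0 nat) \<Rightarrow> nat list" where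
  "nonzero_exponents m = map (lookup m) (sorted_list_of_set (Poly_Mapping.keys m))"

lemma nonzero_exponents_composition: "nonzero_exponents m \<in> compositions"
  by (auto simp: compositions_def nonzero_exponents_def in_keys_iff)

lemma nonzero_exponents_upto:
  "Poly_Mapping.keys m \<subseteq> {1..N} \<Longrightarrow> nonzero_exponents m \<in> compositions_upto N"
  using card_mono[of "{1..N}" "Poly_Mapping.keys m"] nonzero_exponents_composition
  by (simp add: compositions_upto_def nonzero_exponents_def)

lemma lookup_indexed_monom:
  "length is = length as \<Longrightarrow> distinct is \<Longrightarrow>
    lookup (indexed_monom is as) i = (case map_of (zip is as) i of None \<Rightarrow> 0 | Some a \<Rightarrow> a)"
  by (induction "is" as rule: list_induct2)
    (auto simp: lookup_add lookup_single when_def split: option.splits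
      dest: map_of_SomeD set_zip_leftD)

lemma indexed_monom_eq_iff:
  assumes len: "length is = length as" and sorted: "sorted_wrt (<) is" and pos: "0 \<notin> set as"
  shows "indexed_monom is as = m \<longleftrightarrow>
      is = sorted_list_of_set (Poly_Mapping.keys m) \<and> as = nonzero_exponents m"
proof
  have dist: "distinct is" using sorted by (simp add: strict_sorted_iff)
  assume m: "indexed_monom is as = m"
  have lookup_nth: "lookup m (is ! j) = as ! j" if "j < length is" for j
    using map_of_zip_nth[OF len dist, of j] that len lookup_indexed_monom[OF len dist] m by auto
  have "Poly_Mapping.keys m = set is"
  proof -
    have "lookup m i \<noteq> 0 \<longleftrightarrow> i \<in> set is" for i
    proof
      assume "lookup m i \<noteq> 0"
      then show "i \<in> set is" using lookup_indexed_monom[OF len dist, of i] len m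
        by (auto split: option.splits dest: map_of_SomeD set_zip_leftD)
    next
      assume "i \<in> set is"
      then obtain j where "j < length is" "i = is ! j" by (metis in_set_conv_nth)
      then show "lookup m i \<noteq> 0" using lookup_nth len pos nth_mem by metis
    qed
    then show ?thesis by (auto simp: in_keys_iff)
  qed
  then have "is = sorted_list_of_set (Poly_Mapping.keys m)"
    using sorted by (simp add: sorted_list_of_set.idem_if_sorted_distinct strict_sorted_iff)
  moreover have "as = map (lookup m) is" using lookup_nth len by (simp add: list_eq_iff_nth_eq)
  ultimately show "is = sorted_list_of_set (Poly_Mapping.keys m) \<and> as = nonzero_exponents m"
    by (simp add: nonzero_exponents_def)
next
  assume "is = sorted_list_of_set (Poly_Mapping.keys m) \<and> as = nonzero_exponents m"
  then show "indexed_monom is as = m"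
    by (intro poly_mapping_eqI)
      (auto simp: nonzero_exponents_def lookup_indexed_monom map_of_zip_map in_keys_iff)
qed

lemma lookup_monomial_qsym:
  assumes \<alpha>: "\<alpha> \<in> compositions" and m: "Poly_Mapping.keys m \<subseteq> {1..N}"
  shows "lookup (monomial_qsym N \<alpha>) m = (if nonzero_exponents m = \<alpha> then 1 else 0)"
proof -
  let ?J = "{is. length is = length \<alpha> \<and> sorted_wrt (<) is \<and> set is \<subseteq> {1..N}}"
  let ?is = "sorted_list_of_set (Poly_Mapping.keys m)"
  have fin: "finite ?J"
    by (rule finite_subset[OF _ finite_lists_length_eq[of "{1..N}" "length \<alpha>"]]) auto
  have "lookup (monomial_qsym N \<alpha>) m = (\<Sum>is \<in> ?J. if indexed_monom is \<alpha> = m then 1 else 0)"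
    unfolding monomial_qsym_def lookup_sum
    by (rule sum.cong[OF refl]) (auto simp: prod_var_power lookup_single when_def)
  also have "\<dots> = (\<Sum>is \<in> ?J. if is = ?is then (if nonzero_exponents m = \<alpha> then 1 else 0) else 0)"
  proof (rule sum.cong[OF refl])
    fix "is" assume "is \<in> ?J"
    then have "indexed_monom is \<alpha> = m \<longleftrightarrow> is = ?is \<and> \<alpha> = nonzero_exponents m"
      using \<alpha> by (intro indexed_monom_eq_iff) (auto simp: compositions_def)
    then show "(if indexed_monom is \<alpha> = m then 1 else (0 :: int)) =
      (if is = ?is then (if nonzero_exponents m = \<alpha> then 1 else 0) else 0)" by auto
  qed
  also have "\<dots> = (if ?is \<in> ?J then (if nonzero_exponents m = \<alpha> then 1 else 0) else 0)"
    by (rule sum.delta[OF fin])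
  also have "\<dots> = (if nonzero_exponents m = \<alpha> then 1 else 0)"
    using m by (auto simp: nonzero_exponents_def)
  finally show ?thesis .
qed

lemma comp_refines_length: "comp_refines \<beta> \<alpha> \<Longrightarrow> length \<alpha> \<le> length \<beta>"
proof -
  have "[] \<notin> set bs \<Longrightarrow> length bs \<le> length (concat bs)" for bs :: "nat list list"
  proof (induction bs)
    case (Cons b bs)
    then show ?case by (cases b) auto
  qed simp
  then show "comp_refines \<beta> \<alpha> \<Longrightarrow> length \<alpha> \<le> length \<beta>" by (auto simp: comp_refines_def)
qed

lemma comp_refines_sum_list: "comp_refines \<beta> \<alpha> \<Longrightarrow> sum_list \<beta> = sum_list \<alpha>"
proof -
  have "sum_list (concat bs) = sum_list (map sum_list bs)" for bs :: "nat list list"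
    by (induction bs) auto
  then show "comp_refines \<beta> \<alpha> \<Longrightarrow> sum_list \<beta> = sum_list \<alpha>" by (auto simp: comp_refines_def)
qed

lemma comp_refines_composition:
  assumes "comp_refines \<beta> \<alpha>" "\<beta> \<in> compositions"
  shows "\<alpha> \<in> compositions"
proof -
  obtain bs where bs: "[] \<notin> set bs" "concat bs = \<beta>" "map sum_list bs = \<alpha>"
    using assms(1) by (auto simp: comp_refines_def)
  have "sum_list b > 0" if "b \<in> set bs" for b
  proof -
    have "b \<noteq> []" using that bs(1) by auto
    then have "hd b \<in> set \<beta>" using that hd_in_set bs(2) by fastforce
    then have "0 < hd b" using assms(2) by (simp add: compositions_def)
    then show ?thesis using \<open>b \<noteq> []\<close> by (cases b) auto
  qed
  then show ?thesis using bs(3) by (auto simp: compositions_def)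
qed

lemma composition_length_le: "\<beta> \<in> compositions \<Longrightarrow> length \<beta> \<le> sum_list \<beta>"
  by (induction \<beta>) (auto simp: compositions_def)

lemma finite_refinements: "finite {\<beta>. \<beta> \<in> compositions \<and> comp_refines \<beta> \<alpha>}"
proof (rule finite_subset)
  show "{\<beta>. \<beta> \<in> compositions \<and> comp_refines \<beta> \<alpha>} \<subseteq>
      {\<beta>. set \<beta> \<subseteq> {..sum_list \<alpha>} \<and> length \<beta> \<le> sum_list \<alpha>}"
  proof
    fix \<beta> assume "\<beta> \<in> {\<beta>. \<beta> \<in> compositions \<and> comp_refines \<beta> \<alpha>}"
    then have "\<beta> \<in> compositions" "sum_list \<beta> = sum_list \<alpha>" by (auto dest: comp_refines_sum_list)
    then show "\<beta> \<in> {\<beta>. set \<beta> \<subseteq> {..sum_list \<alpha>} \<and> length \<beta> \<le> sum_list \<alpha>}"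
      using composition_length_le[of \<beta>] member_le_sum_list[of _ \<beta>] by auto
  qed
  show "finite {\<beta>. set \<beta> \<subseteq> {..sum_list \<alpha>} \<and> length \<beta> \<le> sum_list \<alpha>}"
    by (rule finite_lists_length_le) simp
qed

lemma lookup_fundamental_qsym:
  assumes "Poly_Mapping.keys m \<subseteq> {1..N}"
  shows "lookup (fundamental_qsym N \<alpha>) m = (if comp_refines (nonzero_exponents m) \<alpha> then 1 else 0)"
proof -
  let ?R = "{\<beta>. \<beta> \<in> compositions \<and> comp_refines \<beta> \<alpha>}"
  have "lookup (fundamental_qsym N \<alpha>) m = (\<Sum>\<beta> \<in> ?R. if \<beta> = nonzero_exponents m then 1 else 0)"
    unfolding fundamental_qsym_def lookup_sum
    by (rule sum.cong) (auto simp: lookup_monomial_qsym[OF _ assms])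
  also have "\<dots> = (if nonzero_exponents m \<in> ?R then 1 else 0)"
    by (rule sum.delta[OF finite_refinements])
  finally show ?thesis using nonzero_exponents_composition by simp
qed

lemma comp_refines_Nil: "comp_refines [] \<gamma> \<longleftrightarrow> \<gamma> = []"
proof
  show "comp_refines [] \<gamma> \<Longrightarrow> \<gamma> = []" using comp_refines_length[of "[]" \<gamma>] by simp
qed (simp add: comp_refines_def)

lemma comp_refines_Cons:
  "comp_refines (x # xs) \<gamma> \<longleftrightarrow>
    (\<exists>ys zs \<beta>. xs = ys @ zs \<and> \<gamma> = (x + sum_list ys) # \<beta> \<and> comp_refines zs \<beta>)" (is "_ \<longleftrightarrow> ?rhs")
proof
  assume "comp_refines (x # xs) \<gamma>"
  then obtain bs where bs: "[] \<notin> set bs" "concat bs = x # xs" "map sum_list bs = \<gamma>"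
    by (auto simp: comp_refines_def)
  then obtain ys bs' where "bs = (x # ys) # bs'"
    by (cases bs; cases "hd bs") auto
  then have "xs = ys @ concat bs'" "\<gamma> = (x + sum_list ys) # map sum_list bs'"
    "comp_refines (concat bs') (map sum_list bs')"
    using bs by (auto simp: comp_refines_def)
  then show ?rhs by blast
next
  assume ?rhs
  then obtain ys bs where "[] \<notin> set bs" "xs = ys @ concat bs"
    "\<gamma> = (x + sum_list ys) # map sum_list bs"
    by (auto simp: comp_refines_def)
  then show "comp_refines (x # xs) \<gamma>"
    unfolding comp_refines_def by (intro exI[of _ "(x # ys) # bs"]) simp
qed

lemma comp_refines_Cons_Cons:
  "comp_refines (x # y # ys) \<gamma> \<longleftrightarrow>
    (\<exists>\<beta>. \<gamma> = x # \<beta> \<and> comp_refines (y # ys) \<beta>) \<or> comp_refines ((x + y) # ys) \<gamma>"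
proof -
  have split_Cons: "(\<exists>us zs. y # ys = us @ zs \<and> R us zs) \<longleftrightarrow>
      R [] (y # ys) \<or> (\<exists>us zs. ys = us @ zs \<and> R (y # us) zs)" for R
    by (auto simp: Cons_eq_append_conv)
  show ?thesis
    using split_Cons[of "\<lambda>us zs. \<exists>\<beta>. \<gamma> = (x + sum_list us) # \<beta> \<and> comp_refines zs \<beta>"]
    unfolding comp_refines_Cons[of x "y # ys"] comp_refines_Cons[of "x + y" ys]
    by (simp add: add.assoc)
qed

text \<open>The coarsenings of \<open>ps\<close> after \<open>a\<close> has been added to its first part.\<close>

fun coarsening_set :: "nat \<Rightarrow> nat list \<Rightarrow> nat list set" where
  "coarsening_set a [] = (if a = 0 then {[]} else {})"
| "coarsening_set a (p # ps) = (#) (a + p) ` coarsening_set 0 ps \<union> coarsening_set (a + p) ps"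

lemma finite_coarsening_set: "finite (coarsening_set a ps)"
  by (induction ps arbitrary: a) auto

lemma coarsening_set_hd:
  "\<beta> \<in> coarsening_set a ps \<Longrightarrow> 0 < a \<Longrightarrow> 0 \<notin> set ps \<Longrightarrow> \<beta> \<noteq> [] \<and> a < hd \<beta>"
  by (induction ps arbitrary: a) (fastforce split: if_splits)+

lemma coarsening_set_Cons:
  "0 < p \<Longrightarrow> 0 \<notin> set ps \<Longrightarrow> coarsening_set a (p # ps) = {\<beta>. comp_refines ((a + p) # ps) \<beta>}"
proof (induction ps arbitrary: a p)
  case Nil
  then show ?case by (auto simp: comp_refines_Cons comp_refines_Nil)
next
  case (Cons q qs)
  then have "coarsening_set 0 (q # qs) = {\<beta>. comp_refines (q # qs) \<beta>}"
    "coarsening_set (a + p) (q # qs) = {\<beta>. comp_refines ((a + p + q) # qs) \<beta>}"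
    using Cons.IH[of q 0] Cons.IH[of q "a + p"] by simp_all
  then show ?case
    by (auto simp: comp_refines_Cons_Cons coarsening_set.simps(2)[of a p]
      simp del: coarsening_set.simps(2))
qed

lemma coarsening_set_eq: "ps \<in> compositions \<Longrightarrow> coarsening_set 0 ps = {\<beta>. comp_refines ps \<beta>}"
  by (cases ps) (auto simp: comp_refines_Nil coarsening_set_Cons compositions_def
    simp del: coarsening_set.simps(2))

definition nonzero_parts :: "nat list \<Rightarrow> nat list" where
  "nonzero_parts v = filter (\<lambda>a. a \<noteq> 0) v"

lemma nonzero_parts_simps [simp]:
  "nonzero_parts [] = []"
  "nonzero_parts (a # v) = (if a = 0 then nonzero_parts v else a # nonzero_parts v)"
  by (simp_all add: nonzero_parts_def)

lemma nonzero_parts_composition: "nonzero_parts v \<in> compositions"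
  by (auto simp: nonzero_parts_def compositions_def)

lemma keys_monom_at: "Poly_Mapping.keys (monom_at k v) = {i \<in> {k..<k + length v}. v ! (i - k) \<noteq> 0}"
  by (auto simp: in_keys_iff lookup_monom_at split: if_splits)

lemma nonzero_exponents_monom_at: "nonzero_exponents (monom_at k v) = nonzero_parts v"
proof -
  let ?is = "filter (\<lambda>i. v ! (i - k) \<noteq> 0) [k..<k + length v]"
  have "sorted_list_of_set (Poly_Mapping.keys (monom_at k v)) = ?is"
    by (rule sorted_distinct_set_unique) (auto simp: keys_monom_at sorted_wrt_filter)
  moreover have "map (lookup (monom_at k v)) ?is =
      filter (\<lambda>a. a \<noteq> 0) (map (\<lambda>i. v ! (i - k)) [k..<k + length v])"
    unfolding filter_map comp_def by (rule map_cong) (auto simp: lookup_monom_at)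
  moreover have "map (\<lambda>i. v ! (i - k)) [k..<k + length v] = v"
    by (rule nth_equalityI) auto
  ultimately show ?thesis by (simp add: nonzero_exponents_def nonzero_parts_def)
qed

lemma keys_monom_at_1: "length v \<le> N \<Longrightarrow> Poly_Mapping.keys (monom_at 1 v) \<subseteq> {1..N}"
  by (auto simp: keys_monom_at)

lemma leaf_sum_merge_parts:
  "leaf_sum (merge_parts False \<alpha> a vs) (\<lambda>(\<beta>, b). if b = 0 then H \<beta> else 0) =
    (\<Sum>\<beta> \<in> coarsening_set a (nonzero_parts vs). H (\<alpha> @ \<beta>))"
proof (induction vs arbitrary: a \<alpha>)
  case (Cons v vs)
  let ?ps = "nonzero_parts vs"
  show ?case
  proof (cases "v = 0")
    case False
    have "(#) (a + v) ` coarsening_set 0 ?ps \<inter> coarsening_set (a + v) ?ps = {}"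
    proof (rule equals0I)
      fix \<beta> assume "\<beta> \<in> (#) (a + v) ` coarsening_set 0 ?ps \<inter> coarsening_set (a + v) ?ps"
      then have "hd \<beta> = a + v" "\<beta> \<in> coarsening_set (a + v) ?ps" by auto
      then show False
        using coarsening_set_hd[of \<beta> "a + v" ?ps] False by (simp add: nonzero_parts_def)
    qed
    then have "(\<Sum>\<beta> \<in> coarsening_set a (nonzero_parts (v # vs)). H (\<alpha> @ \<beta>)) =
        (\<Sum>\<beta> \<in> (#) (a + v) ` coarsening_set 0 ?ps. H (\<alpha> @ \<beta>)) +
        (\<Sum>\<beta> \<in> coarsening_set (a + v) ?ps. H (\<alpha> @ \<beta>))"
      using False by (simp add: sum.union_disjoint finite_coarsening_set)
    also have "(\<Sum>\<beta> \<in> (#) (a + v) ` coarsening_set 0 ?ps. H (\<alpha> @ \<beta>)) =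
        (\<Sum>\<beta> \<in> coarsening_set 0 ?ps. H ((\<alpha> @ [a + v]) @ \<beta>))"
      by (subst sum.reindex) auto
    finally show ?thesis
      using False Cons[of "\<alpha> @ [a + v]" 0] Cons[of \<alpha> "a + v"] by (simp add: add.commute)
  qed (use Cons in simp)
qed simp

lemma leaf_sum_coarsenings:
  "leaf_sum (coarsenings False v) H = (\<Sum>\<beta> | comp_refines (nonzero_parts v) \<beta>. H \<beta>)"
  using leaf_sum_merge_parts[of "[]" 0 v H]
  by (simp add: coarsenings_def leaf_sum_bind case_prod_unfold if_distrib[of "\<lambda>t. leaf_sum t _"]
      coarsening_set_eq[OF nonzero_parts_composition] cong: if_cong)

lemma leaf_sum_coarsenings_strict: "leaf_sum (coarsenings True v) H = H (nonzero_parts v)"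
proof -
  have "leaf_sum (merge_parts True \<alpha> 0 v) (\<lambda>(\<beta>, b). if b = 0 then H \<beta> else 0) =
      H (\<alpha> @ nonzero_parts v)" for \<alpha>
    by (induction v arbitrary: \<alpha>) simp_all
  then show ?thesis
    by (simp add: coarsenings_def leaf_sum_bind case_prod_unfold if_distrib[of "\<lambda>t. leaf_sum t _"]
      cong: if_cong)
qed

lemma merge_parts_composition:
  "(\<alpha>', a') \<in> set_choice_tree (merge_parts strict \<alpha> a vs) \<Longrightarrow> \<alpha> \<in> compositions \<Longrightarrow> \<alpha>' \<in> compositions"
  by (induction vs arbitrary: \<alpha> a) (fastforce simp: compositions_def split: if_splits)+

lemma coarsenings_upto:
  "\<alpha> \<in> set_choice_tree (coarsenings strict v) \<Longrightarrow> length v \<le> N \<Longrightarrow> \<alpha> \<in> compositions_upto N"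
proof -
  assume \<alpha>: "\<alpha> \<in> set_choice_tree (coarsenings strict v)" and "length v \<le> N"
  then have "length \<alpha> \<le> N" using coarsenings_sizes[OF \<alpha>] by simp
  moreover have "\<alpha> \<in> compositions"
    using \<alpha>
    by (auto simp: coarsenings_def set_bind_tree compositions_def
        dest!: merge_parts_composition split: if_splits)
  ultimately show ?thesis by (simp add: compositions_upto_def)
qed

section \<open>Schur coefficients of quasisymmetric expansions\<close>

lemma lookup_fundamental_expansion:
  assumes expansion: "expands_in (fundamental_qsym N) (compositions_upto N) g c"
    and v: "length v \<le> N"
  shows "lookup g (monom_at 1 v) = leaf_sum (coarsenings False v) c"
proof -
  let ?I = "{\<alpha> \<in> compositions_upto N. c \<alpha> \<noteq> 0}" and ?C = "{\<alpha>. comp_refines (nonzero_parts v) \<alpha>}"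
  have fin: "finite ?I" and g: "g = (\<Sum>\<alpha> \<in> ?I. of_int (c \<alpha>) * fundamental_qsym N \<alpha>)"
    using expansion by (auto simp: expands_in_def)
  have lookup: "lookup (fundamental_qsym N \<alpha>) (monom_at 1 v) = (if \<alpha> \<in> ?C then 1 else 0)" for \<alpha>
    using lookup_fundamental_qsym[OF keys_monom_at_1[OF v]]
    by (simp only: nonzero_exponents_monom_at mem_Collect_eq)
  have "lookup g (monom_at 1 v) = (\<Sum>\<alpha> \<in> ?I. if \<alpha> \<in> ?C then c \<alpha> else 0)"
    unfolding g lookup_sum lookup_of_int_mult lookup by (rule sum.cong) auto
  also have "\<dots> = (\<Sum>\<alpha> \<in> ?I \<inter> ?C. c \<alpha>)" by (rule sum.inter_restrict[OF fin, symmetric])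
  also have "\<dots> = (\<Sum>\<alpha> \<in> ?C. c \<alpha>)"
  proof (rule sum.mono_neutral_left)
    show "finite ?C"
      using finite_coarsening_set[of 0] coarsening_set_eq[OF nonzero_parts_composition] by metis
    have "length (nonzero_parts v) \<le> N"
      using v length_filter_le le_trans unfolding nonzero_parts_def by blast
    then have "?C \<subseteq> compositions_upto N"
      using comp_refines_length comp_refines_composition[OF _ nonzero_parts_composition]
      by (fastforce simp: compositions_upto_def)
    then show "\<forall>\<alpha> \<in> ?C - ?I \<inter> ?C. c \<alpha> = 0" by auto
  qed simp
  finally show ?thesis unfolding leaf_sum_coarsenings .
qed

lemma lookup_monomial_expansion:
  assumes expansion: "expands_in (monomial_qsym N) (compositions_upto N) g c" and v: "length v \<le> N"
  shows "lookup g (monom_at 1 v) = leaf_sum (coarsenings True v) c"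
proof -
  let ?I = "{\<alpha> \<in> compositions_upto N. c \<alpha> \<noteq> 0}" and ?\<alpha> = "nonzero_parts v"
  have fin: "finite ?I" and g: "g = (\<Sum>\<alpha> \<in> ?I. of_int (c \<alpha>) * monomial_qsym N \<alpha>)"
    using expansion by (auto simp: expands_in_def)
  note keys = keys_monom_at_1[OF v]
  have "lookup (monomial_qsym N \<alpha>) (monom_at 1 v) = (if \<alpha> = ?\<alpha> then 1 else 0)" if "\<alpha> \<in> ?I" for \<alpha>
    using lookup_monomial_qsym[OF _ keys, of \<alpha>] that
    by (auto simp: nonzero_exponents_monom_at compositions_upto_def)
  then have "lookup g (monom_at 1 v) = (\<Sum>\<alpha> \<in> ?I. if \<alpha> = ?\<alpha> then c ?\<alpha> else 0)"
    unfolding g lookup_sum lookup_of_int_mult by (intro sum.cong) auto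
  also have "\<dots> = c ?\<alpha>"
    using nonzero_exponents_upto[OF keys] fin by (simp add: nonzero_exponents_monom_at)
  finally show ?thesis unfolding leaf_sum_coarsenings_strict .
qed

lemma leaf_sum_schur_coeff_tree:
  assumes "expands_in (schur N) (partitions_upto N) g d" "\<mu> \<in> partitions_upto N"
    and coeff: "\<And>v. length v \<le> N \<Longrightarrow> lookup g (monom_at 1 v) = leaf_sum (coarsenings strict v) c"
  shows "leaf_sum (schur_coeff_tree strict \<mu>) (\<lambda>(p, \<alpha>). parity_sign p * c \<alpha>) = d \<mu>"
proof -
  have "leaf_sum (schur_coeff_tree strict \<mu>) (\<lambda>(p, \<alpha>). parity_sign p * c \<alpha>) =
      leaf_sum (raise_parts (rev \<mu>) [] False)
        (\<lambda>(v, p). parity_sign p * leaf_sum (coarsenings strict v) c)"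
    by (simp only: schur_coeff_tree_def leaf_sum_bind leaf_sum_map leaf_sum_mult_left case_prod_unfold
        fst_conv snd_conv)
  also have "\<dots> =
      leaf_sum (raise_parts (rev \<mu>) [] False) (\<lambda>(v, p). parity_sign p * lookup g (monom_at 1 v))"
  proof (rule leaf_sum_cong, clarify)
    fix v p assume "(v, p) \<in> set_choice_tree (raise_parts (rev \<mu>) [] False)"
    then have "length v \<le> N"
      using assms(2) raise_parts_sizes by (fastforce simp: partitions_upto_def)
    then show "parity_sign p * leaf_sum (coarsenings strict v) c =
        parity_sign p * lookup g (monom_at 1 v)"
      by (simp only: coeff)
  qed
  also have "\<dots> = d \<mu>" using assms(1,2) by (rule leaf_sum_raise_parts_schur_expansion)
  finally show ?thesis .
qed

lemma schur_coeff_tree_upto: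
  "(p, \<alpha>) \<in> set_choice_tree (schur_coeff_tree strict \<mu>) \<Longrightarrow> length \<mu> \<le> N \<Longrightarrow> \<alpha> \<in> compositions_upto N"
  by (auto simp: schur_coeff_tree_def set_bind_tree choice_tree.set_map dest!: raise_parts_sizes
    intro: coarsenings_upto)

theorem gapP_on_schur_coefficients:
  fixes A :: "nat \<Rightarrow> bool list set" and G :: "bool list \<Rightarrow> mpoly" and c d :: "bool list \<Rightarrow> nat list \<Rightarrow> int"
  assumes c: "gapP_on {(w, \<alpha>). \<exists>n. w \<in> A n \<and> \<alpha> \<in> compositions_upto n} encode (\<lambda>(w, \<alpha>). c w \<alpha>)"
    and d: "\<And>n w. w \<in> A n \<Longrightarrow> expands_in (schur n) (partitions_upto n) (G w) (d w)"
    and coeff: "\<And>n w v. w \<in> A n \<Longrightarrow> length v \<le> n \<Longrightarrow>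
      lookup (G w) (monom_at 1 v) = leaf_sum (coarsenings strict v) (c w)"
  shows "gapP_on {(w, \<mu>). \<exists>n. w \<in> A n \<and> \<mu> \<in> partitions_upto n} encode (\<lambda>(w, \<mu>). d w \<mu>)"
proof -
  obtain h where h: "h \<in> GapP"
    and c_h: "\<And>w \<alpha> n. w \<in> A n \<Longrightarrow> \<alpha> \<in> compositions_upto n \<Longrightarrow> c w \<alpha> = h (encode (w, \<alpha>))"
    using c unfolding gapP_on_def by fastforce
  obtain h' where h': "h' \<in> GapP" "\<And>w \<mu>. h' (encode (w, \<mu>)) =
      leaf_sum (schur_coeff_tree strict \<mu>) (\<lambda>(p, \<alpha>). parity_sign p * h (encode (w, \<alpha>)))"
    using GapP_schur_coeff_tree[OF h] by blast
  have "d w \<mu> = h' (encode (w, \<mu>))" if w: "w \<in> A n" and \<mu>: "\<mu> \<in> partitions_upto n" for w \<mu> n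
  proof -
    have "d w \<mu> = leaf_sum (schur_coeff_tree strict \<mu>) (\<lambda>(p, \<alpha>). parity_sign p * c w \<alpha>)"
      using leaf_sum_schur_coeff_tree[OF d[OF w] \<mu> coeff[OF w]] by simp
    also have "\<dots> = h' (encode (w, \<mu>))"
      unfolding h'(2)
    proof (rule leaf_sum_cong, clarify)
      fix p \<alpha> assume "(p, \<alpha>) \<in> set_choice_tree (schur_coeff_tree strict \<mu>)"
      then have "\<alpha> \<in> compositions_upto n"
        using \<mu> schur_coeff_tree_upto by (auto simp: partitions_upto_def)
      then show "parity_sign p * c w \<alpha> = parity_sign p * h (encode (w, \<alpha>))" using c_h[OF w] by simp
    qed
    finally show ?thesis .
  qed
  then show ?thesis unfolding gapP_on_def using h'(1) by (intro bexI[of _ h']) auto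
qed

theorem theorem8p1:
  fixes A :: "nat \<Rightarrow> bool list set"
    and G :: "bool list \<Rightarrow> mpoly"
    and c d :: "bool list \<Rightarrow> nat list \<Rightarrow> int"
  assumes size: "\<forall>n. \<forall>w \<in> A n. length w = n"
    and sym: "\<forall>n. \<forall>w \<in> A n. symmetric_poly n (G w)"
    and c_gapP: "gapP_on {(w, \<alpha>). \<exists>n. w \<in> A n \<and> \<alpha> \<in> compositions_upto n} encode (\<lambda>(w, \<alpha>). c w \<alpha>)"
    and d: "\<forall>n. \<forall>w \<in> A n. expands_in (schur n) (partitions_upto n) (G w) (d w)"
  shows "((\<forall>n. \<forall>w \<in> A n. expands_in (fundamental_qsym n) (compositions_upto n) (G w) (c w)) \<longrightarrow>
            gapP_on {(w, \<mu>). \<exists>n. w \<in> A n \<and> \<mu> \<in> partitions_upto n} encode (\<lambda>(w, \<mu>). d w \<mu>))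
       \<and> ((\<forall>n. \<forall>w \<in> A n. expands_in (monomial_qsym n) (compositions_upto n) (G w) (c w)) \<longrightarrow>
            gapP_on {(w, \<mu>). \<exists>n. w \<in> A n \<and> \<mu> \<in> partitions_upto n} encode (\<lambda>(w, \<mu>). d w \<mu>))"
proof (intro conjI impI)
  assume "\<forall>n. \<forall>w \<in> A n. expands_in (fundamental_qsym n) (compositions_upto n) (G w) (c w)"
  then show "gapP_on {(w, \<mu>). \<exists>n. w \<in> A n \<and> \<mu> \<in> partitions_upto n} encode (\<lambda>(w, \<mu>). d w \<mu>)"
    using d
    by (intro gapP_on_schur_coefficients[where strict = False, OF c_gapP])
      (blast intro: lookup_fundamental_expansion)+
next
  assume "\<forall>n. \<forall>w \<in> A n. expands_in (monomial_qsym n) (compositions_upto n) (G w) (c w)"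
  then show "gapP_on {(w, \<mu>). \<exists>n. w \<in> A n \<and> \<mu> \<in> partitions_upto n} encode (\<lambda>(w, \<mu>). d w \<mu>)"
    using d
    by (intro gapP_on_schur_coefficients[where strict = True, OF c_gapP])
      (blast intro: lookup_monomial_expansion)+
qed

end
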